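(* Let $n\ge 3$ and let $\mathcal O$ be the ring of integers of an imaginary quadratic extension $F/\mathbb Q$ (with $F\subset\mathbb C$). Then there does not exist a closed subgroup $G$ of $\mathrm{SL}_n(\mathbb C)$ such that $G$ is isogenous to $\mathrm{SL}_n(\mathbb R)$ and $G\cap \mathrm{SL}_n(\mathcal O)$ is a cocompact lattice in $G$.
   Context: Two Lie groups are isogenous if they are locally isomorphic up to finite covers and finite index (in particular they have isomorphic Lie algebras). A cocompact lattice in $G$ is a discrete subgroup with compact quotient. *)

theory Defs
  imports
    "HOL-Analysis.Analysis"
    "HOL-Algebra.Left_Coset"
    "HOL-Algebra.Algebraic_Closure_Type"
begin

section \<open>Special linear groups\<close>

text \<open>With \<open>R = UNIV\<close> this is the special linear group over the whole coefficient type.\<close>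

definition SL :: "'a::comm_ring_1 set \<Rightarrow> ('a ^ 'n ^ 'n) monoid" where
  "SL R = \<lparr>carrier = {A. det A = 1 \<and> (\<forall>i j. A $ i $ j \<in> R)}, mult = (**), one = mat 1\<rparr>"

section \<open>Imaginary quadratic fields inside the complex numbers\<close>

definition imaginary_quadratic :: "complex set \<Rightarrow> bool" where
  "imaginary_quadratic F \<longleftrightarrow>
     subfield F ring_of_type_algebra \<and> ring.dimension ring_of_type_algebra 2 \<rat> F \<and> \<not> F \<subseteq> \<real>"

definition ring_of_integers :: "complex set \<Rightarrow> complex set" where
  "ring_of_integers F = {z \<in> F. algebraic_int z}"

section \<open>Topological groups and their coset spaces\<close>

definition topological_group :: "'a monoid \<Rightarrow> 'a topology \<Rightarrow> bool" where
  "topological_group G T \<longleftrightarrow>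
     group G \<and> topspace T = carrier G \<and>
     continuous_map (prod_topology T T) T (\<lambda>(x, y). x \<otimes>\<^bsub>G\<^esub> y) \<and>
     continuous_map T T (m_inv G)"

definition quotient_topology :: "'a topology \<Rightarrow> ('a \<Rightarrow> 'b) \<Rightarrow> 'b topology" where
  "quotient_topology T f =
     topology (\<lambda>U. U \<subseteq> f ` topspace T \<and> openin T {x \<in> topspace T. f x \<in> U})"

lemma openin_quotient_topology:
  "openin (quotient_topology T f) U \<longleftrightarrow>
     U \<subseteq> f ` topspace T \<and> openin T {x \<in> topspace T. f x \<in> U}"
proof -
  have "istopology (\<lambda>U. U \<subseteq> f ` topspace T \<and> openin T {x \<in> topspace T. f x \<in> U})"
    (is "istopology ?P")
    unfolding istopology_def
  proof (intro conjI allI impI)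
    fix S S' assume "?P S" "?P S'"
    moreover have "{x \<in> topspace T. f x \<in> S \<inter> S'} =
        {x \<in> topspace T. f x \<in> S} \<inter> {x \<in> topspace T. f x \<in> S'}"
      by blast
    ultimately show "S \<inter> S' \<subseteq> f ` topspace T"
      and "openin T {x \<in> topspace T. f x \<in> S \<inter> S'}"
      by (auto simp del: Int_iff)
  next
    fix K assume K: "\<forall>S\<in>K. ?P S"
    then show "\<Union> K \<subseteq> f ` topspace T" by blast
    have "{x \<in> topspace T. f x \<in> \<Union> K} = (\<Union>S\<in>K. {x \<in> topspace T. f x \<in> S})"
      by blast
    then show "openin T {x \<in> topspace T. f x \<in> \<Union> K}"
      using K by auto
  qed
  then show ?thesis
    by (simp add: quotient_topology_def topology_inverse')
qed

lemma topspace_quotient_topology: "topspace (quotient_topology T f) = f ` topspace T"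
proof (rule subset_antisym)
  show "topspace (quotient_topology T f) \<subseteq> f ` topspace T"
    using openin_topspace[of "quotient_topology T f"] unfolding openin_quotient_topology by blast
  have "{x \<in> topspace T. f x \<in> f ` topspace T} = topspace T"
    by blast
  then have "openin (quotient_topology T f) (f ` topspace T)"
    by (simp add: openin_quotient_topology)
  then show "f ` topspace T \<subseteq> topspace (quotient_topology T f)"
    by (rule openin_subset)
qed

lemma quotient_map_quotient_topology: "quotient_map T (quotient_topology T f) f"
  by (auto simp: quotient_map_def topspace_quotient_topology openin_quotient_topology)

definition coset_space :: "'a monoid \<Rightarrow> 'a topology \<Rightarrow> 'a set \<Rightarrow> 'a set topology" where
  "coset_space G T H = quotient_topology T (\<lambda>x. x <#\<^bsub>G\<^esub> H)"

definition cocompact_lattice :: "'a set \<Rightarrow> 'a monoid \<Rightarrow> 'a topology \<Rightarrow> bool" where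
  "cocompact_lattice \<Gamma> G T \<longleftrightarrow>
     subgroup \<Gamma> G \<and> subtopology T \<Gamma> = discrete_topology \<Gamma> \<and>
     compact_space (coset_space G T \<Gamma>)"

section \<open>Isogeny\<close>

text \<open>The notion \<^const>\<open>covering_space\<close>, for abstract topologies.\<close>

definition covering_map :: "'a topology \<Rightarrow> 'b topology \<Rightarrow> ('a \<Rightarrow> 'b) \<Rightarrow> bool" where
  "covering_map S T p \<longleftrightarrow>
     continuous_map S T p \<and> p ` topspace S = topspace T \<and>
     (\<forall>y\<in>topspace T. \<exists>U. y \<in> U \<and> openin T U \<and>
        (\<exists>\<V>. \<Union>\<V> = {x \<in> topspace S. p x \<in> U} \<and>
             (\<forall>V\<in>\<V>. openin S V) \<and> pairwise disjnt \<V> \<and>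
             (\<forall>V\<in>\<V>. homeomorphic_map (subtopology S V) (subtopology T U) p)))"

definition finite_cover ::
    "'a monoid \<Rightarrow> 'a topology \<Rightarrow> 'b monoid \<Rightarrow> 'b topology \<Rightarrow> ('a \<Rightarrow> 'b) \<Rightarrow> bool" where
  "finite_cover K S G T p \<longleftrightarrow>
     topological_group K S \<and> topological_group G T \<and>
     p \<in> hom K G \<and> covering_map S T p \<and> finite (kernel K G p)"

definition closed_finite_index_subgroup :: "'a set \<Rightarrow> 'a monoid \<Rightarrow> 'a topology \<Rightarrow> bool" where
  "closed_finite_index_subgroup H G T \<longleftrightarrow>
     subgroup H G \<and> closedin T H \<and> finite (lcosets\<^bsub>G\<^esub> H)"

text \<open>
  Two groups are isogenous if some finite-index subgroups \<open>G'\<close> and \<open>H'\<close> have a common finite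
  cover \<open>K\<close>. For Lie groups (here: closed subgroups of matrix groups with the induced topology)
  it makes no difference to speak about topological groups: a finite-index closed subgroup and a
  finite topological cover of a Lie group are again Lie groups, and continuous homomorphisms
  between Lie groups are smooth.

  Taking the elements of \<open>K\<close> from the type \<open>'a \<times> 'b\<close> is no restriction, since neither the
  multiplication nor the topology of \<open>K\<close> is tied to that type: given any common finite cover,
  with kernels \<open>A\<close> and \<open>B\<close>, its quotient by \<open>A \<inter> B\<close> is also one, and it embeds into \<open>G' \<times> H'\<close>.
\<close>

definition isogenous :: "'a monoid \<Rightarrow> 'a topology \<Rightarrow> 'b monoid \<Rightarrow> 'b topology \<Rightarrow> bool" where
  "isogenous G T H U \<longleftrightarrow>
     (\<exists>G' H' (K :: ('a \<times> 'b) monoid) S p q.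
        closed_finite_index_subgroup G' G T \<and>
        closed_finite_index_subgroup H' H U \<and>
        finite_cover K S (G\<lparr>carrier := G'\<rparr>) (subtopology T G') p \<and>
        finite_cover K S (H\<lparr>carrier := H'\<rparr>) (subtopology U H') q)"

end

theory Submission
  imports Defs
begin

text \<open>
  Suppose that \<open>G\<close> is such a group and \<open>\<Gamma>\<close> its intersection with the special linear group over the
  integers of \<open>F\<close>. The argument has three parts.

  \<^emph>\<open>The group \<open>G\<close> contains a conjugate \<open>P SL\<^sub>n(\<real>) P\<inverse>\<close> with finite index\<close> (\<open>isogenous_contains_conjugate\<close>).
  Composing a local section of the one cover with the other cover gives a continuous local
  homomorphism \<open>\<rho>\<close> from \<open>SL\<^sub>n(\<real>)\<close> to \<open>SL\<^sub>n(\<complex>)\<close> (\<open>finite_cover_local_rep\<close>). Its derivatives \<open>N i j\<close> along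
  the transvections satisfy the commutator relations of the matrix units, and conjugation by lifts of
  signed permutation matrices permutes them. So they form an \<open>n\<close>-dimensional representation of the
  traceless matrices whose set of weights is invariant under the symmetric group. A nonconstant weight
  has at most \<open>n\<close> rearrangements only if all its values but one agree, and this forces the
  standard representation or its dual (\<open>standard_or_dual\<close>). In both cases \<open>\<rho>\<close> maps small transvections
  onto conjugated transvections, and transvections generate \<open>SL\<^sub>n(\<real>)\<close>.

  \<^emph>\<open>The preimage \<open>L\<close> of \<open>\<Gamma>\<close> in \<open>SL\<^sub>n(\<real>)\<close> spans all real matrices\<close> (\<open>span_lattice\<close>). Lebesgue measure on
  the space of matrices is invariant under \<open>SL\<^sub>n(\<real>)\<close>, and so cocompactness of \<open>L\<close> yields Poincare recurrence:
  for each \<open>g\<close> some positive power \<open>g\<^sup>m\<close> becomes an element of \<open>L\<close> after multiplication by factors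
  close to one on both sides (\<open>recurrence\<close>).
  For large powers \<open>1 + m E\<^sub>i\<^sub>j\<close> of a transvection, these lattice elements divided by \<open>m\<close> approach \<open>E\<^sub>i\<^sub>j\<close>.

  \<^emph>\<open>The lattice \<open>L\<close> contains a unipotent element, which is impossible\<close> (\<open>no_integral_lattice\<close>). The
  conjugates by \<open>P\<close> of \<open>n\<^sup>2\<close> linearly independent elements of \<open>L\<close> act on \<open>F\<^sup>n\<close>, which has rational dimension
  \<open>2 n < n\<^sup>2\<close> since \<open>n \<ge> 3\<close>. Hence some nonzero rational combination \<open>a\<close> of them is singular; the
  minimal polynomial of \<open>a\<close> gives \<open>b \<noteq> 0\<close> with \<open>a b = 0\<close>, and some \<open>N = b x a\<close> with \<open>x\<close> in \<open>L\<close> is nonzero with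
  square zero. For a suitable nonzero integer \<open>D\<close> the element \<open>1 + D N\<close> lies in \<open>L\<close>. But it has
  conjugates in \<open>SL\<^sub>n(\<real>)\<close> arbitrarily close to one, which contradicts that \<open>L\<close> is discrete and
  cocompact (\<open>no_unipotent\<close>).
\<close>

no_notation fps_nth (infixl "$" 75)

section \<open>Elementary matrices\<close>

lemma matrix_add_rdistrib: "(B + C) ** A = B ** A + C ** (A :: 'a::semiring_1^_^_)"
  by (vector matrix_matrix_mult_def sum.distrib[symmetric] distrib_right)

lemma matrix_sub_ldistrib: "A ** (B - C) = A ** B - A ** (C :: 'a::ring_1^_^_)"
  by (vector matrix_matrix_mult_def sum_subtractf[symmetric] right_diff_distrib)

lemma matrix_sub_rdistrib: "(B - C) ** A = B ** A - C ** (A :: 'a::ring_1^_^_)"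
  by (vector matrix_matrix_mult_def sum_subtractf[symmetric] left_diff_distrib)

lemma matrix_minus_left: "(- B) ** A = - (B ** (A :: 'a::ring_1^_^_))"
  by (vector matrix_matrix_mult_def sum_negf[symmetric])

lemma matrix_minus_right: "B ** (- A) = - (B ** (A :: 'a::ring_1^_^_))"
  by (vector matrix_matrix_mult_def sum_negf[symmetric])

lemma matrix_scaleR_left: "(k *\<^sub>R A) ** B = k *\<^sub>R (A ** (B::'a::real_algebra_1^_^_))"
  by (simp add: scalar_matrix_assoc)

lemma matrix_scaleR_right: "A ** (k *\<^sub>R B) = k *\<^sub>R (A ** (B::'a::real_algebra_1^_^_))"
  by (simp add: matrix_matrix_mult_def vec_eq_iff scaleR_sum_right)

lemma matrix_sum_left: "(\<Sum>i\<in>I. A i) ** B = (\<Sum>i\<in>I. A i ** (B::'a::semiring_1^_^_))"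
  by (induction I rule: infinite_finite_induct) (auto simp: matrix_add_rdistrib)

lemma matrix_sum_right: "B ** (\<Sum>i\<in>I. A i) = (\<Sum>i\<in>I. B ** (A i::'a::semiring_1^_^_))"
  by (induction I rule: infinite_finite_induct) (auto simp: matrix_add_ldistrib)

lemmas matrix_distribs = matrix_add_ldistrib matrix_add_rdistrib matrix_sub_ldistrib
  matrix_sub_rdistrib matrix_minus_left matrix_minus_right

lemma bounded_bilinear_matrix_mult:
  "bounded_bilinear ((**) :: ('a::{real_algebra_1,euclidean_space})^'n^'k \<Rightarrow> 'a^'m^'n \<Rightarrow> _)"
  unfolding bilinear_conv_bounded_bilinear[symmetric] bilinear_def
  by (auto intro!: linearI simp: matrix_distribs matrix_scaleR_left matrix_scaleR_right)

lemmas tendsto_matrix_mult = bounded_bilinear.tendsto[OF bounded_bilinear_matrix_mult]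
lemmas continuous_on_matrix_mult [continuous_intros] =
  bounded_bilinear.continuous_on[OF bounded_bilinear_matrix_mult]

lemma inverse_matrix:
  fixes A :: "'a::field^'n^'n"
  assumes "det A \<noteq> 0"
  shows "A ** matrix_inv A = mat 1" "matrix_inv A ** A = mat 1"
proof -
  have "\<exists>A'. A ** A' = mat 1 \<and> A' ** A = mat 1"
    using assms invertible_det_nz[of A] unfolding invertible_def by blast
  then have "A ** matrix_inv A = mat 1 \<and> matrix_inv A ** A = mat 1"
    unfolding matrix_inv_def by (rule someI_ex)
  then show "A ** matrix_inv A = mat 1" "matrix_inv A ** A = mat 1" by auto
qed

lemma det_right_inverse:
  assumes "A ** B = mat 1" shows "det (A::'a::field^'n^'n) \<noteq> 0"
  using assms invertible_right_inverse invertible_det_nz by blast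

lemma matrix_inv_unique:
  fixes A :: "'a::field^'n^'n"
  assumes "A ** B = mat 1" shows "matrix_inv A = B"
  by (metis assms det_right_inverse inverse_matrix(2) matrix_mul_assoc matrix_mul_lid matrix_mul_rid)

lemma det_matrix_inv:
  fixes A :: "'a::field^'n^'n"
  assumes "det A \<noteq> 0" shows "det (matrix_inv A) = 1 / det A"
  by (metis assms det_I det_mul inverse_matrix(2) nonzero_eq_divide_eq)

lemma matrix_left_cancel:
  fixes A :: "'a::field^'n^'n"
  assumes "A ** B = mat 1"
  shows "A ** (B ** C) = C" "B ** (A ** C) = C"
  using assms matrix_left_right_inverse[of A B] by (simp_all add: matrix_mul_assoc)

lemma matrix_inv_mult:
  fixes A B :: "'a::field^'n^'n"
  assumes "det A \<noteq> 0" "det B \<noteq> 0"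
  shows "matrix_inv (A ** B) = matrix_inv B ** matrix_inv A"
  using assms
  by (intro matrix_inv_unique) (simp add: matrix_mul_assoc[symmetric] matrix_left_cancel inverse_matrix)

lemma ex_index_outside:
  fixes S :: "'n::finite set"
  assumes "card S < CARD('n)"
  shows "\<exists>k. k \<notin> S"
proof (rule ccontr)
  assume "\<not> ?thesis"
  then have "S = UNIV" by auto
  then show False using assms by simp
qed

definition elem :: "'n \<Rightarrow> 'n \<Rightarrow> 'a \<Rightarrow> 'a::zero^'n^'n" where
  "elem i j t = (\<chi> a b. if a = i \<and> b = j then t else 0)"

lemma elem_nth: "elem i j t $ a $ b = (if a = i \<and> b = j then t else 0)"
  by (simp add: elem_def)

lemma elem_mult_elem:
  "elem i j s ** elem k l t = (if j = k then elem i l (s * t :: 'a::semiring_1) else 0)"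
proof -
  have "(\<Sum>c\<in>UNIV. (if a = i \<and> c = j then s else 0) * (if c = k \<and> b = l then t else 0)) =
     (if j = k \<and> a = i \<and> b = l then s * t else 0)" for a b
  proof -
    have "(\<Sum>c\<in>UNIV. (if a = i \<and> c = j then s else 0) * (if c = k \<and> b = l then t else 0)) =
      (\<Sum>c\<in>UNIV. if c = j then (if j = k \<and> a = i \<and> b = l then s * t else 0) else 0)"
      by (rule sum.cong) auto
    then show ?thesis by simp
  qed
  then show ?thesis
    by (simp add: vec_eq_iff matrix_matrix_mult_def elem_nth)
qed

lemma elem_add: "elem i j (s + t) = elem i j s + elem i j (t::'a::monoid_add)"
  by (simp add: vec_eq_iff elem_nth)

lemma elem_zero [simp]: "elem i j 0 = 0"
  by (simp add: vec_eq_iff elem_nth)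

lemma scaleR_elem: "r *\<^sub>R elem i j t = elem i j (r *\<^sub>R t)"
  by (simp add: vec_eq_iff elem_nth)

lemma sum_elem: "A = (\<Sum>i\<in>UNIV. \<Sum>j\<in>UNIV. elem i j (A $ i $ j :: 'a::comm_monoid_add))"
proof -
  have "(\<Sum>i\<in>UNIV. \<Sum>j\<in>UNIV. if a = i \<and> b = j then A $ i $ j else 0) = A $ a $ b" for a b
  proof -
    have "(\<Sum>i\<in>UNIV. \<Sum>j\<in>UNIV. if a = i \<and> b = j then A $ i $ j else 0) =
       (\<Sum>i\<in>UNIV. if a = i then (\<Sum>j\<in>UNIV. if b = j then A $ i $ j else 0) else 0)"
      by (rule sum.cong) auto
    then show ?thesis by simp
  qed
  then show ?thesis by (simp add: vec_eq_iff elem_nth)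
qed

definition diagm :: "('n \<Rightarrow> 'a) \<Rightarrow> 'a::zero^'n^'n" where
  "diagm d = (\<chi> i j. if i = j then d i else 0)"

lemma diagm_mult_nth: "(diagm d ** A) $ i $ j = d i * (A $ i $ j :: 'a::semiring_1)"
  by (simp add: diagm_def matrix_matrix_mult_def if_distrib[of "\<lambda>x. x * _"] cong: if_cong)

lemma mult_diagm_nth: "(A ** diagm d) $ i $ j = (A $ i $ j :: 'a::semiring_1) * d j"
  by (simp add: diagm_def matrix_matrix_mult_def if_distrib[of "\<lambda>x. _ * x"] cong: if_cong)

lemma diagm_mult: "diagm c ** diagm d = diagm (\<lambda>i. c i * d i :: 'a::semiring_1)"
  by (simp add: vec_eq_iff diagm_mult_nth) (simp add: diagm_def)

lemma diagm_mult_elem: "diagm d ** elem i j t = elem i j (d i * t :: 'a::semiring_1)"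
  by (simp add: vec_eq_iff diagm_mult_nth elem_nth)

lemma elem_mult_diagm: "elem i j t ** diagm d = elem i j (t * d j :: 'a::semiring_1)"
  by (simp add: vec_eq_iff mult_diagm_nth elem_nth)

definition transv :: "'n \<Rightarrow> 'n \<Rightarrow> 'a \<Rightarrow> 'a::semiring_1^'n^'n" where
  "transv i j t = mat 1 + elem i j t"

lemma transv_zero [simp]: "transv i j 0 = mat 1"
  by (simp add: transv_def)

lemma transv_add: "i \<noteq> j \<Longrightarrow> transv i j s ** transv i j t = transv i j (s + t :: 'a::comm_ring_1)"
  by (simp add: transv_def matrix_distribs elem_mult_elem elem_add)

lemma det_transv: "i \<noteq> j \<Longrightarrow> det (transv i j t :: ('a::field)^'n^'n) = 1"
proof -
  assume ij: "i \<noteq> j"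
  have *: "(transv i j t :: 'a^'n^'n) = (\<chi> k. if k = i then row i (mat 1) + t *s row j (mat 1) else row k (mat 1))"
    using ij by (auto simp: vec_eq_iff transv_def elem_nth row_def mat_def)
  show ?thesis
    unfolding * using ij det_row_operation[OF ij, of "mat 1" t] by simp
qed

definition cmat :: "real^'n^'m \<Rightarrow> complex^'n^'m" where
  "cmat A = (\<chi> i j. of_real (A $ i $ j))"

lemma cmat_nth: "cmat A $ i $ j = of_real (A $ i $ j)"
  by (simp add: cmat_def)

lemma cmat_mult: "cmat (A ** B) = cmat A ** cmat B"
  by (simp add: vec_eq_iff matrix_matrix_mult_def cmat_nth)

lemma cmat_one [simp]: "cmat (mat 1) = mat 1"
  by (simp add: vec_eq_iff cmat_nth mat_def)

lemma cmat_add: "cmat (A + B) = cmat A + cmat B"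
  by (simp add: vec_eq_iff cmat_nth)

lemma cmat_scaleR: "cmat (r *\<^sub>R A) = r *\<^sub>R cmat A"
  by (simp add: vec_eq_iff cmat_nth) (simp add: scaleR_conv_of_real)

lemma linear_cmat: "linear cmat"
  by (rule linearI) (auto simp: cmat_add cmat_scaleR)

lemma cmat_inj: "cmat A = cmat B \<Longrightarrow> A = B"
  by (simp add: vec_eq_iff cmat_nth)

lemma det_cmat: "det (cmat A) = of_real (det A)"
  by (simp add: det_def cmat_nth)

lemma cmat_elem: "cmat (elem i j t) = elem i j (of_real t)"
  by (simp add: vec_eq_iff elem_nth cmat_nth)

lemma cmat_transv: "cmat (transv i j t) = transv i j (of_real t)"
  by (simp add: transv_def cmat_add cmat_elem)

definition conj_embed :: "complex^'n^'n \<Rightarrow> real^'n^'n \<Rightarrow> complex^'n^'n" where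
  "conj_embed P A = P ** cmat A ** matrix_inv P"

context
  fixes P :: "complex^'n^'n"
  assumes P: "det P \<noteq> 0"
begin

lemma conj_embed_back: "matrix_inv P ** conj_embed P A ** P = cmat A"
proof -
  have "matrix_inv P ** conj_embed P A ** P = (matrix_inv P ** P) ** cmat A ** (matrix_inv P ** P)"
    unfolding conj_embed_def by (simp only: matrix_mul_assoc)
  then show ?thesis by (simp add: inverse_matrix[OF P])
qed

lemma conj_embed_mult: "conj_embed P (A ** B) = conj_embed P A ** conj_embed P B"
proof -
  have "conj_embed P A ** conj_embed P B = P ** cmat A ** (matrix_inv P ** P) ** cmat B ** matrix_inv P"
    unfolding conj_embed_def by (simp only: matrix_mul_assoc)
  then show ?thesis by (simp add: inverse_matrix[OF P] conj_embed_def cmat_mult matrix_mul_assoc)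
qed

lemma conj_embed_one: "conj_embed P (mat 1) = mat 1"
  by (simp add: conj_embed_def inverse_matrix[OF P])

lemma conj_embed_inv: "det A \<noteq> 0 \<Longrightarrow> conj_embed P (matrix_inv A) = matrix_inv (conj_embed P A)"
  by (intro matrix_inv_unique[symmetric]) (simp add: conj_embed_mult[symmetric] conj_embed_one inverse_matrix)

lemma det_embed: "det (conj_embed P A) = of_real (det A)"
  using P by (simp add: conj_embed_def det_mul det_cmat det_matrix_inv)

end

lemma conj_embed_add: "conj_embed P (A + B) = conj_embed P A + conj_embed P B"
  by (simp add: conj_embed_def cmat_add matrix_distribs)

lemma conj_embed_scaleR: "conj_embed P (r *\<^sub>R A) = r *\<^sub>R conj_embed P A"
  by (simp add: conj_embed_def cmat_scaleR matrix_scaleR_left matrix_scaleR_right)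

lemma continuous_on_det [continuous_intros]:
  fixes f :: "'b::topological_space \<Rightarrow> 'a::{comm_ring_1,real_normed_algebra_1}^'n^'n"
  assumes "continuous_on S f"
  shows "continuous_on S (\<lambda>x. det (f x))"
  unfolding det_def
  by (intro continuous_intros continuous_on_prod' continuous_on_component assms)

text \<open>
  By Cramer's rule the entries of the inverse of a matrix of determinant one are determinants, hence
  continuous in the matrix, and the matrices in question form a compact set.
\<close>

lemma bounded_inverse_SL:
  "\<exists>B>0. \<forall>A::real^'n^'n. det A = 1 \<longrightarrow> norm A \<le> R \<longrightarrow> norm (matrix_inv A) \<le> B"
proof -
  define K where "K = cball 0 R \<inter> {A::real^'n^'n. det A = 1}"
  have "closed {A::real^'n^'n. det A = 1}"
    by (intro closed_Collect_eq continuous_intros)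
  then have K: "compact K"
    unfolding K_def by (intro compact_Int_closed) auto
  have ent: "matrix_inv A $ k $ l = det (\<chi> i j. if j = k then axis l 1 $ i else A $ i $ j)"
    if "A \<in> K" for A k l
  proof -
    have d: "det A = 1" using that by (simp add: K_def)
    then have "A *v (matrix_inv A *v axis l 1) = axis l 1"
      by (simp add: matrix_vector_mul_assoc inverse_matrix)
    then have "matrix_inv A *v axis l 1 = (\<chi> k. det (\<chi> i j. if j = k then axis l 1 $ i else A $ i $ j))"
      using cramer[of A "matrix_inv A *v axis l 1" "axis l 1"] d by simp
    moreover have "(matrix_inv A *v axis l 1) $ k = matrix_inv A $ k $ l"
      by (simp add: matrix_vector_mult_basis column_def)
    ultimately show ?thesis by simp
  qed
  define g where "g A = (\<chi> k l. det (\<chi> i j. if j = k then axis l 1 $ i else A $ i $ j))"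
    for A :: "real^'n^'n"
  have "continuous_on K g"
    unfolding g_def
  proof (intro continuous_intros)
    show "continuous_on K (\<lambda>x. if j = k then axis l 1 $ i else x $ i $ j)" for i j k l
      by (cases "j = k") (auto intro!: continuous_intros)
  qed
  moreover have "g A = matrix_inv A" if "A \<in> K" for A
    using ent[OF that] by (simp add: vec_eq_iff g_def)
  ultimately have "continuous_on K matrix_inv"
    by (metis (no_types, lifting) continuous_on_cong)
  then have "bounded (matrix_inv ` K)"
    using K compact_continuous_image compact_imp_bounded by blast
  then obtain B where "B > 0" "\<forall>A\<in>K. norm (matrix_inv A) \<le> B"
    by (auto simp: bounded_pos)
  then show ?thesis by (auto simp: K_def)
qed

section \<open>Transvections generate the real special linear group\<close>

inductive transv_generated :: "real^'n^'n \<Rightarrow> bool" where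
  transv_generated_one: "transv_generated (mat 1)"
| transv_generated_step: "i \<noteq> j \<Longrightarrow> transv_generated A \<Longrightarrow> transv_generated (transv i j t ** A)"

lemma transv_generated_mult: "transv_generated A \<Longrightarrow> transv_generated B \<Longrightarrow> transv_generated (A ** B)"
  by (induction rule: transv_generated.induct) (auto simp: matrix_mul_assoc[symmetric] intro: transv_generated.intros)

lemma transv_generated_transv: "i \<noteq> j \<Longrightarrow> transv_generated (transv i j t)"
  using transv_generated_step[OF _ transv_generated_one] by (metis matrix_mul_rid)

lemma det_transv_generated: "transv_generated A \<Longrightarrow> det A = 1"
  by (induction rule: transv_generated.induct) (auto simp: det_mul det_transv)

text \<open>
  In the plane of the indices \<open>i\<close> and \<open>j\<close> this is the matrix with rows
  \<open>(0, a)\<close> and \<open>(- 1 / a, 0)\<close>. Products of two of these give the diagonal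
  matrices below.
\<close>

lemma weyl_matrix:
  assumes "i \<noteq> j" "a \<noteq> (0::real)"
  shows "transv i j a ** (transv j i (- inverse a) ** transv i j a) =
    mat 1 - elem i i 1 - elem j j 1 + elem i j a + elem j i (- inverse a)"
  using assms
  by (simp add: transv_def matrix_distribs elem_mult_elem) (simp add: vec_eq_iff elem_nth)

lemma transv_generated_torus:
  assumes "i \<noteq> j" "a \<noteq> (0::real)"
  shows "transv_generated (mat 1 + elem i i (a - 1) + elem j j (inverse a - 1))"
proof -
  have w: "transv i j (-1) ** (transv j i 1 ** transv i j (-1)) =
      mat 1 - elem i i 1 - elem j j 1 + elem i j (-1) + elem j i (1::real)"
    using weyl_matrix[OF assms(1), of "-1"] by simp
  have "mat 1 + elem i i (a - 1) + elem j j (inverse a - 1) =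
    (transv i j a ** (transv j i (- inverse a) ** transv i j a)) **
    (transv i j (-1) ** (transv j i 1 ** transv i j (-1)))"
    unfolding weyl_matrix[OF assms] w
    using assms
    by (simp add: matrix_distribs elem_mult_elem) (simp add: vec_eq_iff elem_nth)
  then show ?thesis
    using assms by (metis transv_generated_mult transv_generated_transv)
qed

lemma det_diagm: "det (diagm d) = (prod d UNIV :: 'a::comm_ring_1)"
  by (subst det_diagonal) (auto simp: diagm_def)

text \<open>
  Splitting off one factor from \<open>transv_generated_torus\<close> turns an entry of
  \<open>d\<close> into one and moves it to another place where \<open>d\<close> is not one.
\<close>

lemma transv_generated_diag: "prod d UNIV = 1 \<Longrightarrow> transv_generated (diagm d)"
proof (induction "card {i. d i \<noteq> 1}" arbitrary: d rule: less_induct)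
  case less
  show ?case
  proof (cases "\<forall>i. d i = 1")
    case True
    then have "diagm d = mat 1" by (simp add: diagm_def mat_def vec_eq_iff)
    then show ?thesis by (simp add: transv_generated_one)
  next
    case False
    then obtain i where i: "d i \<noteq> 1" by auto
    have "\<exists>j. j \<noteq> i \<and> d j \<noteq> 1"
    proof (rule ccontr)
      assume "\<not> ?thesis"
      then have "prod d (UNIV - {i}) = 1" by (intro prod.neutral) auto
      then have "prod d UNIV = d i"
        using prod.remove[of UNIV i d] by simp
      then show False using i less.prems by simp
    qed
    then obtain j where j: "j \<noteq> i" "d j \<noteq> 1" by auto
    have nz: "d k \<noteq> 0" for k
      using less.prems by (metis finite prod_zero UNIV_I zero_neq_one)
    define d' where "d' = d(i := 1, j := d i * d j)"
    have "prod d' UNIV = d' i * (d' j * prod d' (UNIV - {i} - {j}))"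
      using j prod.remove[of "UNIV" i d'] prod.remove[of "UNIV - {i}" j d'] by simp
    also have "prod d' (UNIV - {i} - {j}) = prod d (UNIV - {i} - {j})"
      by (rule prod.cong) (auto simp: d'_def)
    also have "d' i * (d' j * prod d (UNIV - {i} - {j})) = prod d UNIV"
      using j prod.remove[of "UNIV" i d] prod.remove[of "UNIV - {i}" j d] by (simp add: d'_def)
    finally have p: "prod d' UNIV = 1" using less.prems by simp
    have "{k. d' k \<noteq> 1} \<subset> {k. d k \<noteq> 1}"
      using i j by (auto simp: d'_def split: if_splits)
    then have "card {k. d' k \<noteq> 1} < card {k. d k \<noteq> 1}"
      by (intro psubset_card_mono) auto
    then have "transv_generated (diagm d')" using less.hyps p by blast
    moreover have "diagm d = (mat 1 + elem i i (d i - 1) + elem j j (inverse (d i) - 1)) ** diagm d'"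
    proof -
      have "mat 1 + elem i i (d i - 1) + elem j j (inverse (d i) - 1) =
        diagm (\<lambda>k. if k = i then d i else if k = j then inverse (d i) else 1)"
        using j by (auto simp: vec_eq_iff diagm_def mat_def elem_nth)
      then show ?thesis
        using j nz by (auto simp: diagm_mult d'_def intro!: arg_cong[of _ _ diagm])
    qed
    ultimately show ?thesis
      using transv_generated_mult transv_generated_torus[of i j "d i"] nz j by metis
  qed
qed

lemma diagm_mult_transv:
  fixes d :: "'n::finite \<Rightarrow> real"
  assumes "d j \<noteq> 0"
  shows "diagm d ** transv i j t = transv i j (d i * t / d j) ** diagm d"
proof -
  show ?thesis
    using assms by (simp add: transv_def matrix_distribs diagm_mult_elem elem_mult_diagm)
qed

text \<open>
  Diagonal matrices normalise the transvections. This allows the diagonal factors in a product of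
  elementary matrices to be collected on the right.
\<close>

lemma diagm_transv_generated:
  fixes d :: "'n::finite \<Rightarrow> real"
  assumes "\<And>i. d i \<noteq> 0" "transv_generated E"
  shows "\<exists>E'. transv_generated E' \<and> diagm d ** E = E' ** diagm d"
  using assms(2)
proof (induction rule: transv_generated.induct)
  case transv_generated_one
  then show ?case by (metis matrix_mul_lid matrix_mul_rid transv_generated.transv_generated_one)
next
  case (transv_generated_step i j A t)
  then obtain E' where E': "transv_generated E'" "diagm d ** A = E' ** diagm d" by auto
  have "diagm d ** (transv i j t ** A) = (transv i j (d i * t / d j) ** E') ** diagm d"
    using E'(2) diagm_mult_transv[of d j i t] assms(1) by (metis matrix_mul_assoc)
  then show ?case using E'(1) transv_generated.transv_generated_step[OF transv_generated_step(1)] by blast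
qed

proposition SL_generated_by_transvections:
  fixes A :: "real^'n^'n"
  assumes "det A = 1" "P (mat 1)" "\<And>i j t. i \<noteq> j \<Longrightarrow> P (transv i j t)"
    "\<And>A B. P A \<Longrightarrow> P B \<Longrightarrow> P (A ** B)"
  shows "P A"
proof -
  define Q where "Q A \<longleftrightarrow> det A = 0 \<or> (\<exists>E d. transv_generated E \<and> A = E ** diagm d)" for A :: "real^'n^'n"
  have "Q A"
  proof (rule induct_matrix_elementary)
    fix A B :: "real^'n^'n" assume AB: "Q A" "Q B"
    show "Q (A ** B)"
    proof (cases "det A = 0 \<or> det B = 0")
      case True
      then show ?thesis by (auto simp: Q_def det_mul)
    next
      case False
      then obtain E d E' d' where E: "transv_generated E" "A = E ** diagm d" "transv_generated E'" "B = E' ** diagm d'"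
        using AB unfolding Q_def by blast
      have "det (diagm d) \<noteq> 0" using False E by (auto simp: det_mul)
      then have "d i \<noteq> 0" for i by (auto simp: det_diagm)
      then obtain E'' where E'': "transv_generated E''" "diagm d ** E' = E'' ** diagm d"
        using diagm_transv_generated[of d E'] E(3) by auto
      have "A ** B = E ** (diagm d ** E') ** diagm d'"
        by (simp add: E matrix_mul_assoc)
      also have "\<dots> = (E ** E'') ** diagm (\<lambda>i. d i * d' i)"
        by (simp add: E''(2) matrix_mul_assoc diagm_mult[symmetric])
      finally show ?thesis unfolding Q_def using E(1) E''(1) transv_generated_mult by blast
    qed
  next
    fix A :: "real^'n^'n" and i assume "row i A = 0"
    then show "Q A" by (auto simp: Q_def det_zero_row(2))
  next
    fix A :: "real^'n^'n" assume "\<And>i j. i \<noteq> j \<Longrightarrow> A $ i $ j = 0"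
    then have "A = mat 1 ** diagm (\<lambda>i. A $ i $ i)" by (simp add: vec_eq_iff diagm_def)
    then show "Q A" unfolding Q_def using transv_generated_one by blast
  next
    fix m n :: 'n assume mn: "m \<noteq> n"
    let ?w = "transv m n 1 ** (transv n m (- inverse 1) ** transv m n (1::real))"
    have d: "diagm (\<lambda>i. if i = m then -1 else 1) = mat 1 - elem m m (2::real)"
      by (auto simp: vec_eq_iff diagm_def mat_def elem_nth)
    have w: "?w = mat 1 - elem m m 1 - elem n n 1 + elem m n 1 + elem n m (- 1)"
      using weyl_matrix[OF mn, of 1] by simp
    have wd: "?w ** diagm (\<lambda>i. if i = m then -1 else 1) = ?w - elem n m (-2)"
      using mn unfolding d w by (simp add: matrix_distribs elem_mult_elem)
    have "(\<chi> i j. mat 1 $ i $ Transposition.transpose m n j) $ k $ l = (?w - elem n m (-2)) $ k $ l" for k l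
      unfolding w using mn
      by (cases "k = m"; cases "k = n"; cases "l = m"; cases "l = n")
        (simp_all add: elem_nth mat_def Transposition.transpose_def)
    then have "(\<chi> i j. mat 1 $ i $ Transposition.transpose m n j) = ?w ** diagm (\<lambda>i. if i = m then -1 else 1)"
      unfolding wd by (simp add: vec_eq_iff)
    moreover have "transv_generated ?w"
      using mn by (intro transv_generated_mult transv_generated_transv) auto
    ultimately show "Q (\<chi> i j. mat 1 $ i $ Transposition.transpose m n j)"
      unfolding Q_def by blast
  next
    fix m n :: 'n and c :: real assume mn: "m \<noteq> n"
    have "(\<chi> i j. if i = m \<and> j = n then c else of_bool (i = j)) = transv m n c ** diagm (\<lambda>i. 1)"
    proof -
      have "diagm (\<lambda>i. 1) = (mat 1 :: real^'n^'n)" by (simp add: diagm_def mat_def)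
      show ?thesis unfolding \<open>diagm (\<lambda>i. 1) = mat 1\<close> matrix_mul_rid
        using mn by (auto simp: vec_eq_iff transv_def elem_nth mat_def)
    qed
    then show "Q (\<chi> i j. if i = m \<and> j = n then c else of_bool (i = j))"
      unfolding Q_def using transv_generated_transv mn by blast
  qed
  then obtain E d where E: "transv_generated E" "A = E ** diagm d"
    using assms(1) by (auto simp: Q_def)
  then have "prod d UNIV = 1"
    using assms(1) by (simp add: det_mul det_transv_generated det_diagm)
  then have "transv_generated A"
    using E transv_generated_diag transv_generated_mult by blast
  then show "P A"
    by (induction rule: transv_generated.induct) (auto intro: assms)
qed

section \<open>Invariance of Lebesgue measure under the special linear group\<close>

text \<open>
  By Fubini the coordinate along \<open>b'\<close> can be integrated first; there the shear is a
  translation.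
\<close>

lemma nn_integral_shear:
  fixes b b' :: "'a::euclidean_space" and h :: "'a \<Rightarrow> ennreal"
  assumes b: "b \<in> Basis" "b' \<in> Basis" "b \<noteq> b'" and [measurable]: "h \<in> borel_measurable borel"
  shows "(\<integral>\<^sup>+x. h (x + (t * (x \<bullet> b)) *\<^sub>R b') \<partial>lborel) = (\<integral>\<^sup>+x. h x \<partial>lborel)"
proof -
  interpret product_sigma_finite "\<lambda>_::'a. lborel :: real measure" ..
  define I where "I = (Basis :: 'a set) - {b'}"
  have I: "finite I" "b' \<notin> I" "Basis = insert b' I" "b \<in> I"
    using b by (auto simp: I_def)
  define S where "S f = (\<Sum>c\<in>Basis. f c *\<^sub>R c)" for f :: "'a \<Rightarrow> real"
  have lb: "(lborel :: 'a measure) = distr (\<Pi>\<^sub>M b\<in>insert b' I. lborel) borel S"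
    using lborel_eq[where 'a='a] I(3) by (simp add: S_def[abs_def])
  have [measurable]: "S \<in> borel_measurable (\<Pi>\<^sub>M b\<in>insert b' I. lborel)"
    unfolding S_def I(3) by measurable
  have split: "(\<integral>\<^sup>+x. k x \<partial>lborel) = (\<integral>\<^sup>+f. (\<integral>\<^sup>+y. k (S (f(b' := y))) \<partial>lborel) \<partial>(\<Pi>\<^sub>M b\<in>I. lborel))"
    if [measurable]: "k \<in> borel_measurable borel" for k :: "'a \<Rightarrow> ennreal"
    unfolding lb by (subst nn_integral_distr) (auto simp: product_nn_integral_insert[OF I(1,2)])
  have Sb: "S f \<bullet> b = f b" for f
    using b by (simp add: S_def inner_sum_left inner_Basis if_distrib cong: if_cong)
  have Supd: "S (f(b' := y)) + c *\<^sub>R b' = S (f(b' := y + c))" for f y c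
    unfolding S_def I(3) using I(1,2) by (simp add: algebra_simps) (auto intro!: sum.cong)
  have "(\<integral>\<^sup>+x. h (x + (t * (x \<bullet> b)) *\<^sub>R b') \<partial>lborel) =
     (\<integral>\<^sup>+f. (\<integral>\<^sup>+y. h (S (f(b' := y + t * f b))) \<partial>lborel) \<partial>(\<Pi>\<^sub>M b\<in>I. lborel))"
    using b by (subst split) (auto simp: Sb Supd)
  also have "\<dots> = (\<integral>\<^sup>+f. (\<integral>\<^sup>+y. h (S (f(b' := y))) \<partial>lborel) \<partial>(\<Pi>\<^sub>M b\<in>I. lborel))"
  proof (rule nn_integral_cong)
    fix f :: "'a \<Rightarrow> real" assume "f \<in> space (\<Pi>\<^sub>M b\<in>I. lborel)"
    have "(\<lambda>y. S (f(b' := y))) = (\<lambda>y. S (f(b' := 0)) + y *\<^sub>R b')"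
      by (simp add: Supd)
    then have [measurable]: "(\<lambda>y. S (f(b' := y))) \<in> borel_measurable borel" by simp
    show "(\<integral>\<^sup>+y. h (S (f(b' := y + t * f b))) \<partial>lborel) = (\<integral>\<^sup>+y. h (S (f(b' := y))) \<partial>lborel)"
      using nn_integral_real_affine[of "\<lambda>y. h (S (f(b' := y)))" 1 "t * f b"]
      by (simp add: add.commute)
  qed
  also have "\<dots> = (\<integral>\<^sup>+x. h x \<partial>lborel)"
    by (rule split[symmetric]) simp
  finally show ?thesis .
qed

text \<open>
  Sources and targets are disjoint, so the simultaneous shear is the composition of the single ones.
  Multiplication by a transvection is of this form.
\<close>

lemma nn_integral_shears:
  fixes s e :: "'i \<Rightarrow> 'a::euclidean_space" and h :: "'a \<Rightarrow> ennreal"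
  assumes "finite D" "\<And>d. d \<in> D \<Longrightarrow> s d \<in> Basis" "\<And>d. d \<in> D \<Longrightarrow> e d \<in> Basis"
    "\<And>d d'. d \<in> D \<Longrightarrow> d' \<in> D \<Longrightarrow> s d \<noteq> e d'" "h \<in> borel_measurable borel"
  shows "(\<integral>\<^sup>+x. h (x + (\<Sum>d\<in>D. (t * (x \<bullet> s d)) *\<^sub>R e d)) \<partial>lborel) = (\<integral>\<^sup>+x. h x \<partial>lborel)"
  using assms
proof (induction D arbitrary: h rule: finite_induct)
  case empty
  then show ?case by simp
next
  case (insert c D)
  note [measurable] = insert.prems(4)
  define T where "T x = x + (\<Sum>d\<in>D. (t * (x \<bullet> s d)) *\<^sub>R e d)" for x
  have "T x \<bullet> s c = x \<bullet> s c" for x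
  proof -
    have "e d \<bullet> s c = 0" if "d \<in> D" for d
      using that insert.prems(1)[of c] insert.prems(2)[of d] insert.prems(3)[of c d]
      by (auto simp: inner_Basis)
    then show ?thesis by (simp add: T_def inner_add_left inner_sum_left)
  qed
  then have "x + (\<Sum>d\<in>insert c D. (t * (x \<bullet> s d)) *\<^sub>R e d) = T x + (t * (T x \<bullet> s c)) *\<^sub>R e c" for x
    using insert.hyps by (simp add: T_def algebra_simps)
  then have "(\<integral>\<^sup>+x. h (x + (\<Sum>d\<in>insert c D. (t * (x \<bullet> s d)) *\<^sub>R e d)) \<partial>lborel) =
     (\<integral>\<^sup>+x. h (T x + (t * (T x \<bullet> s c)) *\<^sub>R e c) \<partial>lborel)" by simp
  also have "\<dots> = (\<integral>\<^sup>+x. h (x + (t * (x \<bullet> s c)) *\<^sub>R e c) \<partial>lborel)"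
    unfolding T_def
    using insert.prems by (intro insert.IH[of "\<lambda>x. h (x + (t * (x \<bullet> s c)) *\<^sub>R e c)"]) auto
  also have "\<dots> = (\<integral>\<^sup>+x. h x \<partial>lborel)"
    using insert.prems(1)[of c] insert.prems(2)[of c] insert.prems(3)[of c c]
    by (intro nn_integral_shear) auto
  finally show ?case .
qed

lemma borel_measurable_matrix_mult [measurable]:
  "(\<lambda>x. g ** x) \<in> borel_measurable (borel :: (real^'n^'n) measure)"
  "(\<lambda>x. x ** g) \<in> borel_measurable (borel :: (real^'n^'n) measure)"
  by (auto intro!: borel_measurable_continuous_onI continuous_intros)

lemma nn_integral_SL_mult:
  fixes g :: "real^'n^'n"
  assumes "det g = 1"
  shows "\<forall>h\<in>borel_measurable borel. (\<integral>\<^sup>+x. h (g ** x) \<partial>lborel) = (\<integral>\<^sup>+x. h x \<partial>lborel) \<and>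
    (\<integral>\<^sup>+x. h (x ** g) \<partial>lborel) = (\<integral>\<^sup>+x. h x \<partial>lborel)"
    (is "?P g")
  using assms
proof (rule SL_generated_by_transvections[where P = ?P])
  show "?P (mat 1)" by simp
next
  fix i j :: 'n and t :: real assume ij: "i \<noteq> j"
  have bs: "axis k (axis l 1) \<in> (Basis :: (real^'n^'n) set)" for k l
    by simp
  have ne: "axis k (axis l 1) \<noteq> (axis k' (axis l' 1) :: real^'n^'n)" if "k \<noteq> k' \<or> l \<noteq> l'" for k k' l l'
    using that by (auto simp: axis_eq_axis)
  have in_ax: "x \<bullet> axis k (axis l 1) = x $ k $ l" for x :: "real^'n^'n" and k l
    by (simp add: inner_axis)
  have ax: "axis k (axis l 1) $ a $ b = (if a = k \<and> b = l then 1 else 0 :: real)" for k l a b :: 'n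
    by (simp add: axis_def)
  have ax1: "axis l 1 $ b = (if b = l then 1 else 0 :: real)" for l b :: 'n
    by (simp add: axis_def)
  have L: "transv i j t ** x = x + (\<Sum>c\<in>UNIV. (t * (x \<bullet> axis j (axis c 1))) *\<^sub>R axis i (axis c 1))" for x :: "real^'n^'n"
  proof -
    have "(elem i j t ** x) $ a $ b = (\<Sum>c\<in>UNIV. (t * (x $ j $ c)) *\<^sub>R axis i (axis c 1)) $ a $ b" for a b
      by (cases "a = i") (simp_all add: matrix_matrix_mult_def elem_nth ax ax1 if_distrib[of "\<lambda>x. x * _"]
          if_distrib[of "\<lambda>x. _ * x"] cong: if_cong)
    then show ?thesis by (simp add: vec_eq_iff transv_def matrix_add_rdistrib in_ax)
  qed
  have R: "x ** transv i j t = x + (\<Sum>r\<in>UNIV. (t * (x \<bullet> axis r (axis i 1))) *\<^sub>R axis r (axis j 1))" for x :: "real^'n^'n"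
  proof -
    have "(x ** elem i j t) $ a $ b = (\<Sum>r\<in>UNIV. (t * (x $ r $ i)) *\<^sub>R axis r (axis j 1)) $ a $ b" for a b
      by (cases "b = j") (simp_all add: matrix_matrix_mult_def elem_nth ax ax1 if_distrib[of "\<lambda>x. x * _"]
          if_distrib[of "\<lambda>x. _ * x"] mult.commute cong: if_cong)
    then show ?thesis by (simp add: vec_eq_iff transv_def matrix_add_ldistrib in_ax)
  qed
  show "?P (transv i j t)"
    unfolding L R
    by (intro ballI conjI nn_integral_shears) (use ij in \<open>auto intro: bs simp: axis_eq_axis\<close>)
next
  fix A B :: "real^'n^'n" assume A: "?P A" and B: "?P B"
  show "?P (A ** B)"
  proof (intro ballI conjI)
    fix h :: "real^'n^'n \<Rightarrow> ennreal" assume [measurable]: "h \<in> borel_measurable borel"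
    have "(\<integral>\<^sup>+x. h (A ** B ** x) \<partial>lborel) = (\<integral>\<^sup>+x. h (A ** x) \<partial>lborel)"
      using B[rule_format, of "\<lambda>x. h (A ** x)"] by (simp add: matrix_mul_assoc)
    then show "(\<integral>\<^sup>+x. h (A ** B ** x) \<partial>lborel) = (\<integral>\<^sup>+x. h x \<partial>lborel)" using A by simp
    have "(\<integral>\<^sup>+x. h (x ** (A ** B)) \<partial>lborel) = (\<integral>\<^sup>+x. h (x ** B) \<partial>lborel)"
      using A[rule_format, of "\<lambda>x. h (x ** B)"] by (simp add: matrix_mul_assoc)
    then show "(\<integral>\<^sup>+x. h (x ** (A ** B)) \<partial>lborel) = (\<integral>\<^sup>+x. h x \<partial>lborel)" using B by simp
  qed
qed

lemma emeasure_SL_mult: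
  fixes g d :: "real^'n^'n"
  assumes "det g = 1" "det d = 1" and V[measurable]: "V \<in> sets borel"
  shows "emeasure lborel {y. g ** y ** d \<in> V} = emeasure lborel V"
proof -
  have "(\<lambda>y. g ** y ** d) \<in> borel_measurable borel"
    by (auto intro!: borel_measurable_continuous_onI continuous_intros)
  from measurable_sets[OF this V] have [measurable]: "{y. g ** y ** d \<in> V} \<in> sets borel"
    by (simp add: vimage_def)
  have "emeasure lborel {y. g ** y ** d \<in> V} = (\<integral>\<^sup>+x. indicator {y. g ** y ** d \<in> V} x \<partial>lborel)"
    by (rule nn_integral_indicator[symmetric]) simp
  also have "\<dots> = (\<integral>\<^sup>+x. indicator V (g ** x ** d) \<partial>lborel)"
    by (rule nn_integral_cong) (simp add: indicator_def)
  also have "\<dots> = (\<integral>\<^sup>+x. indicator V (x ** d) \<partial>lborel)"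
    using nn_integral_SL_mult[OF assms(1), rule_format, of "\<lambda>x. indicator V (x ** d)"] by simp
  also have "\<dots> = (\<integral>\<^sup>+x. indicator V x \<partial>lborel)"
    using nn_integral_SL_mult[OF assms(2), rule_format, of "\<lambda>x. indicator V x"] by simp
  also have "\<dots> = emeasure lborel V" by simp
  finally show ?thesis .
qed

section \<open>Uniform lattices span the matrix algebra\<close>

primrec mpow :: "'a::semiring_1^'n^'n \<Rightarrow> nat \<Rightarrow> 'a^'n^'n" where
  "mpow A 0 = mat 1"
| "mpow A (Suc k) = A ** mpow A k"

lemma mpow_add: "mpow A (k + l) = mpow A k ** mpow A l"
  by (induction k) (auto simp: matrix_mul_assoc)

lemma det_mpow: "det (mpow A k) = (det A ^ k :: 'a::comm_ring_1)"
  by (induction k) (auto simp: det_mul)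

lemma mpow_transv: "i \<noteq> j \<Longrightarrow> mpow (transv i j t) k = transv i j (of_nat k * t :: 'a::comm_ring_1)"
  by (induction k) (auto simp: transv_add algebra_simps)

lemma det_scaleR: "det (c *\<^sub>R A) = c ^ CARD('n) * det (A :: real^'n^'n)"
proof -
  have "c *\<^sub>R A = diagm (\<lambda>_. c) ** A" by (simp add: vec_eq_iff diagm_mult_nth)
  then show ?thesis by (simp add: det_mul det_diagm)
qed

lemma matrix_mult_bound:
  "\<exists>K>0. \<forall>(A :: real^'n^'n) B :: real^'n^'n. norm (A ** B) \<le> norm A * norm B * K"
  by (rule bounded_bilinear.pos_bounded[OF bounded_bilinear_matrix_mult])

lemma near_one_det: "\<exists>d>0. \<forall>A::real^'n^'n. norm (A - mat 1) < d \<longrightarrow> 1/2 < det A \<and> det A < 2"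
proof -
  let ?S = "{A::real^'n^'n. 1/2 < det A \<and> det A < 2}"
  have "open ?S"
    by (intro open_Collect_conj open_Collect_less continuous_intros)
  moreover have "mat 1 \<in> ?S" by simp
  ultimately obtain d where d: "d > 0" "ball (mat 1) d \<subseteq> ?S" by (rule openE)
  have "A \<in> ?S" if "norm (A - mat 1) < d" for A
    using that d(2) by (intro subsetD[OF d(2)]) (simp add: dist_norm norm_minus_commute)
  then show ?thesis using d(1) by blast
qed

text \<open>
  The bounds on the determinant allow a matrix near one to be rescaled into the special linear
  group.
\<close>

lemma near_one_inverse:
  assumes "r > 0"
  shows "\<exists>d>0. \<forall>A::real^'n^'n. norm (A - mat 1) < d \<longrightarrow>
    1/2 < det A \<and> det A < 2 \<and> norm (matrix_inv A - mat 1) < r"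
proof -
  obtain d0 where d0: "d0 > 0" "\<And>A::real^'n^'n. norm (A - mat 1) < d0 \<Longrightarrow> 1/2 < det A \<and> det A < 2"
    using near_one_det by blast
  obtain K where K: "K > 0" "\<And>(A :: real^'n^'n) B :: real^'n^'n. norm (A ** B) \<le> norm A * norm B * K"
    by (rule exE[OF matrix_mult_bound[where 'n = 'n]]) blast
  define N where "N = norm (mat 1 :: real^'n^'n) + 1"
  have N: "N > 0" by (simp add: N_def add_nonneg_pos)
  define d where "d = min d0 (min (1 / (2 * K)) (r / (2 * K * N)))"
  have "d > 0" using d0 K N assms by (simp add: d_def)
  moreover have "1/2 < det A \<and> det A < 2 \<and> norm (matrix_inv A - mat 1) < r"
    if A: "norm (A - mat 1) < d" for A :: "real^'n^'n"
  proof -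
    have dA: "1/2 < det A \<and> det A < 2" using A d0(2) by (simp add: d_def)
    define B where "B = matrix_inv A"
    have BA: "B ** A = mat 1" using dA by (simp add: B_def inverse_matrix)
    have eq: "B - mat 1 = B ** (mat 1 - A)" by (simp add: matrix_sub_ldistrib BA)
    have small: "norm (mat 1 - A) < 1 / (2 * K)" "norm (mat 1 - A) < r / (2 * K * N)"
      using A by (simp_all add: d_def norm_minus_commute)
    have b1: "norm (B - mat 1) \<le> norm B * norm (mat 1 - A) * K" unfolding eq by (rule K(2))
    also have "\<dots> \<le> norm B * (1 / (2 * K)) * K"
      using small K by (intro mult_right_mono mult_left_mono) auto
    also have "\<dots> = norm B / 2" using K by simp
    finally have "norm (B - mat 1) \<le> norm B / 2" .
    then have "norm B \<le> N - 1 + norm B / 2"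
      using norm_triangle_ineq[of "mat 1" "B - mat 1"] by (simp add: N_def)
    then have "norm B < 2 * N" using N by simp
    then have "norm B * norm (mat 1 - A) * K \<le> 2 * N * norm (mat 1 - A) * K"
      using K by (intro mult_right_mono) auto
    also have "\<dots> < 2 * N * (r / (2 * K * N)) * K"
      using small K N by (intro mult_strict_right_mono mult_strict_left_mono) auto
    also have "\<dots> = r" using K N by simp
    finally show ?thesis using b1 dA by (simp add: B_def)
  qed
  ultimately show ?thesis by blast
qed

lemma near_one_mult:
  assumes "r > 0"
  shows "\<exists>d>0. \<forall>A B::real^'n^'n. norm (A - mat 1) < d \<longrightarrow> norm (B - mat 1) < d \<longrightarrow> norm (A ** B - mat 1) < r"
proof -
  obtain K where K: "K > 0" "\<And>(A :: real^'n^'n) B :: real^'n^'n. norm (A ** B) \<le> norm A * norm B * K"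
    by (rule exE[OF matrix_mult_bound[where 'n = 'n]]) blast
  define d where "d = min 1 (r / (2 + K))"
  have "d \<le> r / (2 + K)" by (simp add: d_def)
  then have "d * (2 + K) \<le> r"
    using K(1) pos_le_divide_eq[of "2 + K" d r] by linarith
  moreover have "d > 0" "d \<le> 1" using K(1) assms by (simp_all add: d_def)
  ultimately have d: "d > 0" "d \<le> 1" "d * (2 + K) \<le> r" by auto
  have "norm (A ** B - mat 1) < r" if AB: "norm (A - mat 1) < d" "norm (B - mat 1) < d" for A B :: "real^'n^'n"
  proof -
    have "A ** B - mat 1 = (A - mat 1) + (B - mat 1) + (A - mat 1) ** (B - mat 1)"
      by (simp add: matrix_distribs)
    then have "norm (A ** B - mat 1) \<le> norm (A - mat 1) + norm (B - mat 1) + norm ((A - mat 1) ** (B - mat 1))"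
      by (metis norm_triangle_le norm_triangle_ineq add_right_mono)
    also have "norm ((A - mat 1) ** (B - mat 1)) \<le> norm (A - mat 1) * norm (B - mat 1) * K" by (rule K)
    also have "norm (A - mat 1) * norm (B - mat 1) * K \<le> d * 1 * K"
      using AB d K by (intro mult_right_mono mult_mono) auto
    finally have "norm (A ** B - mat 1) < d + d + d * K" using AB by simp
    also have "\<dots> \<le> r" using d by (simp add: algebra_simps)
    finally show ?thesis .
  qed
  then show ?thesis using d(1) by blast
qed

text \<open>
  A cocompact lattice, with discreteness and cocompactness made quantitative by a radius and a
  bound.
\<close>

locale uniform_lattice =
  fixes L :: "(real^'n^'n) set" and e R :: real
  assumes one: "mat 1 \<in> L"
    and mult: "x \<in> L \<Longrightarrow> y \<in> L \<Longrightarrow> x ** y \<in> L"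
    and inv: "x \<in> L \<Longrightarrow> matrix_inv x \<in> L"
    and det: "x \<in> L \<Longrightarrow> det x = 1"
    and discrete: "e > 0" "x \<in> L \<Longrightarrow> norm (x - mat 1) < e \<Longrightarrow> x = mat 1"
    and cocompact: "det g = 1 \<Longrightarrow> \<exists>x\<in>L. norm (g ** x) \<le> R"
begin

lemma R_nonneg: "0 \<le> R"
  using cocompact[of "mat 1"] by (metis det_I norm_ge_zero order_trans)

lemma finite_ball: "finite {x \<in> L. norm x \<le> r}"
proof -
  obtain K where K: "K > 0" "\<And>(A :: real^'n^'n) B :: real^'n^'n. norm (A ** B) \<le> norm A * norm B * K"
    by (rule exE[OF matrix_mult_bound[where 'n = 'n]]) blast
  obtain B where B: "B > 0" "\<And>A::real^'n^'n. det A = 1 \<Longrightarrow> norm A \<le> r \<Longrightarrow> norm (matrix_inv A) \<le> B"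
    using bounded_inverse_SL by metis
  have "x = y" if xy: "x \<in> L" "y \<in> L" "norm x \<le> r" "norm y \<le> r" "dist x y < e / (B * K)" for x y
  proof -
    have d: "det x \<noteq> 0" "det x = 1" using det xy by auto
    have "matrix_inv x ** y - mat 1 = matrix_inv x ** (y - x)"
      using d by (simp add: matrix_sub_ldistrib inverse_matrix)
    then have "norm (matrix_inv x ** y - mat 1) \<le> norm (matrix_inv x) * norm (y - x) * K"
      using K by metis
    also have "\<dots> \<le> B * norm (y - x) * K"
      using B(2)[of x] d xy K by (intro mult_right_mono) auto
    also have "\<dots> < B * (e / (B * K)) * K"
      using xy(5) B K by (intro mult_strict_right_mono mult_strict_left_mono)
        (auto simp: dist_norm norm_minus_commute)
    also have "\<dots> = e" using B K by simp
    finally have "matrix_inv x ** y = mat 1"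
      using discrete(2) mult inv xy by blast
    then show ?thesis
      by (metis d(1) inverse_matrix(1) matrix_mul_assoc matrix_mul_lid matrix_mul_rid)
  qed
  moreover have "e / (B * K) > 0" using discrete(1) B K by simp
  ultimately have "uniform_discrete {x \<in> L. norm x \<le> r}"
    unfolding uniform_discrete_def by blast
  moreover have "bounded {x \<in> L. norm x \<le> r}"
    by (rule boundedI[of _ r]) auto
  ultimately show ?thesis using uniform_discrete_finite_iff by blast
qed

text \<open>
  Poincare recurrence. Let \<open>U\<close> be a small ball around one. If the claim failed, the
  sets \<open>g\<^sup>k U x\<close> for natural \<open>k\<close> and \<open>x\<close> in
  \<open>L\<close> would be pairwise disjoint. By cocompactness each \<open>g\<^sup>k U\<close> can
  be cut into finitely many pieces that translate into one fixed ball, so for every number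
  \<open>M\<close> of powers this ball would have at least \<open>M\<close> times the volume of
  \<open>U\<close>. Working with a ball of matrices, rather than with a part of the special linear
  group, makes Lebesgue measure serve as Haar measure.
\<close>

lemma recurrence:
  assumes g: "det g = 1" and r: "r > 0"
  shows "\<exists>m\<ge>1. \<exists>A B. norm (A - mat 1) < r \<and> norm (B - mat 1) < r \<and> A ** mpow g m ** B \<in> L"
proof (rule ccontr)
  assume neg: "\<not> ?thesis"
  obtain d1 where d1: "d1 > 0" "\<And>A B::real^'n^'n. norm (A - mat 1) < d1 \<Longrightarrow> norm (B - mat 1) < d1 \<Longrightarrow>
      norm (A ** B - mat 1) < e"
    using near_one_mult[OF discrete(1)] by blast
  define r1 where "r1 = min 1 (min r d1)"
  have "r1 > 0" using r d1 by (simp add: r1_def)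
  then obtain d where d: "d > 0" "\<And>A::real^'n^'n. norm (A - mat 1) < d \<Longrightarrow>
    1/2 < det A \<and> det A < 2 \<and> norm (matrix_inv A - mat 1) < r1"
    using near_one_inverse by blast
  define r2 where "r2 = min d r1"
  have r2: "r2 > 0" "r2 \<le> d" "r2 \<le> r1" using d \<open>r1 > 0\<close> by (auto simp: r2_def)
  define U where "U = ball (mat 1 :: real^'n^'n) r2"
  have U: "norm (A - mat 1) < r1" "1/2 < det A" "det A < 2" "norm (matrix_inv A - mat 1) < r1" if "A \<in> U" for A
    using that d(2)[of A] r2 by (auto simp: U_def dist_norm norm_minus_commute)
  define G where "G k = mpow g k" for k
  have detG: "det (G k) = 1" for k by (simp add: G_def det_mpow g)
  \<comment> \<open>for \<open>k < l\<close> by the negated claim, for \<open>k = l\<close> by discreteness\<close>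
  have disj: "k = l \<and> x = y" if "k \<le> l" "x \<in> L" "y \<in> L" "A \<in> U" "B \<in> U" "G k ** A ** x = G l ** B ** y"
    for k l x y A B
  proof -
    define A' where "A' = matrix_inv A"
    have dA: "det A \<noteq> 0" using U[OF that(4)] by auto
    have dy: "det y \<noteq> 0" using det that by auto
    have dk: "det (G k) \<noteq> 0" using detG[of k] by simp
    have "G l = G k ** G (l - k)"
      using that(1) by (simp add: G_def mpow_add[symmetric])
    then have "G k ** (A ** x) = G k ** (G (l - k) ** B ** y)"
      using that(6) by (simp add: matrix_mul_assoc)
    then have "A ** x = G (l - k) ** B ** y"
      using matrix_left_cancel(2)[OF inverse_matrix(1)[OF dk]] by metis
    then have "A' ** (A ** x) = A' ** (G (l - k) ** B ** y)" by (rule arg_cong)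
    moreover have "A' ** (A ** x) = x"
      unfolding A'_def by (rule matrix_left_cancel(2)[OF inverse_matrix(1)[OF dA]])
    ultimately have "x = A' ** G (l - k) ** B ** y"
      by (metis matrix_mul_assoc)
    then have "x ** matrix_inv y = A' ** G (l - k) ** B ** (y ** matrix_inv y)"
      by (metis matrix_mul_assoc)
    then have eq: "x ** matrix_inv y = A' ** G (l - k) ** B"
      by (simp only: inverse_matrix(1)[OF dy] matrix_mul_rid)
    have xy: "x ** matrix_inv y \<in> L" using that mult inv by blast
    have A'B: "norm (A' - mat 1) < r1" "norm (B - mat 1) < r1"
      using U[OF that(4)] U[OF that(5)] by (auto simp: A'_def)
    have kl: "k = l"
    proof (rule ccontr)
      assume "k \<noteq> l"
      then have "l - k \<ge> 1" using that(1) by simp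
      moreover have "A' ** mpow g (l - k) ** B \<in> L" using xy eq by (simp add: G_def)
      moreover have "norm (A' - mat 1) < r" "norm (B - mat 1) < r" using A'B by (auto simp: r1_def)
      ultimately show False using neg by blast
    qed
    then have "x ** matrix_inv y = A' ** B" using eq by (simp add: G_def)
    moreover have "norm (A' ** B - mat 1) < e" using A'B by (intro d1) (auto simp: r1_def)
    ultimately have "x ** matrix_inv y = mat 1" using discrete(2) xy by metis
    then have "x ** (matrix_inv y ** y) = y" by (simp add: matrix_mul_assoc)
    then show ?thesis using dy kl by (simp add: inverse_matrix)
  qed
  define V where "V k (x :: real^'n^'n) = U \<inter> {A. norm (G k ** A ** x) \<le> 2 * R}" for k x
  define E where "E k (x :: real^'n^'n) = {y. matrix_inv (G k) ** y ** matrix_inv x \<in> V k x}" for k x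
  define F where "F k = {x \<in> L. V k x \<noteq> {}}" for k
  have Vm[measurable]: "V k x \<in> sets borel" for k x
  proof -
    have "closed {A. norm (G k ** A ** x) \<le> 2 * R}"
      by (intro closed_Collect_le continuous_intros)
    then show ?thesis unfolding V_def U_def by (intro sets.Int) auto
  qed
  have Em[measurable]: "E k x \<in> sets borel" for k x
  proof -
    have "(\<lambda>y. matrix_inv (G k) ** y ** matrix_inv x) \<in> borel_measurable borel"
      by (auto intro!: borel_measurable_continuous_onI continuous_intros)
    from measurable_sets[OF this Vm[of k x]] show ?thesis by (simp add: E_def vimage_def)
  qed
  have EV: "emeasure lborel (E k x) = emeasure lborel (V k x)" if "x \<in> L" for k x
    unfolding E_def using det[OF that] detG[of k] by (intro emeasure_SL_mult) (auto simp: det_matrix_inv)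
  have Ex: "\<exists>A\<in>V k x. y = G k ** A ** x" if "y \<in> E k x" "x \<in> L" for k x y
  proof -
    have "det x \<noteq> 0" "det (G k) \<noteq> 0" using det that detG[of k] by auto
    then have "y = G k ** (matrix_inv (G k) ** (y ** (matrix_inv x ** x)))"
      by (simp add: inverse_matrix matrix_left_cancel)
    then have "y = G k ** (matrix_inv (G k) ** y ** matrix_inv x) ** x"
      by (simp add: matrix_mul_assoc)
    then show ?thesis using that(1) unfolding E_def by blast
  qed
  obtain K where K: "K > 0" "\<And>(A :: real^'n^'n) B :: real^'n^'n. norm (A ** B) \<le> norm A * norm B * K"
    by (rule exE[OF matrix_mult_bound[where 'n = 'n]]) blast
  have finF: "finite (F k)" for k
  proof (rule finite_subset[OF _ finite_ball])
    let ?r = "(norm (mat 1 :: real^'n^'n) + 1) * (norm (matrix_inv (G k)) * (2 * R) * K) * K"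
    show "F k \<subseteq> {x \<in> L. norm x \<le> ?r}"
    proof
      fix x assume x: "x \<in> F k"
      then obtain A where A: "A \<in> U" "norm (G k ** A ** x) \<le> 2 * R" by (auto simp: F_def V_def)
      have "det A \<noteq> 0" "det (G k) \<noteq> 0" using U[OF A(1)] detG[of k] by auto
      then have "x = matrix_inv A ** (matrix_inv (G k) ** (G k ** A ** x))"
        by (simp add: inverse_matrix matrix_left_cancel matrix_mul_assoc[symmetric])
      then have "norm x \<le> norm (matrix_inv A) * norm (matrix_inv (G k) ** (G k ** A ** x)) * K"
        using K(2) by metis
      also have "\<dots> \<le> norm (matrix_inv A) * (norm (matrix_inv (G k)) * norm (G k ** A ** x) * K) * K"
        using K by (intro mult_right_mono mult_left_mono) auto
      also have "\<dots> \<le> ?r"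
      proof (intro mult_right_mono mult_mono mult_nonneg_nonneg)
        show "norm (matrix_inv A) \<le> norm (mat 1 :: real^'n^'n) + 1"
          using U(4)[OF A(1)] norm_triangle_ineq[of "matrix_inv A - mat 1" "mat 1"] by (simp add: r1_def)
      qed (use A K R_nonneg in auto)
      finally show "x \<in> {x \<in> L. norm x \<le> ?r}" using x by (simp add: F_def)
    qed
  qed
  have cover: "U \<subseteq> (\<Union>x\<in>F k. V k x)" for k
  proof
    fix A assume A: "A \<in> U"
    define c where "c = root CARD('n) (det A)"
    have c0: "c > 0" using U[OF A] by (simp add: c_def)
    have cn: "c ^ CARD('n) = det A" using U[OF A] by (simp add: c_def)
    have "det A \<le> 2 ^ CARD('n)" using U[OF A] self_le_power[of "2::real" "CARD('n)"] by simp
    then have "c \<le> root CARD('n) (2 ^ CARD('n))" unfolding c_def by simp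
    then have c2: "c \<le> 2" by (simp add: real_root_power_cancel)
    have "det ((1 / c) *\<^sub>R (G k ** A)) = 1"
      using c0 cn U(2)[OF A] by (simp add: det_scaleR det_mul detG power_divide)
    then obtain x where x: "x \<in> L" "norm ((1 / c) *\<^sub>R (G k ** A) ** x) \<le> R"
      using cocompact by blast
    have "norm (G k ** A ** x) = c * norm ((1 / c) *\<^sub>R (G k ** A) ** x)"
      using c0 by (simp add: matrix_scaleR_left)
    also have "\<dots> \<le> 2 * R" using c2 c0 x(2) R_nonneg by (intro mult_mono) auto
    finally show "A \<in> (\<Union>x\<in>F k. V k x)" using A x by (auto simp: V_def F_def)
  qed
  define a where "a = measure lborel U"
  define b where "b = measure lborel (cball (0 :: real^'n^'n) (2 * R))"
  have a: "a > 0" "emeasure lborel U = ennreal a"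
    using r2 content_ball_pos[of r2 "mat 1 :: real^'n^'n"]
      emeasure_lborel_ball_finite[of "mat 1 :: real^'n^'n" r2]
    by (auto simp: a_def U_def intro!: emeasure_eq_ennreal_measure)
  have b: "emeasure lborel (cball (0 :: real^'n^'n) (2 * R)) = ennreal b"
    using emeasure_lborel_cball_finite[of "0 :: real^'n^'n" "2 * R"]
    by (auto simp: b_def intro!: emeasure_eq_ennreal_measure)
  have "real M * a \<le> b" for M :: nat
  proof -
    let ?I = "SIGMA k:{..<M}. F k"
    have "of_nat M * emeasure lborel U = (\<Sum>k<M. emeasure lborel U)" by simp
    also have "\<dots> \<le> (\<Sum>k<M. emeasure lborel (\<Union>x\<in>F k. V k x))"
      using cover finF by (intro sum_mono emeasure_mono) (auto intro!: sets.finite_UN)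
    also have "\<dots> \<le> (\<Sum>k<M. \<Sum>x\<in>F k. emeasure lborel (V k x))"
      using finF by (intro sum_mono emeasure_subadditive_finite) auto
    also have "\<dots> = (\<Sum>k<M. \<Sum>x\<in>F k. emeasure lborel (E k x))"
      by (intro sum.cong refl EV[symmetric]) (auto simp: F_def)
    also have "\<dots> = (\<Sum>i\<in>?I. emeasure lborel (case i of (k, x) \<Rightarrow> E k x))"
      using finF by (subst sum.Sigma) (auto intro!: sum.cong)
    also have "\<dots> = emeasure lborel (\<Union>i\<in>?I. case i of (k, x) \<Rightarrow> E k x)"
    proof (rule sum_emeasure)
      show "disjoint_family_on (\<lambda>i. case i of (k, x) \<Rightarrow> E k x) ?I"
        unfolding disjoint_family_on_def
      proof (intro ballI impI)
        fix i j assume ij: "i \<in> ?I" "j \<in> ?I" "i \<noteq> j"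
        obtain k x l y where kl: "i = (k, x)" "j = (l, y)" by (metis surj_pair)
        have xy: "x \<in> L" "y \<in> L" using ij kl by (auto simp: F_def)
        have False if z: "z \<in> E k x" "z \<in> E l y" for z
        proof -
          obtain A where A: "A \<in> U" "z = G k ** A ** x" using Ex[OF z(1) xy(1)] by (auto simp: V_def)
          obtain B where B: "B \<in> U" "z = G l ** B ** y" using Ex[OF z(2) xy(2)] by (auto simp: V_def)
          have "k = l \<and> x = y"
          proof (cases "k \<le> l")
            case True
            then show ?thesis using disj[of k l x y A B] xy A B by metis
          next
            case False
            then show ?thesis using disj[of l k y x B A] xy A B by (metis nat_le_linear)
          qed
          then show False using ij kl by simp
        qed
        then show "(case i of (k, x) \<Rightarrow> E k x) \<inter> (case j of (k, x) \<Rightarrow> E k x) = {}"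
          unfolding kl by auto
      qed
    qed (use finF in auto)
    also have "\<dots> \<le> emeasure lborel (cball (0 :: real^'n^'n) (2 * R))"
    proof (rule emeasure_mono)
      show "(\<Union>i\<in>?I. case i of (k, x) \<Rightarrow> E k x) \<subseteq> cball 0 (2 * R)"
        using Ex by (fastforce simp: F_def V_def)
    qed simp
    finally have "of_nat M * ennreal a \<le> ennreal b" using a b by simp
    then have "ennreal (real M * a) \<le> ennreal b"
      using a by (simp add: ennreal_mult ennreal_of_nat_eq_real_of_nat)
    then show ?thesis using a by (simp add: b_def)
  qed
  then show False using reals_Archimedean3[OF a(1)] by (meson not_le)
qed

lemma span_mult:
  assumes "A \<in> span L" "B \<in> span L"
  shows "A ** B \<in> span L"
proof -
  have 1: "x ** B \<in> span L" if x: "x \<in> L" for x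
    using assms(2)
  proof (induction rule: span_induct_alt)
    case base
    then show ?case by (simp add: span_zero)
  next
    case (step c y z)
    then show ?case using mult[OF x] x
      by (simp add: matrix_add_ldistrib matrix_scaleR_right span_add span_scale span_base)
  qed
  show ?thesis
    using assms(1)
  proof (induction rule: span_induct_alt)
    case base
    then show ?case by (simp add: span_zero)
  next
    case (step c y z)
    then show ?case using 1
      by (simp add: matrix_add_rdistrib matrix_scaleR_left span_add span_scale)
  qed
qed

text \<open>
  A high power of the transvection \<open>1 + c E\<close> is \<open>1 + m c E\<close>; divided by
  \<open>m c\<close> it tends to \<open>E\<close>. By recurrence these quotients are close to
  multiples of elements of \<open>L\<close>, and the span is closed.
\<close>

lemma elem_in_span:
  assumes ij: "i \<noteq> j"
  shows "elem i j 1 \<in> span L"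
proof -
  have "\<exists>m A B. m \<ge> 1 \<and> norm (A - mat 1) < 1 / real (Suc k) \<and> norm (B - mat 1) < 1 / real (Suc k) \<and>
     A ** mpow (transv i j (real (Suc k))) m ** B \<in> L" for k
    using recurrence[of "transv i j (real (Suc k))" "1 / real (Suc k)"] det_transv[OF ij] by auto
  then obtain m A B where m: "\<And>k. m k \<ge> (1::nat)"
    and A: "\<And>k. norm (A k - mat 1) < 1 / real (Suc k)" and B: "\<And>k. norm (B k - mat 1) < 1 / real (Suc k)"
    and L: "\<And>k. A k ** mpow (transv i j (real (Suc k))) (m k) ** B k \<in> L"
    by metis
  define c where "c k = 1 / (real (m k) * real (Suc k))" for k
  have c: "0 < c k" "c k \<le> 1 / real (Suc k)" for k
  proof -
    have "real (Suc k) * 1 \<le> real (Suc k) * real (m k)" using m[of k] by (intro mult_left_mono) auto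
    then show "0 < c k" "c k \<le> 1 / real (Suc k)" using m[of k] by (auto simp: c_def field_simps)
  qed
  define g where "g k = A k ** (c k *\<^sub>R mat 1 + elem i j 1) ** B k" for k
  have "g k \<in> span L" for k
  proof -
    have "g k = c k *\<^sub>R (A k ** mpow (transv i j (real (Suc k))) (m k) ** B k)"
    proof -
      have "c k *\<^sub>R mpow (transv i j (real (Suc k))) (m k) = c k *\<^sub>R mat 1 + elem i j 1"
        using c[of k] m[of k] unfolding mpow_transv[OF ij]
        by (simp add: transv_def scaleR_add_right scaleR_elem c_def)
      then have "g k = A k ** (c k *\<^sub>R mpow (transv i j (real (Suc k))) (m k)) ** B k"
        by (simp only: g_def)
      then show ?thesis by (simp only: matrix_scaleR_left matrix_scaleR_right)
    qed
    then show ?thesis using L by (simp add: span_scale span_base)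
  qed
  moreover have "g \<longlonglongrightarrow> mat 1 ** (0 *\<^sub>R mat 1 + elem i j 1) ** mat 1"
    unfolding g_def
  proof (intro tendsto_matrix_mult tendsto_intros)
    have s: "(\<lambda>k. 1 / real (Suc k)) \<longlonglongrightarrow> 0" using LIMSEQ_inverse_real_of_nat by (simp add: inverse_eq_divide)
    show "A \<longlonglongrightarrow> mat 1"
      by (rule LIM_zero_cancel, rule Lim_null_comparison[OF _ s])
        (intro always_eventually allI less_imp_le A)
    show "B \<longlonglongrightarrow> mat 1"
      by (rule LIM_zero_cancel, rule Lim_null_comparison[OF _ s])
        (intro always_eventually allI less_imp_le B)
    have "norm (c k) \<le> 1 / real (Suc k)" for k using c[of k] by simp
    then show "c \<longlonglongrightarrow> 0"
      by (intro Lim_null_comparison[OF _ s] always_eventually allI)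
  qed
  ultimately have "mat 1 ** (0 *\<^sub>R mat 1 + elem i j 1) ** mat 1 \<in> span L"
    using closed_sequentially[OF closed_subspace[OF subspace_span[of L]]] by blast
  then show ?thesis by simp
qed

proposition span_lattice:
  assumes "CARD('n) \<ge> 2"
  shows "span L = UNIV"
proof -
  have e: "elem i j 1 \<in> span L" for i j
  proof (cases "i = j")
    case True
    obtain k where "k \<noteq> i"
      using assms ex_index_outside[of "{i}"] by auto
    then show ?thesis
      using True span_mult[OF elem_in_span[of i k] elem_in_span[of k i]] by (simp add: elem_mult_elem)
  qed (rule elem_in_span)
  have "A \<in> span L" for A
    by (subst sum_elem[of A]) (intro span_sum, metis e mult.right_neutral real_scaleR_def scaleR_elem span_scale)
  then show ?thesis by blast
qed

end

section \<open>Linear relations in vector spaces\<close>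

context vector_space begin

lemma family_dependent:
  assumes "finite T" "finite I" "f ` I \<subseteq> span T" "card T < card I"
  shows "\<exists>c. (\<exists>i\<in>I. c i \<noteq> 0) \<and> (\<Sum>i\<in>I. scale (c i) (f i)) = 0"
proof (cases "inj_on f I")
  case True
  have "dependent (f ` I)"
  proof (rule ccontr)
    assume "independent (f ` I)"
    then have "card (f ` I) \<le> card T"
      using independent_span_bound assms(1,3) by blast
    then show False using True assms(4) by (simp add: card_image)
  qed
  then obtain u where u: "\<exists>v\<in>f ` I. u v \<noteq> 0" "(\<Sum>v\<in>f ` I. scale (u v) v) = 0"
    using dependent_finite[of "f ` I"] assms(2) by auto
  have "(\<Sum>i\<in>I. scale (u (f i)) (f i)) = 0"
    using u(2) True by (simp add: sum.reindex)
  then show ?thesis using u(1) by (intro exI[of _ "u \<circ> f"]) auto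
next
  case False
  then obtain i j where ij: "i \<in> I" "j \<in> I" "i \<noteq> j" "f i = f j"
    by (auto simp: inj_on_def)
  define c where "c k = (if k = i then 1 else if k = j then - 1 else (0::'a))" for k
  have "(\<Sum>k\<in>I. scale (c k) (f k)) = (\<Sum>k\<in>{i, j}. scale (c k) (f k))"
    using ij assms(2) by (intro sum.mono_neutral_right) (auto simp: c_def)
  also have "\<dots> = 0" using ij by (simp add: c_def)
  finally show ?thesis using ij(1) by (intro exI[of _ c]) (auto simp: c_def)
qed

end

section \<open>Simultaneous eigenvectors\<close>

definition poly_apply :: "complex^'n^'n \<Rightarrow> complex poly \<Rightarrow> complex^'n \<Rightarrow> complex^'n" where
  "poly_apply M p v = fold_coeffs (\<lambda>a u. a *s v + M *v u) p 0"

lemma poly_apply_0 [simp]: "poly_apply M 0 v = 0" by (simp add: poly_apply_def)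

lemma poly_apply_pCons [simp]: "poly_apply M (pCons a p) v = a *s v + M *v poly_apply M p v"
  by (cases "a = 0 \<and> p = 0") (auto simp: poly_apply_def fold_coeffs_pCons_not_0_0_eq fold_coeffs_pCons_coeff_not_0_eq)

lemma poly_apply_add: "poly_apply M (p + q) v = poly_apply M p v + poly_apply M q v"
proof (induction p arbitrary: q)
  case (pCons a p)
  then show ?case
    by (cases q) (simp add: matrix_vector_right_distrib vector_sadd_rdistrib algebra_simps)
qed simp

lemma poly_apply_smult: "poly_apply M (Polynomial.smult c p) v = c *s poly_apply M p v"
  by (induction p) (auto simp: vector_add_ldistrib vector_smult_assoc 
      vec.linear_scale[OF matrix_vector_mul_linear_gen])

lemma poly_apply_in_subspace:
  assumes "vec.subspace S" "\<And>x. x \<in> S \<Longrightarrow> M *v x \<in> S" "v \<in> S"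
  shows "poly_apply M p v \<in> S"
  by (induction p) (auto intro!: vec.subspace_add vec.subspace_scale assms vec.subspace_0)

text \<open>
  A polynomial of least degree that annihilates a vector of \<open>S\<close> is a linear factor
  times a polynomial that does not.
\<close>

lemma eigenvector_in_subspace:
  fixes M :: "complex^'n^'n"
  assumes S: "vec.subspace S" "\<And>x. x \<in> S \<Longrightarrow> M *v x \<in> S" and v: "v \<in> S" "v \<noteq> 0"
  shows "\<exists>w c. w \<in> S \<and> w \<noteq> 0 \<and> M *v w = c *s w"
proof -
  define N where "N = CARD('n)"
  have "\<exists>c. (\<exists>i\<in>{..N}. c i \<noteq> 0) \<and> (\<Sum>i\<in>{..N}. c i *s poly_apply M (Polynomial.monom 1 i) v) = 0"
    by (rule vec.family_dependent[where T = cart_basis])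
      (auto simp: finite_cart_basis card_cart_basis N_def)
  then obtain c i where c: "i \<le> N" "c i \<noteq> 0" "(\<Sum>i\<le>N. c i *s poly_apply M (Polynomial.monom 1 i) v) = 0"
    by auto
  define p where "p = (\<Sum>i\<le>N. Polynomial.monom (c i) i)"
  have "poly_apply M (\<Sum>i\<in>I. Polynomial.monom (c i) i) v = (\<Sum>i\<in>I. c i *s poly_apply M (Polynomial.monom 1 i) v)" for I
    by (induction I rule: infinite_finite_induct)
      (auto simp: poly_apply_add smult_monom poly_apply_smult[symmetric])
  then have "poly_apply M p v = 0" using c(3) by (simp add: p_def)
  moreover have "poly.coeff p i = c i"
    using c(1) by (simp add: p_def coeff_sum)
  then have "p \<noteq> 0" using c(2) by auto
  ultimately have "\<exists>p. p \<noteq> 0 \<and> poly_apply M p v = 0" by blast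
  then obtain p where p: "p \<noteq> 0" "poly_apply M p v = 0"
    and min: "\<And>q. q \<noteq> 0 \<Longrightarrow> poly_apply M q v = 0 \<Longrightarrow> Polynomial.degree p \<le> Polynomial.degree q"
    using ex_has_least_nat[of "\<lambda>p. p \<noteq> 0 \<and> poly_apply M p v = 0" _ Polynomial.degree] by metis
  have "Polynomial.degree p \<noteq> 0"
  proof
    assume "Polynomial.degree p = 0"
    then obtain a where "p = [:a:]" using degree_eq_zeroE by blast
    then show False using p v by auto
  qed
  then obtain z where "poly p z = 0"
    using fundamental_theorem_of_algebra[of p] by (auto simp: constant_degree)
  then obtain q where q: "p = [:- z, 1:] * q" by (metis dvdE poly_eq_0_iff_dvd)
  have q0: "q \<noteq> 0" using q p by auto
  have "Polynomial.degree p = Polynomial.degree q + 1"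
    unfolding q using q0 by (subst degree_mult_eq) auto
  then have w0: "poly_apply M q v \<noteq> 0" using min[of q] q0 by auto
  have "p = Polynomial.smult (- z) q + pCons 0 q" using q by simp
  then have "0 = (- z) *s poly_apply M q v + M *v poly_apply M q v"
    using p(2) by (simp only: poly_apply_add poly_apply_smult poly_apply_pCons) simp
  then have "M *v poly_apply M q v = z *s poly_apply M q v"
    by (simp add: vec_eq_iff)
  then show ?thesis using w0 poly_apply_in_subspace[OF S v(1)] by blast
qed

text \<open>
  On an invariant subspace of least positive dimension each of the matrices is scalar, because its
  eigenspaces there are invariant.
\<close>

lemma simultaneous_eigenvector:
  fixes M :: "'i \<Rightarrow> complex^'n^'n"
  assumes comm: "\<And>i j. M i ** M j = M j ** M i"
    and S: "vec.subspace S" "\<And>i x. x \<in> S \<Longrightarrow> M i *v x \<in> S" and v: "v \<in> S" "v \<noteq> 0"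
  shows "\<exists>w c. w \<in> S \<and> w \<noteq> 0 \<and> (\<forall>i. M i *v w = c i *s w)"
proof -
  define Q where "Q T \<longleftrightarrow> vec.subspace T \<and> (\<forall>i. \<forall>x\<in>T. M i *v x \<in> T) \<and> (\<exists>v\<in>T. v \<noteq> 0) \<and> T \<subseteq> S" for T
  have "Q S" unfolding Q_def using S v by blast
  then obtain T where T: "Q T" and min: "\<And>T'. Q T' \<Longrightarrow> vec.dim T \<le> vec.dim T'"
    using ex_has_least_nat[of Q S vec.dim] by blast
  have T1: "vec.subspace T" and T2: "\<And>i x. x \<in> T \<Longrightarrow> M i *v x \<in> T" and T3: "T \<subseteq> S"
    using T unfolding Q_def by auto
  obtain x0 where x0: "x0 \<in> T" "x0 \<noteq> 0" using T unfolding Q_def by auto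
  have "\<exists>c. \<forall>x\<in>T. M i *v x = c *s x" for i
  proof -
    obtain w c where w: "w \<in> T" "w \<noteq> 0" "M i *v w = c *s w"
      using eigenvector_in_subspace[OF T1 T2[of _ i] x0] by auto
    define T' where "T' = {x \<in> T. M i *v x = c *s x}"
    have "vec.subspace T'"
      using T1 unfolding T'_def vec.subspace_def
      by (auto simp: matrix_vector_right_distrib vector_add_ldistrib vector_smult_assoc mult.commute
          vec.linear_scale[OF matrix_vector_mul_linear_gen])
    moreover have "M j *v x \<in> T'" if "x \<in> T'" for j x
    proof -
      have "M i *v (M j *v x) = M j *v (M i *v x)"
        by (simp add: matrix_vector_mul_assoc comm)
      also have "\<dots> = c *s (M j *v x)"
        using that by (simp add: T'_def vec.linear_scale[OF matrix_vector_mul_linear_gen])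
      finally show ?thesis using that T2 by (simp add: T'_def)
    qed
    moreover have "w \<in> T'" "T' \<subseteq> T" using w by (auto simp: T'_def)
    ultimately have "Q T'" using T3 w unfolding Q_def by blast
    then have "T' = T"
      using min[of T'] T1 \<open>T' \<subseteq> T\<close> by (intro vec.subspace_dim_equal) (auto simp: Q_def)
    then show ?thesis unfolding T'_def by blast
  qed
  then obtain c where "\<And>i x. x \<in> T \<Longrightarrow> M i *v x = c i *s x" by metis
  then show ?thesis using x0 T3 by blast
qed

text \<open>
  Applying \<open>M i - w k0 i\<close> removes the summand \<open>k0\<close>, and \<open>i\<close>
  can be chosen such that a given other summand survives.
\<close>

lemma weight_vectors_independent:
  fixes M :: "'i \<Rightarrow> complex^'n^'n" and w :: "'k \<Rightarrow> 'i \<Rightarrow> complex"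
  assumes "finite I" "inj_on w I" "\<And>k i. k \<in> I \<Longrightarrow> M i *v u k = w k i *s u k"
    "(\<Sum>k\<in>I. u k) = 0" "k \<in> I"
  shows "u k = 0"
  using assms
proof (induction I arbitrary: u k rule: finite_induct)
  case empty
  then show ?case by simp
next
  case (insert k0 I)
  have other: "u k = 0" if k: "k \<in> I" for k
  proof -
    have "w k \<noteq> w k0" using insert.hyps insert.prems(1) k by (auto simp: inj_on_def)
    then obtain i where i: "w k i \<noteq> w k0 i" by auto
    define u' where "u' k = (w k i - w k0 i) *s u k" for k
    have "(\<Sum>k\<in>insert k0 I. M i *v u k) = 0"
      using insert.prems(3) by (simp only: vec.linear_sum[OF matrix_vector_mul_linear_gen, symmetric]) simp
    then have "(\<Sum>k\<in>insert k0 I. w k i *s u k) = 0"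
      using insert.prems(2) by simp
    moreover have "(\<Sum>k\<in>insert k0 I. w k0 i *s u k) = 0"
      using insert.prems(3) by (simp only: vec.scale_sum_right[symmetric]) simp
    ultimately have "(\<Sum>k\<in>insert k0 I. u' k) = 0"
      by (simp add: u'_def vec.scale_left_diff_distrib sum_subtractf algebra_simps
          del: sum.insert)
    then have "(\<Sum>k\<in>I. u' k) = 0"
      using insert.hyps by (simp add: u'_def)
    moreover have "M j *v u' k = w k j *s u' k" if "k \<in> I" for k j
    proof -
      have "M j *v u k = w k j *s u k" using insert.prems(2) that by blast
      then show ?thesis
        unfolding u'_def vec.linear_scale[OF matrix_vector_mul_linear_gen]
        by (simp only: vector_smult_assoc mult.commute)
    qed
    ultimately have "u' k = 0"
      using insert.IH[of u' k] insert.prems(1) k by (auto simp: inj_on_def)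
    then show ?thesis using i by (simp add: u'_def)
  qed
  then have "u k0 = 0" using insert.prems(3) insert.hyps by simp
  then show ?case using other insert.prems(4) by blast
qed

section \<open>Orbits of the symmetric group on functions\<close>

lemma binomial_gt:
  "2 \<le> k \<Longrightarrow> k + 2 \<le> n \<Longrightarrow> n < n choose k"
proof (induction n)
  case (Suc n)
  show ?case
  proof (cases "k + 2 \<le> n")
    case True
    then have "n < n choose k" using Suc by simp
    moreover have "1 \<le> n choose (k - 1)" using True by (simp add: Suc_le_eq)
    ultimately show ?thesis using Suc.prems binomial_Suc_Suc[of n "k - 1"] by simp
  next
    case False
    then have n: "Suc n = k + 2" using Suc.prems by simp
    have "Suc n choose k = Suc n choose 2"
      using binomial_symmetric[of k "Suc n"] n by simp
    then have c: "Suc n choose k = (k + 2) * (k + 1) div 2" using n by (simp add: choose_two)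
    have "(k + 2) * 3 \<le> (k + 2) * (k + 1)" using Suc.prems by (intro mult_le_mono) auto
    then have "(k + 2) * 3 div 2 \<le> (k + 2) * (k + 1) div 2" by (rule div_le_mono)
    moreover have "k + 2 < (k + 2) * 3 div 2" by presburger
    ultimately show ?thesis unfolding c unfolding n by (rule order.strict_trans2[rotated])
  qed
qed simp

text \<open>
  If some value were taken \<open>k\<close> times with \<open>2 \<le> k \<le> n - 2\<close>, its
  level sets under rearrangement would range over all \<open>k\<close>-subsets, of which there are
  more than \<open>n\<close>. If all values were taken once, there would be \<open>n!\<close>
  rearrangements. So some value is taken \<open>n - 1\<close> times.
\<close>

lemma few_rearrangements:
  fixes f :: "'n::finite \<Rightarrow> 'a"
  assumes n: "CARD('n) \<ge> 3" and nonconst: "f p \<noteq> f q"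
    and few: "\<And>F. finite F \<Longrightarrow> F \<subseteq> {f \<circ> s | s :: 'n \<Rightarrow> 'n. bij s} \<Longrightarrow> card F \<le> CARD('n)"
  shows "\<exists>i0 c d. c \<noteq> d \<and> f = (\<lambda>i. if i = i0 then c else d)"
proof -
  have level: "card {i. f i = a} = 1 \<or> card {i. f i = a} = CARD('n) - 1" if "a \<in> range f" for a
  proof -
    define S where "S = {i. f i = a}"
    define k where "k = card S"
    have "S \<noteq> {}" using that by (auto simp: S_def)
    then have k1: "1 \<le> k" by (simp add: k_def Suc_le_eq card_gt_0_iff)
    have "S \<noteq> UNIV" using nonconst unfolding S_def by (metis (mono_tags) UNIV_I mem_Collect_eq)
    then have k2: "k < CARD('n)" unfolding k_def by (intro psubset_card_mono) auto
    have "\<exists>s::'n \<Rightarrow> 'n. bij s \<and> {i. f (s i) = a} = B" if B: "card B = k" for B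
    proof -
      obtain g where g: "bij_betw g B S"
        using B finite_same_card_bij[OF finite finite, of B S] unfolding k_def by blast
      have "card (- B) = card (- S)"
        using B by (simp add: Compl_eq_Diff_UNIV card_Diff_subset k_def)
      then obtain h where h: "bij_betw h (- B) (- S)"
        using finite_same_card_bij[OF finite finite, of "- B" "- S"] by blast
      define s where "s i = (if i \<in> B then g i else h i)" for i
      have "bij_betw s (B \<union> - B) (S \<union> - S)"
      proof (rule bij_betw_combine)
        show "bij_betw s B S" using g by (rule bij_betw_cong[THEN iffD1, rotated]) (simp add: s_def)
        show "bij_betw s (- B) (- S)" using h by (rule bij_betw_cong[THEN iffD1, rotated]) (simp add: s_def)
      qed simp
      then have "bij s" by simp
      moreover have "s i \<in> S \<longleftrightarrow> i \<in> B" for i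
        using g h by (auto simp: s_def bij_betw_def)
      ultimately show ?thesis unfolding S_def by blast
    qed
    then obtain s :: "'n set \<Rightarrow> 'n \<Rightarrow> 'n" where
      s: "\<And>B. card B = k \<Longrightarrow> bij (s B) \<and> {i. f (s B i) = a} = B" by metis
    define BB where "BB = {B. B \<subseteq> (UNIV :: 'n set) \<and> card B = k}"
    have "inj_on (\<lambda>B. f \<circ> s B) BB"
    proof (rule inj_onI)
      fix B B' assume "B \<in> BB" "B' \<in> BB" "f \<circ> s B = f \<circ> s B'"
      moreover have "B = {i. (f \<circ> s B) i = a}" "B' = {i. (f \<circ> s B') i = a}"
        using s[of B] s[of B'] \<open>B \<in> BB\<close> \<open>B' \<in> BB\<close> by (auto simp: BB_def)
      ultimately show "B = B'" by simp
    qed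
    then have "card ((\<lambda>B. f \<circ> s B) ` BB) = card BB" by (rule card_image)
    moreover have "card BB = CARD('n) choose k" unfolding BB_def by (rule n_subsets) simp
    moreover have "card ((\<lambda>B. f \<circ> s B) ` BB) \<le> CARD('n)"
    proof (rule few)
      show "(\<lambda>B. f \<circ> s B) ` BB \<subseteq> {f \<circ> s | s :: 'n \<Rightarrow> 'n. bij s}"
        using s by (auto simp: BB_def)
    qed (simp add: BB_def)
    ultimately have "CARD('n) choose k \<le> CARD('n)" by simp
    then have "\<not> (2 \<le> k \<and> k + 2 \<le> CARD('n))" using binomial_gt by fastforce
    then show ?thesis using k1 k2 unfolding S_def k_def by linarith
  qed
  have "\<exists>a\<in>range f. card {i. f i = a} = CARD('n) - 1"
  proof (rule ccontr)
    assume neg: "\<not> ?thesis"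
    have "inj f"
    proof (rule injI)
      fix x y assume "f x = f y"
      have "card {i. f i = f x} = 1" using level[of "f x"] neg by blast
      then obtain z where "{i. f i = f x} = {z}" by (auto simp: card_1_singleton_iff)
      then show "x = y" using \<open>f x = f y\<close> by (metis (mono_tags) mem_Collect_eq singletonD)
    qed
    define F where "F = (\<lambda>s. f \<circ> s) ` {s. s permutes (UNIV :: 'n set)}"
    have "card F = card {s. s permutes (UNIV :: 'n set)}"
      unfolding F_def using \<open>inj f\<close> by (intro card_image) (auto simp: inj_on_def fun_eq_iff)
    also have "\<dots> = fact CARD('n)" by (rule card_permutations) auto
    finally have F: "card F = fact CARD('n)" .
    have "finite F" unfolding F_def by (intro finite_imageI finite_permutations) simp
    moreover have "F \<subseteq> {f \<circ> s | s :: 'n \<Rightarrow> 'n. bij s}" unfolding F_def using permutes_bij by blast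
    ultimately have "fact CARD('n) \<le> CARD('n)" using few[of F] F by simp
    moreover have "CARD('n) < fact CARD('n)"
    proof -
      obtain m where m: "CARD('n) = Suc m" "2 \<le> m" using n by (cases "CARD('n)") auto
      have "m \<le> fact m" by (rule fact_ge_self)
      then have "Suc m * 2 \<le> Suc m * fact m" using m by (intro mult_le_mono) auto
      then show ?thesis using m(1) by simp
    qed
    ultimately show False by simp
  qed
  then obtain a where a: "a \<in> range f" "card {i. f i = a} = CARD('n) - 1" by blast
  then have "card (- {i. f i = a}) = 1"
    using n by (simp add: Compl_eq_Diff_UNIV card_Diff_subset)
  then obtain i0 where i0: "- {i. f i = a} = {i0}" by (auto simp: card_1_singleton_iff)
  then have "f i0 \<noteq> a" "\<And>i. i \<noteq> i0 \<Longrightarrow> f i = a" by blast+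
  then show ?thesis by (intro exI[of _ i0] exI[of _ "f i0"] exI[of _ a]) auto
qed

section \<open>Representations of dimension n of the Lie algebra of traceless matrices\<close>

lemma matrix_sum_vector: "(\<Sum>i\<in>I. A i) *v v = (\<Sum>i\<in>I. (A i :: 'a::comm_ring_1^_^_) *v v)"
  by (induction I rule: infinite_finite_induct) (auto simp: matrix_vector_mult_add_rdistrib)

definition comm :: "complex^'n^'n \<Rightarrow> complex^'n^'n \<Rightarrow> complex^'n^'n" where
  "comm A B = A ** B - B ** A"

lemma comm_add_left: "comm (A + B) C = comm A C + comm B C"
  and comm_add_right: "comm C (A + B) = comm C A + comm C B"
  and comm_minus_right: "comm C (- A) = - comm C A"
  and comm_scaleR_left: "comm (r *\<^sub>R A) C = r *\<^sub>R comm A C"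
  and comm_scaleR_right: "comm C (r *\<^sub>R A) = r *\<^sub>R comm C A"
  and comm_swap: "comm A B = - comm B A"
  by (simp_all add: comm_def matrix_distribs matrix_scaleR_left matrix_scaleR_right scaleR_diff_right)

lemma comm_zero [simp]: "comm A 0 = 0" "comm 0 A = 0" by (simp_all add: comm_def)

lemma comm_sum_left: "comm (\<Sum>i\<in>I. A i) C = (\<Sum>i\<in>I. comm (A i) C)"
  by (induction I rule: infinite_finite_induct) (auto simp: comm_add_left)

lemma comm_sum_right: "comm C (\<Sum>i\<in>I. A i) = (\<Sum>i\<in>I. comm C (A i))"
  by (induction I rule: infinite_finite_induct) (auto simp: comm_add_right)

lemma jacobi: "comm A (comm B C) = comm (comm A B) C + comm B (comm A C)"
  by (simp add: comm_def matrix_distribs matrix_mul_assoc)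

lemma jacobi': "comm (comm A B) C = comm A (comm B C) - comm B (comm A C)"
  by (simp add: jacobi[of A B C])

definition delta :: "'n \<Rightarrow> 'n \<Rightarrow> real" where "delta i j = (if i = j then 1 else 0)"

text \<open>
  The matrices \<open>N i j\<close> are the images of the matrix units off the diagonal; the
  relations between these units determine those with the diagonal part. The symmetry under index
  permutations comes from conjugation by signed permutation matrices, whence the signs
  \<open>d\<close>.
\<close>

locale sl_rep =
  fixes N :: "'n::finite \<Rightarrow> 'n \<Rightarrow> complex^'n^'n"
  assumes n3: "CARD('n) \<ge> 3"
    and chain: "\<And>i j k. i \<noteq> j \<Longrightarrow> j \<noteq> k \<Longrightarrow> i \<noteq> k \<Longrightarrow> comm (N i j) (N j k) = N i k"
    and commute: "\<And>i j k l. i \<noteq> j \<Longrightarrow> k \<noteq> l \<Longrightarrow> j \<noteq> k \<Longrightarrow> i \<noteq> l \<Longrightarrow> comm (N i j) (N k l) = 0"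
    and weyl: "\<And>s. bij s \<Longrightarrow> \<exists>W d. det W \<noteq> 0 \<and> (\<forall>i. d i = 1 \<or> d i = - 1) \<and>
      (\<forall>i j. i \<noteq> j \<longrightarrow> W ** N i j = (d i * d j :: real) *\<^sub>R (N (s i) (s j) ** W))"
    and nonzero: "\<And>i j. i \<noteq> j \<Longrightarrow> N i j \<noteq> 0"
begin

lemma chain': "i \<noteq> j \<Longrightarrow> j \<noteq> k \<Longrightarrow> i \<noteq> k \<Longrightarrow> comm (N j k) (N i j) = - N i k"
  using chain[of i j k] comm_swap by metis

lemma third_index: "\<exists>k::'n. k \<noteq> i \<and> k \<noteq> j"
  using ex_index_outside[of "{i, j}"] n3 card_insert_le_m1[of 2 "{j}" i] by auto

definition H where "H i j = (if i = j then 0 else comm (N i j) (N j i))"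

text \<open>
  When \<open>i\<close> and \<open>j\<close> do not both lie in \<open>{a, b}\<close> this follows
  from the relations by the Jacobi identity. Otherwise \<open>N i j\<close> is the commutator of
  \<open>N i k\<close> and \<open>N k j\<close> for a third index \<open>k\<close>, and weights add
  up.
\<close>

lemma weight_H:
  assumes "i \<noteq> j"
  shows "comm (H a b) (N i j) = (delta a i - delta a j - delta b i + delta b j) *\<^sub>R N i j"
proof (cases "a = b")
  case True
  then show ?thesis by (simp add: H_def)
next
  case False
  have easy: "comm (H a b) (N i j) = (delta a i - delta a j - delta b i + delta b j) *\<^sub>R N i j"
    if ij: "i \<noteq> j" and out: "i \<notin> {a, b} \<or> j \<notin> {a, b}" for i j
  proof -
    have H: "comm (H a b) (N i j) = comm (N a b) (comm (N b a) (N i j)) - comm (N b a) (comm (N a b) (N i j))"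
      using False by (simp add: H_def jacobi')
    consider "i \<notin> {a, b}" "j \<notin> {a, b}" | "i = a" "j \<notin> {a, b}" | "i = b" "j \<notin> {a, b}"
      | "j = a" "i \<notin> {a, b}" | "j = b" "i \<notin> {a, b}" using out by blast
    then show ?thesis
      unfolding H by cases (use False ij in \<open>auto simp: delta_def chain chain' commute comm_minus_right\<close>)
  qed
  show ?thesis
  proof (cases "i \<in> {a, b} \<and> j \<in> {a, b}")
    case True
    obtain k where k: "k \<noteq> i" "k \<noteq> j" using third_index by blast
    have "comm (H a b) (N i j) = comm (H a b) (comm (N i k) (N k j))"
      using k assms by (simp add: chain)
    also have "\<dots> = comm (comm (H a b) (N i k)) (N k j) + comm (N i k) (comm (H a b) (N k j))"
      by (rule jacobi)
    also have "\<dots> = ((delta a i - delta a k - delta b i + delta b k) + (delta a k - delta a j - delta b k + delta b j)) *\<^sub>R N i j"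
    proof -
      have "k \<notin> {a, b}" using k True assms by auto
      then have e: "comm (H a b) (N i k) = (delta a i - delta a k - delta b i + delta b k) *\<^sub>R N i k"
        "comm (H a b) (N k j) = (delta a k - delta a j - delta b k + delta b j) *\<^sub>R N k j"
        using easy[of i k] easy[of k j] k by auto
      have c: "comm (N i k) (N k j) = N i j" using chain k assms by metis
      show ?thesis
        unfolding e comm_scaleR_left comm_scaleR_right c by (simp only: scaleR_left_distrib)
    qed
    finally show ?thesis by simp
  next
    case False
    then show ?thesis using easy assms by blast
  qed
qed

text \<open>In the standard representation this is the diagonal matrix unit at \<open>a\<close> minus its trace part.\<close>

definition D where "D a = (1 / real CARD('n)) *\<^sub>R (\<Sum>b\<in>UNIV. H a b)"

lemma weight_D:
  assumes "i \<noteq> j"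
  shows "comm (D a) (N i j) = (delta a i - delta a j) *\<^sub>R N i j"
proof -
  have "(\<Sum>b\<in>UNIV. delta a i - delta a j - delta b i + delta b j) = real CARD('n) * (delta a i - delta a j)"
    by (simp add: sum.distrib sum_subtractf delta_def algebra_simps)
  then have "(\<Sum>b\<in>UNIV. comm (H a b) (N i j)) = (real CARD('n) * (delta a i - delta a j)) *\<^sub>R N i j"
    using assms by (simp add: weight_H scaleR_sum_left[symmetric])
  then show ?thesis
    by (simp add: D_def comm_scaleR_left comm_sum_left)
qed

lemma D_commute: "D a ** D b = D b ** D a"
proof -
  have "comm (D a) (H b c) = 0" for c
    by (cases "b = c") (simp_all add: H_def jacobi weight_D comm_scaleR_left comm_scaleR_right
        scaleR_left_distrib[symmetric])
  then have "comm (D a) (D b) = 0"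
    unfolding D_def[of b] by (simp add: comm_scaleR_right comm_sum_right)
  then show ?thesis by (simp add: comm_def)
qed

lemma sum_D: "(\<Sum>a\<in>UNIV. D a) = 0"
proof -
  have anti: "H a b = - H b a" for a b using comm_swap by (auto simp: H_def)
  have "(\<Sum>a\<in>UNIV. \<Sum>b\<in>UNIV. H a b) = (\<Sum>a\<in>UNIV. \<Sum>b\<in>UNIV. - H b a)"
    by (intro sum.cong refl anti)
  also have "\<dots> = - (\<Sum>a\<in>UNIV. \<Sum>b\<in>UNIV. H b a)"
    by (simp add: sum_negf)
  also have "(\<Sum>a\<in>UNIV. \<Sum>b\<in>UNIV. H b a) = (\<Sum>a\<in>UNIV. \<Sum>b\<in>UNIV. H a b)"
    by (rule sum.swap)
  finally have "(\<Sum>a\<in>UNIV. \<Sum>b\<in>UNIV. H a b) + (\<Sum>a\<in>UNIV. \<Sum>b\<in>UNIV. H a b) = 0"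
    by (metis add.right_inverse)
  then have "2 *\<^sub>R (\<Sum>a\<in>UNIV. \<Sum>b\<in>UNIV. H a b) = 0" by (simp only: scaleR_2)
  then have "(\<Sum>a\<in>UNIV. \<Sum>b\<in>UNIV. H a b) = 0" by (simp only: scaleR_eq_0_iff) simp
  then show ?thesis by (simp add: D_def scaleR_sum_right[symmetric])
qed

lemma weyl_D:
  assumes "bij s"
  shows "\<exists>W. det W \<noteq> 0 \<and> (\<forall>a. W ** D a = D (s a) ** W)"
proof -
  obtain W and d :: "'n \<Rightarrow> real" where Wd: "det W \<noteq> 0 \<and> (\<forall>i. d i = 1 \<or> d i = - 1) \<and>
      (\<forall>i j. i \<noteq> j \<longrightarrow> W ** N i j = (d i * d j) *\<^sub>R (N (s i) (s j) ** W))"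
    using weyl[OF assms] by (elim exE)
  then have W: "det W \<noteq> 0" and d: "\<And>i. d i = 1 \<or> d i = - 1"
    and WX: "\<And>i j. i \<noteq> j \<Longrightarrow> W ** N i j = (d i * d j) *\<^sub>R (N (s i) (s j) ** W)" by auto
  have inj: "s i \<noteq> s j" if "i \<noteq> j" for i j using assms that by (auto simp: bij_def inj_on_def)
  have prod: "W ** (N i j ** N j i) = (N (s i) (s j) ** N (s j) (s i)) ** W" if "i \<noteq> j" for i j
  proof -
    have dd: "(d i * d j) * (d j * d i) = 1" using d[of i] d[of j] by auto
    have "W ** (N i j ** N j i) = (d i * d j) *\<^sub>R (N (s i) (s j) ** (W ** N j i))"
      using WX[OF that] by (simp add: matrix_mul_assoc matrix_scaleR_left)
    also have "\<dots> = ((d i * d j) * (d j * d i)) *\<^sub>R (N (s i) (s j) ** N (s j) (s i) ** W)"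
      using WX[of j i] that by (simp add: matrix_mul_assoc matrix_scaleR_right)
    finally show ?thesis by (simp add: dd)
  qed
  have H: "W ** H i j = H (s i) (s j) ** W" for i j
    using prod[of i j] prod[of j i] inj[of i j]
    by (auto simp: H_def comm_def matrix_sub_ldistrib matrix_sub_rdistrib)
  have "W ** D a = D (s a) ** W" for a
  proof -
    have "(\<Sum>b\<in>UNIV. H (s a) (s b) ** W) = (\<Sum>b\<in>UNIV. H (s a) b ** W)"
      using assms by (rule sum.reindex_bij_betw)
    then show ?thesis
      by (simp add: D_def matrix_scaleR_left matrix_scaleR_right matrix_sum_left matrix_sum_right H)
  qed
  then show ?thesis using W by blast
qed

definition weight where "weight w \<longleftrightarrow> (\<exists>v. v \<noteq> 0 \<and> (\<forall>a. D a *v v = w a *s v))"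

lemma weight_perm:
  assumes "weight w" "bij s"
  shows "weight (w \<circ> s)"
proof -
  obtain v where v: "v \<noteq> 0" "\<And>a. D a *v v = w a *s v" using assms(1) by (auto simp: weight_def)
  have bs: "bij (inv_into UNIV s)" using assms(2) by (rule bij_imp_bij_inv)
  obtain W where W: "det W \<noteq> 0" "\<And>a. W ** D a = D (inv_into UNIV s a) ** W"
    using weyl_D[OF bs] by blast
  have "D a *v (W *v v) = w (s a) *s (W *v v)" for a
  proof -
    have "D a ** W = W ** D (s a)"
      using W(2)[of "s a"] assms(2) by (simp add: bij_is_inj)
    then have "D a *v (W *v v) = W *v (D (s a) *v v)"
      by (simp add: matrix_vector_mul_assoc)
    then show ?thesis by (simp add: v vec.linear_scale[OF matrix_vector_mul_linear_gen])
  qed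
  moreover have "W *v v \<noteq> 0"
  proof
    assume "W *v v = 0"
    then have "matrix_inv W *v (W *v v) = 0" by simp
    then show False using W(1) v(1) by (simp add: matrix_vector_mul_assoc inverse_matrix)
  qed
  ultimately show ?thesis unfolding weight_def comp_def by blast
qed

lemma weight_vectors_independent':
  assumes "inj_on w I" "\<And>k i. k \<in> I \<Longrightarrow> D i *v u k = w k i *s u k"
    "(\<Sum>k\<in>I. c k *s u k) = 0" "k \<in> I" "u k \<noteq> 0" "finite I"
  shows "c k = 0"
proof -
  have "c k *s u k = 0"
  proof (rule weight_vectors_independent[where M = D and w = w and I = I and u = "\<lambda>k. c k *s u k"])
    show "D i *v (c k *s u k) = w k i *s (c k *s u k)" if "k \<in> I" for k i
      using assms(2)[OF that, of i]
      by (simp only: vec.linear_scale[OF matrix_vector_mul_linear_gen] vector_smult_assoc mult.commute)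
  qed (use assms in auto)
  then show ?thesis using assms(5) by simp
qed

lemma few_weights:
  assumes "finite F" "\<And>w. w \<in> F \<Longrightarrow> weight w"
  shows "card F \<le> CARD('n)"
proof (rule ccontr)
  assume neg: "\<not> ?thesis"
  obtain u where u: "\<And>w. w \<in> F \<Longrightarrow> u w \<noteq> 0" "\<And>w a. w \<in> F \<Longrightarrow> D a *v u w = w a *s u w"
    using assms(2) unfolding weight_def by metis
  obtain c where c: "\<exists>w\<in>F. c w \<noteq> 0" "(\<Sum>w\<in>F. c w *s u w) = 0"
    using vec.family_dependent[of cart_basis F u] assms(1) neg
    by (auto simp: finite_cart_basis card_cart_basis)
  then obtain w where w: "w \<in> F" "c w \<noteq> 0" by blast
  have "c w = 0"
    by (rule weight_vectors_independent'[where w = "\<lambda>w. w", OF _ u(2) c(2) w(1) u(1)[OF w(1)] assms(1)])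
      simp_all
  then show False using w by simp
qed

text \<open>
  By its commutator with \<open>D i\<close>, the matrix \<open>N i j\<close> shifts eigenvalues of
  \<open>D i\<close> by one: if zero were the only eigenvalue, then \<open>D i + 1\<close> would be
  invertible and preserve the kernel of \<open>N i j\<close>, and an eigenvector of \<open>D
  i\<close> in the image of \<open>N i j\<close> would come from this kernel.
\<close>

lemma nonzero_eigenvalue: "\<exists>v c. v \<noteq> 0 \<and> c \<noteq> 0 \<and> D i *v v = c *s v"
proof (rule ccontr)
  assume neg: "\<not> ?thesis"
  obtain j where ij: "i \<noteq> j" using third_index[of i i] by metis
  have DX: "D i ** N i j = N i j ** D i + N i j"
    using weight_D[OF ij, of i] ij by (simp add: comm_def delta_def algebra_simps)
  have DXv: "D i *v (N i j *v v) = N i j *v (D i *v v) + N i j *v v" for v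
    using DX by (metis matrix_vector_mul_assoc matrix_vector_mult_add_rdistrib)
  have lin: "Vector_Spaces.linear (*s) (*s) ((*v) M)" for M :: "complex^'n^'n"
    by (rule matrix_vector_mul_linear_gen)
  obtain x where x: "N i j *v x \<noteq> 0"
    using nonzero[OF ij] by (metis matrix_eq matrix_vector_mult_0)
  \<comment> \<open>the image of \<open>N i j\<close> is invariant under \<open>D i\<close>\<close>
  have "\<exists>w c. w \<in> range ((*v) (N i j)) \<and> w \<noteq> 0 \<and> D i *v w = c *s w"
  proof (rule eigenvector_in_subspace)
    show "vec.subspace (range ((*v) (N i j)))"
      by (rule vec.linear_subspace_image[OF lin vec.subspace_UNIV])
    show "D i *v w \<in> range ((*v) (N i j))" if w: "w \<in> range ((*v) (N i j))" for w
    proof -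
      obtain v where "w = N i j *v v" using w by auto
      then have "D i *v w = N i j *v (D i *v v + v)"
        by (simp add: DXv matrix_vector_right_distrib)
      then show ?thesis by blast
    qed
  qed (use x in auto)
  then obtain v c where v: "N i j *v v \<noteq> 0" "D i *v (N i j *v v) = c *s (N i j *v v)" by auto
  then have "c = 0" using neg by blast
  then have ker: "N i j *v (D i *v v + v) = 0"
    using v(2) by (simp add: DXv matrix_vector_right_distrib)
  define Kr where "Kr = {v. N i j *v v = 0}"
  define T where "T v = D i *v v + v" for v
  have T: "T v = (D i + mat 1) *v v" for v by (simp add: T_def matrix_vector_mult_add_rdistrib)
  have sub: "vec.subspace Kr"
    unfolding Kr_def vec.subspace_def
    by (simp add: matrix_vector_right_distrib vec.linear_scale[OF lin])
  have injT: "x = y" if "T x = T y" for x y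
  proof -
    have "D i *v (x - y) = (- 1) *s (x - y)"
      using that by (simp add: T_def matrix_vector_mult_diff_distrib algebra_simps)
    then have "x - y = 0" using neg by (metis neg_equal_0_iff_equal zero_neq_one)
    then show ?thesis by simp
  qed
  have "N i j *v (D i *v v) = 0" if "N i j *v v = 0" for v
    using DXv[of v] that by simp
  then have "T ` Kr \<subseteq> Kr"
    unfolding Kr_def T_def by (auto simp: matrix_vector_right_distrib)
  moreover have "vec.dim (T ` Kr) = vec.dim Kr"
    unfolding T using injT by (intro vec.dim_image_eq lin) (auto simp: T[symmetric] inj_on_def)
  moreover have "vec.subspace (T ` Kr)"
    unfolding T by (rule vec.linear_subspace_image[OF lin sub])
  ultimately have "T ` Kr = Kr"
    using sub by (intro vec.subspace_dim_equal) auto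
  moreover have "T v \<in> Kr" using ker by (simp add: Kr_def T_def)
  ultimately obtain k where "k \<in> Kr" "T v = T k" by auto
  then have "v \<in> Kr" using injT by blast
  then show False using v(1) by (simp add: Kr_def)
qed

text \<open>
  The entries of a weight sum to zero, so a weight with a nonzero entry is not constant.
\<close>

lemma nonconstant_weight: "\<exists>w p q. weight w \<and> w p \<noteq> w q"
proof -
  fix i :: 'n
  obtain v0 c where v0: "v0 \<noteq> 0" "c \<noteq> 0" "D i *v v0 = c *s v0" using nonzero_eigenvalue by blast
  have lin: "Vector_Spaces.linear (*s) (*s) ((*v) M)" for M :: "complex^'n^'n"
    by (rule matrix_vector_mul_linear_gen)
  have "\<exists>v w. v \<in> {x. D i *v x = c *s x} \<and> v \<noteq> 0 \<and> (\<forall>a. D a *v v = w a *s v)"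
  proof (rule simultaneous_eigenvector)
    show "vec.subspace {x. D i *v x = c *s x}"
      unfolding vec.subspace_def
      by (auto simp: matrix_vector_right_distrib vector_add_ldistrib vec.linear_scale[OF lin]
          vector_smult_assoc mult.commute)
    show "D a *v x \<in> {x. D i *v x = c *s x}" if "x \<in> {x. D i *v x = c *s x}" for a x
    proof -
      have "D i *v (D a *v x) = D a *v (D i *v x)"
        by (simp add: matrix_vector_mul_assoc D_commute)
      then show ?thesis using that by (simp add: vec.linear_scale[OF lin])
    qed
    show "v0 \<in> {x. D i *v x = c *s x}" "v0 \<noteq> 0" using v0 by auto
  qed (rule D_commute)
  then obtain v w where v: "D i *v v = c *s v" "v \<noteq> 0" "\<And>a. D a *v v = w a *s v" by blast
  then have wt: "weight w" and wi: "w i = c"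
    using v(3)[of i] by (auto simp: weight_def vec.scale_right_imp_eq)
  have "\<exists>q. w i \<noteq> w q"
  proof (rule ccontr)
    assume "\<not> ?thesis"
    then have const: "w a = c" for a using wi by auto
    have "(\<Sum>a\<in>UNIV. D a) *v v = (\<Sum>a\<in>UNIV. D a *v v)"
      by (rule matrix_sum_vector)
    then have "(\<Sum>a\<in>(UNIV::'n set). c *s v) = 0" by (simp add: sum_D v(3) const)
    then have "(\<Sum>a\<in>(UNIV::'n set). c) *s v = 0" by (simp only: vec.scale_sum_left)
    then show False using v(2) v0(2) by (simp del: vector_smult_assoc)
  qed
  then show ?thesis using wt by blast
qed

text \<open>
  By \<open>few_rearrangements\<close> the weights are \<open>d + (c - d) e\<^sub>k\<close>, one for
  each index \<open>k\<close>, and the weight vectors form a basis. As \<open>N i j\<close> shifts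
  weights by \<open>e\<^sub>i - e\<^sub>j\<close>, necessarily \<open>c - d\<close> is
  \<open>1\<close> or \<open>- 1\<close>, and \<open>N i j\<close> is a multiple of a matrix unit in
  this basis. The relations allow the basis to be rescaled such that the multiples are one.
\<close>

proposition standard_or_dual:
  "\<exists>P. det P \<noteq> 0 \<and> ((\<forall>i j. i \<noteq> j \<longrightarrow> N i j ** P = P ** elem i j 1) \<or>
     (\<forall>i j. i \<noteq> j \<longrightarrow> N i j ** P = - (P ** elem j i 1)))"
proof -
  obtain w p q where w: "weight w" "w p \<noteq> w q" using nonconstant_weight by blast
  have "\<exists>i0 c d. c \<noteq> d \<and> w = (\<lambda>i. if i = i0 then c else d)"
  proof (rule few_rearrangements[OF n3 w(2)])
    fix F assume "finite F" "F \<subseteq> {w \<circ> s | s :: 'n \<Rightarrow> 'n. bij s}"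
    then show "card F \<le> CARD('n)" using few_weights weight_perm[OF w(1)] by blast
  qed
  then obtain i0 c d where cd: "c \<noteq> d" and wi: "w = (\<lambda>i. if i = i0 then c else d)" by blast
  define om where "om k a = (if a = k then c else d)" for k a :: 'n
  have "weight (om k)" for k
  proof -
    have "w \<circ> Transposition.transpose i0 k = om k"
      by (auto simp: wi om_def fun_eq_iff Transposition.transpose_def)
    then show ?thesis using weight_perm[OF w(1), of "Transposition.transpose i0 k"] by simp
  qed
  then obtain v where v: "\<And>k. v k \<noteq> 0" "\<And>k a. D a *v v k = om k a *s v k"
    unfolding weight_def by metis
  have inj_om: "inj om" using cd by (auto simp: inj_def om_def fun_eq_iff)
  define P where "P = (\<chi> a k. v k $ a)"
  have Pv: "P *v x = (\<Sum>k\<in>UNIV. x $ k *s v k)" for x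
    by (simp add: P_def vec_eq_iff matrix_vector_mult_def sum_component mult.commute)
  have "x = 0" if "P *v x = 0" for x
    using weight_vectors_independent'[of om UNIV v "\<lambda>k. x $ k"] inj_om v that
    by (auto simp: Pv vec_eq_iff)
  then have detP: "det P \<noteq> 0"
    using matrix_left_invertible_ker[of P] invertible_left_inverse[of P] invertible_det_nz[of P] by auto
  have DP: "D a ** P = P ** diagm (\<lambda>k. om k a)" for a
  proof -
    have "(D a ** P) $ b $ k = (D a *v v k) $ b" for b k
      by (simp add: P_def matrix_matrix_mult_def matrix_vector_mult_def)
    then show ?thesis by (simp add: vec_eq_iff mult_diagm_nth v(2)) (simp add: P_def mult.commute)
  qed
  define M where "M i j = matrix_inv P ** N i j ** P" for i j
  have PM: "P ** M i j = N i j ** P" for i j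
    by (simp add: M_def matrix_mul_assoc inverse_matrix[OF detP])
  have M_chain: "M i j ** M j k - M j k ** M i j = M i k" if "i \<noteq> j" "j \<noteq> k" "i \<noteq> k" for i j k
  proof -
    have "M i j ** M k l = matrix_inv P ** (N i j ** N k l) ** P" for i j k l
      unfolding M_def
      by (metis PM M_def matrix_mul_assoc)
    then show ?thesis using chain[OF that]
      by (simp add: comm_def M_def matrix_sub_ldistrib[symmetric] matrix_sub_rdistrib[symmetric])
  qed
  have M_nz: "M i j \<noteq> 0" if "i \<noteq> j" for i j
  proof
    assume "M i j = 0"
    then have "N i j ** P ** matrix_inv P = 0" using PM[of i j] by simp
    then show False using nonzero[OF that] by (simp add: matrix_mul_assoc[symmetric] inverse_matrix[OF detP])
  qed
  have entry: "(c - d) * (delta a l - delta a k) = delta a i - delta a j" if "i \<noteq> j" "M i j $ l $ k \<noteq> 0" for i j k l a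
  proof -
    let ?\<Delta> = "diagm (\<lambda>k. om k a)"
    have "P ** (?\<Delta> ** M i j - M i j ** ?\<Delta>) = P ** ((delta a i - delta a j) *\<^sub>R M i j)"
    proof -
      have "P ** (?\<Delta> ** M i j) = D a ** N i j ** P" by (metis DP PM matrix_mul_assoc)
      moreover have "P ** (M i j ** ?\<Delta>) = N i j ** D a ** P" by (metis DP PM matrix_mul_assoc)
      moreover have "D a ** N i j - N i j ** D a = (delta a i - delta a j) *\<^sub>R N i j"
        using weight_D[OF that(1), of a] by (simp add: comm_def)
      ultimately show ?thesis
        by (simp add: matrix_sub_ldistrib matrix_sub_rdistrib[symmetric] matrix_scaleR_left
            matrix_scaleR_right PM)
    qed
    then have "?\<Delta> ** M i j - M i j ** ?\<Delta> = (delta a i - delta a j) *\<^sub>R M i j"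
      using matrix_left_cancel(2)[OF inverse_matrix(1)[OF detP]] by metis
    then have "(?\<Delta> ** M i j - M i j ** ?\<Delta>) $ l $ k = ((delta a i - delta a j) *\<^sub>R M i j) $ l $ k" by simp
    then have "(om l a - om k a) * M i j $ l $ k = of_real (delta a i - delta a j) * M i j $ l $ k"
      by (simp add: diagm_mult_nth mult_diagm_nth algebra_simps) (simp add: scaleR_conv_of_real algebra_simps)
    then have "om l a - om k a = of_real (delta a i - delta a j)" using that(2) by simp
    then show ?thesis by (auto simp: om_def delta_def)
  qed
  have "c - d = 1 \<or> d - c = 1"
  proof -
    obtain i j :: 'n where ij: "i \<noteq> j" using third_index[of undefined undefined] by metis
    obtain l k where "M i j $ l $ k \<noteq> 0" using M_nz[OF ij] by (auto simp: vec_eq_iff)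
    then have "(c - d) * (delta i l - delta i k) = delta i i - delta i j" using entry[OF ij] by blast
    then show ?thesis using ij by (auto simp: delta_def split: if_splits)
  qed
  moreover have std: "\<exists>Q. det Q \<noteq> 0 \<and> (\<forall>i j Z. i \<noteq> j \<longrightarrow> Z ** P = P ** Y i j \<longrightarrow> Z ** Q = Q ** elem i j 1)"
    if Y_elem: "\<And>i j. i \<noteq> j \<Longrightarrow> Y i j = elem i j (m i j)"
      and Y_chain: "\<And>i j k. i \<noteq> j \<Longrightarrow> j \<noteq> k \<Longrightarrow> i \<noteq> k \<Longrightarrow> Y i j ** Y j k - Y j k ** Y i j = Y i k"
      and Y_nz: "\<And>i j. i \<noteq> j \<Longrightarrow> Y i j \<noteq> 0" for Y :: "'n \<Rightarrow> 'n \<Rightarrow> complex^'n^'n" and m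
  proof -
    have m_nz: "m i j \<noteq> 0" if "i \<noteq> j" for i j
      using Y_nz[OF that] Y_elem[OF that] by auto
    have m_chain: "m i j * m j k = m i k" if "i \<noteq> j" "j \<noteq> k" "i \<noteq> k" for i j k
    proof -
      have "elem i k (m i j * m j k) $ i $ k = elem i k (m i k) $ i $ k"
        using Y_chain[OF that] that by (simp add: Y_elem elem_mult_elem)
      then show ?thesis by (simp add: elem_nth)
    qed
    have m_inv: "m j k * m k j = 1" if "j \<noteq> k" for j k
    proof -
      obtain i where i: "i \<noteq> j" "i \<noteq> k" using third_index by blast
      have "m i j * (m j k * m k j) = m i j * 1"
        using m_chain[of i j k] m_chain[of i k j] i that by (simp add: mult.assoc[symmetric])
      then show ?thesis using m_nz[of i j] i by simp
    qed
    define b where "b i = (if i = i0 then 1 else m i i0)" for i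
    have mb: "m i j * b j = b i" if "i \<noteq> j" for i j
      using that m_chain[of i j i0] m_inv[of i j] by (auto simp: b_def)
    have "b i \<noteq> 0" for i using m_nz by (auto simp: b_def)
    then have "det (P ** diagm b) \<noteq> 0"
      using detP by (simp add: det_mul det_diagonal diagm_def)
    moreover have "Z ** (P ** diagm b) = (P ** diagm b) ** elem i j 1" if "i \<noteq> j" "Z ** P = P ** Y i j" for Z i j
    proof -
      have "Z ** (P ** diagm b) = P ** (elem i j (m i j) ** diagm b)"
        using that by (simp add: matrix_mul_assoc Y_elem)
      also have "\<dots> = P ** (diagm b ** elem i j 1)"
        using mb[OF that(1)] by (simp add: elem_mult_diagm diagm_mult_elem)
      finally show ?thesis by (simp add: matrix_mul_assoc)
    qed
    ultimately show ?thesis by blast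
  qed
  ultimately show ?thesis
  proof (elim disjE)
    assume cd1: "c - d = 1"
    have M_elem: "M i j = elem i j (M i j $ i $ j)" if "i \<noteq> j" for i j
    proof -
      have "l = i \<and> k = j" if "M i j $ l $ k \<noteq> 0" for l k
      proof -
        have "of_real (delta i l - delta i k) = (of_real (delta i i - delta i j) :: complex)"
          "of_real (delta j l - delta j k) = (of_real (delta j i - delta j j) :: complex)"
          using entry[OF \<open>i \<noteq> j\<close> that, of i] entry[OF \<open>i \<noteq> j\<close> that, of j] cd1 by simp_all
        then have "delta i l - delta i k = delta i i - delta i j" "delta j l - delta j k = delta j i - delta j j"
          by (simp_all only: of_real_eq_iff)
        then show ?thesis using \<open>i \<noteq> j\<close> by (auto simp: delta_def split: if_splits)
      qed
      then show ?thesis by (auto simp: vec_eq_iff elem_nth)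
    qed
    show ?thesis
      using std[of M "\<lambda>i j. M i j $ i $ j"] M_elem M_chain M_nz PM by metis
  next
    assume "d - c = 1"
    then have cd1: "c - d = - 1" by (metis minus_diff_eq)
    have M_elem: "- M j i = elem i j (- (M j i $ i $ j))" if "i \<noteq> j" for i j
    proof -
      have "l = i \<and> k = j" if "M j i $ l $ k \<noteq> 0" for l k
      proof -
        have ji: "j \<noteq> i" using \<open>i \<noteq> j\<close> by simp
        have "of_real (delta i k - delta i l) = (of_real (delta i j - delta i i) :: complex)"
          "of_real (delta j k - delta j l) = (of_real (delta j j - delta j i) :: complex)"
          using entry[OF ji that, of i] entry[OF ji that, of j] cd1 by simp_all
        then have "delta i k - delta i l = delta i j - delta i i" "delta j k - delta j l = delta j j - delta j i"
          by (simp_all only: of_real_eq_iff)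
        then show ?thesis using \<open>i \<noteq> j\<close> by (auto simp: delta_def split: if_splits)
      qed
      then show ?thesis by (auto simp: vec_eq_iff elem_nth)
    qed
    have "\<exists>Q. det Q \<noteq> 0 \<and> (\<forall>i j Z. i \<noteq> j \<longrightarrow> Z ** P = P ** (- M j i) \<longrightarrow> Z ** Q = Q ** elem i j 1)"
    proof (rule std[of "\<lambda>i j. - M j i" "\<lambda>i j. - (M j i $ i $ j)"])
      show "- M j i ** - M k j - - M k j ** - M j i = - M k i"
        if "i \<noteq> j" "j \<noteq> k" "i \<noteq> k" for i j k
        using M_chain[of k j i] that by (simp add: matrix_minus_left matrix_minus_right algebra_simps)
      show "- M j i \<noteq> 0" if "i \<noteq> j" for i j
        using M_nz[of j i] that by auto
    qed (rule M_elem)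
    then obtain Q where Q: "det Q \<noteq> 0"
      "\<And>i j Z. i \<noteq> j \<Longrightarrow> Z ** P = P ** (- M j i) \<Longrightarrow> Z ** Q = Q ** elem i j 1" by blast
    have "N i j ** Q = - (Q ** elem j i 1)" if "i \<noteq> j" for i j
    proof -
      have "(- N i j) ** P = P ** (- M i j)"
        by (simp add: matrix_minus_left matrix_minus_right PM)
      then have "(- N i j) ** Q = Q ** elem j i 1" using Q(2)[of j i] that by auto
      then show ?thesis by (metis matrix_minus_left add.inverse_inverse)
    qed
    then show ?thesis using Q(1) by blast
  qed
qed

end

section \<open>One-parameter groups of matrices\<close>

lemma norm_axis: "norm (axis i x :: 'a::real_normed_vector^'n) = norm x"
proof -
  have "(\<Sum>j\<in>UNIV. (norm (axis i x $ j :: 'a))\<^sup>2) = (\<Sum>j\<in>UNIV. if j = i then (norm x)\<^sup>2 else 0)"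
    by (rule sum.cong) (auto simp: axis_def)
  then show ?thesis by (simp add: norm_vec_def L2_set_def)
qed

lemma norm_elem [simp]: "norm (elem i j t) = norm (t :: 'a::real_normed_vector)"
proof -
  have "elem i j t = axis i (axis j t)" by (auto simp: vec_eq_iff elem_nth axis_def)
  then show ?thesis by (simp add: norm_axis)
qed

lemma norm_transv: "norm (transv i j t - mat 1) = \<bar>t\<bar>" for t :: real
  by (simp add: transv_def)

lemma near_one_det_complex: "\<exists>d>0. \<forall>A::complex^'n^'n. norm (A - mat 1) < d \<longrightarrow> det A \<noteq> 0"
proof -
  have "open {A::complex^'n^'n. det A \<noteq> 0}"
    by (intro open_Collect_neq continuous_intros)
  moreover have "mat 1 \<in> {A::complex^'n^'n. det A \<noteq> 0}" by simp
  ultimately obtain d where d: "d > 0" "ball (mat 1) d \<subseteq> {A::complex^'n^'n. det A \<noteq> 0}" by (rule openE)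
  have "A \<in> {A::complex^'n^'n. det A \<noteq> 0}" if "norm (A - mat 1) < d" for A
    using that d(2) by (intro subsetD[OF d(2)]) (simp add: dist_norm norm_minus_commute)
  then show ?thesis using d(1) by blast
qed

lemma bounded_linear_matrix_mult_right: "bounded_linear (\<lambda>A. B ** A :: 'a::{real_algebra_1,euclidean_space}^'n^'m)"
  by (rule bounded_bilinear.bounded_linear_right[OF bounded_bilinear_matrix_mult])

lemma bounded_linear_matrix_mult_left: "bounded_linear (\<lambda>A. A ** B :: 'a::{real_algebra_1,euclidean_space}^'n^'m)"
  by (rule bounded_bilinear.bounded_linear_left[OF bounded_bilinear_matrix_mult])

text \<open>
  Let \<open>M\<close> be the integral of \<open>f\<close> over a short interval \<open>[0,
  h]\<close>; it is close to \<open>h\<close> times the identity and thus invertible. As \<open>f(s)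
  M\<close> is the integral of \<open>f\<close> over \<open>[s, s + h]\<close>, it is differentiable
  in \<open>s\<close>.
\<close>

lemma one_parameter_differentiable:
  fixes f :: "real \<Rightarrow> complex^'n^'n"
  assumes r: "r > 0" and cont: "continuous_on {-r<..<r} f" and f0: "f 0 = mat 1"
    and add: "\<And>a b. \<bar>a\<bar> < r \<Longrightarrow> \<bar>b\<bar> < r \<Longrightarrow> \<bar>a + b\<bar> < r \<Longrightarrow> f (a + b) = f a ** f b"
  shows "\<exists>N d. d > 0 \<and> (\<forall>t. \<bar>t\<bar> < d \<longrightarrow> (f has_vector_derivative f t ** N) (at t))"
proof -
  obtain d0 where d0: "d0 > 0" "\<And>A::complex^'n^'n. norm (A - mat 1) < d0 \<Longrightarrow> det A \<noteq> 0"
    using near_one_det_complex by blast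
  have "isCont f 0"
    using cont r by (simp add: continuous_on_eq_continuous_at)
  then obtain d1 where d1: "d1 > 0" "\<And>t. \<bar>t\<bar> < d1 \<Longrightarrow> dist (f t) (f 0) < d0 / 2"
    using d0(1) unfolding continuous_at_eps_delta by (metis diff_zero dist_real_def half_gt_zero)
  define h where "h = min (d1 / 2) (r / 4)"
  have h: "h > 0" "h < d1" "h \<le> r / 4" using d1(1) r by (auto simp: h_def)
  define M where "M = integral {0..h} f"
  have contI: "continuous_on {a..b} f" if "-r < a" "b < r" for a b
    using that by (intro continuous_on_subset[OF cont]) auto
  have "det M \<noteq> 0"
  proof -
    have "norm (integral {0..h} (\<lambda>t. f t - mat 1)) \<le> (d0 / 2) * (h - 0)"
    proof (rule integral_bound)
      show "norm (f t - mat 1) \<le> d0 / 2" if "t \<in> {0..h}" for t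
        using d1(2)[of t] that h f0 by (auto simp: dist_norm intro: less_imp_le)
    qed (use h r in \<open>auto intro!: continuous_intros contI\<close>)
    moreover have "integral {0..h} (\<lambda>t. f t - mat 1) = M - h *\<^sub>R mat 1"
      unfolding M_def using h r by (subst integral_diff) (auto intro!: integrable_continuous_real contI)
    ultimately have "norm (M - h *\<^sub>R mat 1) \<le> d0 / 2 * h" by simp
    then have "norm ((1 / h) *\<^sub>R (M - h *\<^sub>R mat 1)) \<le> d0 / 2"
      unfolding norm_scaleR using h by (simp add: field_simps)
    also have "(1 / h) *\<^sub>R (M - h *\<^sub>R mat 1) = (1 / h) *\<^sub>R M - mat 1"
      using h by (simp add: scaleR_diff_right)
    finally have "det ((1 / h) *\<^sub>R M) \<noteq> 0" using d0 by (intro d0(2)) simp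
    then have "det ((1 / h) *\<^sub>R M ** (matrix_inv ((1 / h) *\<^sub>R M))) \<noteq> 0"
      by (simp add: inverse_matrix)
    then have "M ** ((1 / h) *\<^sub>R matrix_inv ((1 / h) *\<^sub>R M)) = mat 1"
      using \<open>det ((1 / h) *\<^sub>R M) \<noteq> 0\<close> inverse_matrix(1)[of "(1 / h) *\<^sub>R M"]
      by (simp add: matrix_scaleR_left matrix_scaleR_right)
    then show ?thesis by (rule det_right_inverse)
  qed
  then have MM: "M ** matrix_inv M = mat 1" by (rule inverse_matrix)
  define g where "g u = integral {- (r / 2)..u} f" for u
  have g: "(g has_vector_derivative f u) (at u)" if "\<bar>u\<bar> < r / 2" for u
  proof -
    have "(g has_vector_derivative f u) (at u within {- (r / 2)..r / 2})"
      unfolding g_def using that r by (intro integral_has_vector_derivative contI) auto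
    moreover have "at u within {- (r / 2)..r / 2} = at u"
      using that by (intro at_within_Icc_at) auto
    ultimately show ?thesis by simp
  qed
  have f_eq: "f s = (g (h + s) - g s) ** matrix_inv M" if s: "\<bar>s\<bar> < h" for s
  proof -
    have "f s ** M = integral {0..h} ((\<lambda>A. f s ** A) \<circ> f)"
      unfolding M_def using h r
      by (intro integral_linear[symmetric] bounded_linear_matrix_mult_right integrable_continuous_real contI) auto
    also have "\<dots> = integral {0..h} (f \<circ> (+) s)"
      using s h r by (intro integral_cong) (auto simp: add)
    also have "\<dots> = integral {s..h + s} f"
      by (simp add: integral_shift_Icc_real)
    also have "\<dots> = g (h + s) - g s"
      unfolding g_def using s h r
      by (subst Henstock_Kurzweil_Integration.integral_combine[symmetric, of "- (r / 2)" s "h + s"])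
        (auto intro!: integrable_continuous_real contI)
    finally have "f s ** M ** matrix_inv M = (g (h + s) - g s) ** matrix_inv M" by simp
    then show ?thesis by (simp add: matrix_mul_assoc[symmetric] MM)
  qed
  define N where "N = (f h - mat 1) ** matrix_inv M"
  have "(f has_vector_derivative f t ** N) (at t)" if t: "\<bar>t\<bar> < h" for t
  proof (rule has_vector_derivative_transform_within_open[where S = "{-h<..<h}"])
    have 1: "((\<lambda>s. g (h + s)) has_vector_derivative f (h + t)) (at t)"
    proof -
      have "((\<lambda>s. h + s) has_vector_derivative 1) (at t)" by (auto intro!: derivative_eq_intros)
      then have "(g \<circ> (\<lambda>s. h + s) has_vector_derivative 1 *\<^sub>R f (h + t)) (at t)"
        using t h by (intro vector_diff_chain_at g) auto
      then show ?thesis by (simp add: o_def)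
    qed
    have "((\<lambda>s. (g (h + s) - g s) ** matrix_inv M) has_vector_derivative (f (h + t) - f t) ** matrix_inv M) (at t)"
      using t h
      by (intro bounded_linear.has_vector_derivative[OF bounded_linear_matrix_mult_left]
          has_vector_derivative_diff 1 g) auto
    moreover have "(f (h + t) - f t) ** matrix_inv M = f t ** N"
    proof -
      have "f (t + h) = f t ** f h" using t h by (intro add) auto
      then show ?thesis by (simp add: N_def matrix_distribs matrix_mul_assoc add.commute)
    qed
    ultimately show "((\<lambda>s. (g (h + s) - g s) ** matrix_inv M) has_vector_derivative f t ** N) (at t)" by simp
  qed (use t f_eq in auto)
  then show ?thesis using h(1) by blast
qed

lemma derivative_unique_local:
  assumes "(f has_vector_derivative a) (at (0::real))" "(g has_vector_derivative b) (at 0)"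
    "d > 0" "\<And>t. \<bar>t\<bar> < d \<Longrightarrow> f t = g t"
  shows "a = b"
proof -
  have "(g has_vector_derivative a) (at 0)"
    using assms by (intro has_vector_derivative_transform_within_open[OF assms(1), of "{-d<..<d}"]) auto
  then show ?thesis using assms(2) vector_derivative_unique_at by blast
qed

text \<open>
  The permutation matrix has determinant \<open>1\<close> or \<open>- 1\<close>, and scaling one of
  its columns by this sign makes the determinant one.
\<close>

lemma signed_permutation:
  fixes s :: "'n::finite \<Rightarrow> 'n"
  assumes s: "bij s"
  shows "\<exists>(w :: real^'n^'n) d. det w = 1 \<and> (\<forall>i. d i = 1 \<or> d i = - 1) \<and>
    (\<forall>i j t. i \<noteq> j \<longrightarrow> w ** transv i j t = transv (s i) (s j) (d i * d j * t) ** w)"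
proof -
  define p :: "real^'n^'n" where "p = (\<chi> a b. if a = s b then 1 else 0)"
  have inj: "s a = s b \<longleftrightarrow> a = b" for a b using s by (auto simp: bij_def inj_def)
  have "transpose p ** p = mat 1"
    by (simp add: vec_eq_iff p_def transpose_def matrix_matrix_mult_def mat_def inj
        if_distrib[of "\<lambda>x. x * _"] cong: if_cong)
  then have "det p * det p = 1" by (metis det_I det_mul det_transpose)
  then have "det p = 1 \<or> det p = - 1" by (simp add: square_eq_1_iff)
  fix i0 :: 'n
  define d where "d i = (if i = i0 then det p else 1)" for i
  have d: "d i = 1 \<or> d i = - 1" for i using \<open>det p = 1 \<or> det p = - 1\<close> by (auto simp: d_def)
  have dd: "d i * d i = 1" for i using d[of i] by auto
  define w where "w = p ** diagm d"
  have "prod d UNIV = det p" by (simp add: d_def)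
  then have "det w = 1" using \<open>det p * det p = 1\<close> by (simp add: w_def det_mul det_diagm)
  moreover have "w ** transv i j t = transv (s i) (s j) (d i * d j * t) ** w" for i j t
  proof -
    have "(w ** elem i j t) $ a $ b = (if a = s i \<and> b = j then d i * t else 0)" for a b
    proof -
      have "(\<Sum>k\<in>UNIV. p $ a $ k * elem i j (d i * t) $ k $ b) =
          (\<Sum>k\<in>UNIV. if k = i then (if a = s i \<and> b = j then d i * t else 0) else 0)"
        by (rule sum.cong) (auto simp: p_def elem_nth)
      then have "(p ** elem i j (d i * t)) $ a $ b = (if a = s i \<and> b = j then d i * t else 0)"
        by (simp add: matrix_matrix_mult_def)
      then show ?thesis
        by (simp add: w_def matrix_mul_assoc[symmetric] diagm_mult_elem)
    qed
    moreover have "(elem (s i) (s j) (d i * d j * t) ** w) $ a $ b = (if a = s i \<and> b = j then d i * t else 0)" for a b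
    proof -
      have "(elem (s i) (s j) (d i * d j * t) ** p) $ a $ b = (if a = s i \<and> b = j then d i * d j * t else 0)"
        by (cases "a = s i") (simp_all add: p_def matrix_matrix_mult_def elem_nth inj
            if_distrib[of "\<lambda>x. x * _"] if_distrib[of "\<lambda>x. _ * x"] eq_commute cong: if_cong)
      then show ?thesis
        using dd[of j] by (simp add: w_def matrix_mul_assoc mult_diagm_nth)
    qed
    ultimately have "w ** elem i j t = elem (s i) (s j) (d i * d j * t) ** w"
      by (simp add: vec_eq_iff)
    then show ?thesis by (simp add: transv_def matrix_distribs)
  qed
  ultimately show ?thesis using d by blast
qed

section \<open>Local homomorphisms of the special linear group\<close>

text \<open>
  A continuous homomorphism near one. The matrices \<open>W\<close> in \<open>conj\<close> come from
  the elements of a covering group, on which \<open>\<rho>\<close> extends to a global homomorphism.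
\<close>

locale local_rep =
  fixes \<rho> :: "real^'n^'n \<Rightarrow> complex^'n^'n" and e :: real
  assumes n3: "CARD('n) \<ge> 3" and e: "e > 0"
    and cont: "continuous_on {x. det x = 1 \<and> norm (x - mat 1) < e} \<rho>"
    and one: "\<rho> (mat 1) = mat 1"
    and hom: "\<exists>d>0. \<forall>x y. det x = 1 \<longrightarrow> det y = 1 \<longrightarrow> norm (x - mat 1) < d \<longrightarrow> norm (y - mat 1) < d \<longrightarrow>
      \<rho> (x ** y) = \<rho> x ** \<rho> y"
    and kernel: "finite {x. det x = 1 \<and> norm (x - mat 1) < e \<and> \<rho> x = mat 1}"
    and conj: "\<And>w. det w = 1 \<Longrightarrow> \<exists>W. det W \<noteq> 0 \<and> (\<exists>d>0. \<forall>x. det x = 1 \<longrightarrow> norm (x - mat 1) < d \<longrightarrow>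
      \<rho> (w ** x ** matrix_inv w) ** W = W ** \<rho> x)"
begin

definition f where "f i j t = \<rho> (transv i j t)"

lemma f_0: "f i j 0 = mat 1" by (simp add: f_def one)

lemma multiplicative: "\<exists>d>0. d \<le> 1 \<and> d \<le> e \<and>
   (\<forall>x y. det x = 1 \<longrightarrow> det y = 1 \<longrightarrow> norm (x - mat 1) < d \<longrightarrow> norm (y - mat 1) < d \<longrightarrow>
      \<rho> (x ** y) = \<rho> x ** \<rho> y) \<and>
   (\<forall>x y z. det x = 1 \<longrightarrow> det y = 1 \<longrightarrow> det z = 1 \<longrightarrow> norm (x - mat 1) < d \<longrightarrow>
      norm (y - mat 1) < d \<longrightarrow> norm (z - mat 1) < d \<longrightarrow> \<rho> (x ** (y ** z)) = \<rho> x ** (\<rho> y ** \<rho> z))"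
proof -
  obtain d where d: "d > 0" "\<And>x y. det x = 1 \<Longrightarrow> det y = 1 \<Longrightarrow> norm (x - mat 1) < d \<Longrightarrow> norm (y - mat 1) < d \<Longrightarrow>
      \<rho> (x ** y) = \<rho> x ** \<rho> y"
    using hom by blast
  obtain d' where d': "d' > 0" "\<And>x y::real^'n^'n. norm (x - mat 1) < d' \<Longrightarrow> norm (y - mat 1) < d' \<Longrightarrow>
      norm (x ** y - mat 1) < d"
    using near_one_mult[OF d(1)] by blast
  let ?d = "min (min d d') (min 1 e)"
  have "\<rho> (x ** (y ** z)) = \<rho> x ** (\<rho> y ** \<rho> z)"
    if "det x = 1" "det y = 1" "det z = 1" "norm (x - mat 1) < ?d" "norm (y - mat 1) < ?d" "norm (z - mat 1) < ?d"
    for x y z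
  proof -
    have "\<rho> (x ** (y ** z)) = \<rho> x ** \<rho> (y ** z)"
      using that d'(2)[of y z] by (intro d(2)) (auto simp: det_mul)
    also have "\<rho> (y ** z) = \<rho> y ** \<rho> z" using that by (intro d(2)) auto
    finally show ?thesis .
  qed
  moreover have "\<rho> (x ** y) = \<rho> x ** \<rho> y"
    if "det x = 1" "det y = 1" "norm (x - mat 1) < ?d" "norm (y - mat 1) < ?d" for x y
    using that by (intro d(2)) auto
  moreover have "?d > 0" "?d \<le> 1" "?d \<le> e" using d d' e by auto
  ultimately show ?thesis by blast
qed

text \<open>
  A radius within which \<open>\<rho>\<close> is multiplicative on products of two and of three
  elements.
\<close>

definition r where "r = (SOME d. d > 0 \<and> d \<le> 1 \<and> d \<le> e \<and>
   (\<forall>x y. det x = 1 \<longrightarrow> det y = 1 \<longrightarrow> norm (x - mat 1) < d \<longrightarrow> norm (y - mat 1) < d \<longrightarrow>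
      \<rho> (x ** y) = \<rho> x ** \<rho> y) \<and>
   (\<forall>x y z. det x = 1 \<longrightarrow> det y = 1 \<longrightarrow> det z = 1 \<longrightarrow> norm (x - mat 1) < d \<longrightarrow>
      norm (y - mat 1) < d \<longrightarrow> norm (z - mat 1) < d \<longrightarrow> \<rho> (x ** (y ** z)) = \<rho> x ** (\<rho> y ** \<rho> z)))"

lemma r: "r > 0" "r \<le> 1" "r \<le> e"
  and r2: "det x = 1 \<Longrightarrow> det y = 1 \<Longrightarrow> norm (x - mat 1) < r \<Longrightarrow> norm (y - mat 1) < r \<Longrightarrow>
      \<rho> (x ** y) = \<rho> x ** \<rho> y"
  and r3: "det x = 1 \<Longrightarrow> det y = 1 \<Longrightarrow> det z = 1 \<Longrightarrow> norm (x - mat 1) < r \<Longrightarrow>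
      norm (y - mat 1) < r \<Longrightarrow> norm (z - mat 1) < r \<Longrightarrow> \<rho> (x ** (y ** z)) = \<rho> x ** (\<rho> y ** \<rho> z)"
  using someI_ex[OF multiplicative, folded r_def] by blast+

lemma f_mult:
  assumes "i \<noteq> j" "k \<noteq> l" "\<bar>s\<bar> < r" "\<bar>t\<bar> < r"
  shows "\<rho> (transv i j s ** transv k l t) = f i j s ** f k l t"
  unfolding f_def using assms by (intro r2) (auto simp: det_transv norm_transv)

lemma f_add: "i \<noteq> j \<Longrightarrow> \<bar>s\<bar> < r \<Longrightarrow> \<bar>t\<bar> < r \<Longrightarrow> f i j (s + t) = f i j s ** f i j t"
  using f_mult[of i j i j s t] by (simp add: transv_add f_def[of i j "s + t"])

lemma f_differentiable:
  assumes "i \<noteq> j"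
  shows "\<exists>N d. d > 0 \<and> (\<forall>t. \<bar>t\<bar> < d \<longrightarrow> (f i j has_vector_derivative f i j t ** N) (at t))"
proof (rule one_parameter_differentiable[of r])
  have "continuous_on {- r<..<r} (\<rho> \<circ> transv i j)"
  proof (rule continuous_on_compose)
    have "continuous_on {- r<..<r} (\<lambda>t. mat 1 + t *\<^sub>R elem i j 1 :: real^'n^'n)"
      by (intro continuous_intros)
    then show "continuous_on {- r<..<r} (transv i j :: real \<Rightarrow> real^'n^'n)"
      by (simp add: transv_def[abs_def] scaleR_elem)
    show "continuous_on (transv i j ` {- r<..<r}) \<rho>"
      by (rule continuous_on_subset[OF cont]) (use r assms in \<open>auto simp: det_transv norm_transv\<close>)
  qed
  then show "continuous_on {- r<..<r} (f i j)" by (simp add: f_def[abs_def] o_def)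
qed (use r assms f_add f_0 in auto)

definition N where
  "N i j = (SOME N. \<exists>d>0. \<forall>t. \<bar>t\<bar> < d \<longrightarrow> (f i j has_vector_derivative f i j t ** N) (at t))"

lemma f_deriv_near:
  "i \<noteq> j \<Longrightarrow> \<exists>d>0. \<forall>t. \<bar>t\<bar> < d \<longrightarrow> (f i j has_vector_derivative f i j t ** N i j) (at t)"
  unfolding N_def by (rule someI_ex) (use f_differentiable in blast)

lemma f_deriv: "i \<noteq> j \<Longrightarrow> (f i j has_vector_derivative N i j) (at 0)"
proof -
  assume "i \<noteq> j"
  then obtain d where "d > 0" "\<And>t. \<bar>t\<bar> < d \<Longrightarrow> (f i j has_vector_derivative f i j t ** N i j) (at t)"
    using f_deriv_near by blast
  from this(2)[of 0] this(1) show ?thesis by (simp add: f_0)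
qed

lemma f_deriv_scale:
  assumes "i \<noteq> j"
  shows "((\<lambda>t. f i j (s * t)) has_vector_derivative s *\<^sub>R N i j) (at 0)"
proof -
  have "((\<lambda>t. s * t) has_vector_derivative s) (at 0)" by (auto intro!: derivative_eq_intros)
  then have "(f i j \<circ> (\<lambda>t. s * t) has_vector_derivative s *\<^sub>R N i j) (at 0)"
    using f_deriv[OF assms] by (intro vector_diff_chain_at) auto
  then show ?thesis by (simp add: o_def)
qed

lemmas mult_left_deriv = bounded_linear.has_vector_derivative[OF bounded_linear_matrix_mult_left]
lemmas mult_right_deriv = bounded_linear.has_vector_derivative[OF bounded_linear_matrix_mult_right]

lemma commute_relation:
  assumes "i \<noteq> j" "k \<noteq> l" "j \<noteq> k" "i \<noteq> l"
  shows "N i j ** N k l = N k l ** N i j"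
proof -
  have T: "transv i j s ** transv k l t = transv k l t ** (transv i j s :: real^'n^'n)" for s t
    using assms by (simp add: transv_def matrix_distribs elem_mult_elem)
  have F: "f i j s ** f k l t = f k l t ** f i j s" if "\<bar>s\<bar> < r" "\<bar>t\<bar> < r" for s t
    using f_mult[of i j k l s t] f_mult[of k l i j t s] that assms T[of s t] by simp
  have "f i j s ** N k l = N k l ** f i j s" if "\<bar>s\<bar> < r" for s
    by (rule derivative_unique_local[OF mult_right_deriv[OF f_deriv] mult_left_deriv[OF f_deriv] r(1)])
      (use F that assms in auto)
  then show ?thesis
    by (intro derivative_unique_local[OF mult_left_deriv[OF f_deriv] mult_right_deriv[OF f_deriv] r(1)])
      (use assms in auto)
qed

text \<open>
  For transvections this is \<open>x\<^sub>i\<^sub>j(s) x\<^sub>j\<^sub>k(t) = x\<^sub>i\<^sub>k(s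
  t) x\<^sub>j\<^sub>k(t) x\<^sub>i\<^sub>j(s)\<close>, differentiated with respect to
  \<open>t\<close> and then to \<open>s\<close>.
\<close>

lemma chain_relation:
  assumes "i \<noteq> j" "j \<noteq> k" "i \<noteq> k"
  shows "N i j ** N j k = N i k + N j k ** N i j"
proof -
  have T: "transv i j s ** transv j k t = transv i k (s * t) ** (transv j k t ** transv i j s :: real^'n^'n)" for s t
    using assms by (simp add: transv_def matrix_distribs elem_mult_elem)
  have F: "f i j s ** f j k t = f i k (s * t) ** f j k t ** f i j s" if st: "\<bar>s\<bar> < r" "\<bar>t\<bar> < r" for s t
  proof -
    have "\<bar>s * t\<bar> \<le> 1 * \<bar>t\<bar>" unfolding abs_mult using st r by (intro mult_right_mono) auto
    then have "\<rho> (transv i k (s * t) ** (transv j k t ** transv i j s)) = f i k (s * t) ** (f j k t ** f i j s)"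
      unfolding f_def using assms st by (intro r3) (auto simp: det_transv norm_transv)
    then show ?thesis
      using f_mult[of i j j k s t] st assms T[of s t] by (simp add: matrix_mul_assoc)
  qed
  have "f i j s ** N j k = (s *\<^sub>R N i k + N j k) ** f i j s" if s: "\<bar>s\<bar> < r" for s
  proof (rule derivative_unique_local[OF mult_right_deriv[OF f_deriv] mult_left_deriv r(1)])
    have "((\<lambda>t. f i k (s * t) ** f j k t) has_vector_derivative f i k (s * 0) ** N j k + (s *\<^sub>R N i k) ** f j k 0) (at 0)"
      using assms by (intro bounded_bilinear.has_vector_derivative[OF bounded_bilinear_matrix_mult] f_deriv f_deriv_scale) auto
    then show "((\<lambda>t. f i k (s * t) ** f j k t) has_vector_derivative s *\<^sub>R N i k + N j k) (at 0)"
      by (simp add: f_0 add.commute)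
  qed (use F s assms in auto)
  then show ?thesis
  proof (intro derivative_unique_local[OF mult_left_deriv[OF f_deriv] _ r(1)])
    have "((\<lambda>s. s *\<^sub>R N i k + N j k) has_vector_derivative N i k) (at 0)"
      by (auto intro!: derivative_eq_intros)
    then have "((\<lambda>s. (s *\<^sub>R N i k + N j k) ** f i j s) has_vector_derivative
        (0 *\<^sub>R N i k + N j k) ** N i j + N i k ** f i j 0) (at 0)"
      using assms by (intro bounded_bilinear.has_vector_derivative[OF bounded_bilinear_matrix_mult] f_deriv) auto
    then show "((\<lambda>s. (s *\<^sub>R N i k + N j k) ** f i j s) has_vector_derivative N i k + N j k ** N i j) (at 0)"
      by (simp add: f_0 add.commute)
  qed (use assms in auto)
qed

lemma weyl_relation:
  assumes "bij s"
  shows "\<exists>W d. det W \<noteq> 0 \<and> (\<forall>i. d i = 1 \<or> d i = - 1) \<and>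
    (\<forall>i j. i \<noteq> j \<longrightarrow> W ** N i j = (d i * d j :: real) *\<^sub>R (N (s i) (s j) ** W))"
proof -
  obtain w :: "real^'n^'n" and d where w: "det w = 1" and d: "\<And>i. d i = 1 \<or> d i = - 1"
    and wt: "\<And>i j t. i \<noteq> j \<Longrightarrow> w ** transv i j t = transv (s i) (s j) (d i * d j * t) ** w"
    using signed_permutation[OF assms] by metis
  obtain W c where W: "det W \<noteq> 0" "c > 0"
    "\<And>x. det x = 1 \<Longrightarrow> norm (x - mat 1) < c \<Longrightarrow> \<rho> (w ** x ** matrix_inv w) ** W = W ** \<rho> x"
    using conj[OF w] by blast
  have "W ** N i j = (d i * d j) *\<^sub>R (N (s i) (s j) ** W)" if ij: "i \<noteq> j" for i j
  proof -
    have sij: "s i \<noteq> s j" using assms ij by (auto simp: bij_def inj_def)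
    have w0: "det w \<noteq> 0" using w by simp
    have F: "W ** f i j t = f (s i) (s j) (d i * d j * t) ** W" if "\<bar>t\<bar> < c" for t
    proof -
      have "w ** transv i j t ** matrix_inv w = transv (s i) (s j) (d i * d j * t)"
        unfolding wt[OF ij] using w0 by (simp add: matrix_mul_assoc[symmetric] inverse_matrix)
      then show ?thesis
        using W(3)[of "transv i j t"] that ij by (simp add: f_def det_transv norm_transv)
    qed
    have "W ** N i j = ((d i * d j) *\<^sub>R N (s i) (s j)) ** W"
      by (rule derivative_unique_local[OF mult_right_deriv[OF f_deriv[OF ij]]
          mult_left_deriv[OF f_deriv_scale[OF sij]] W(2) F])
    then show ?thesis by (simp add: matrix_scaleR_left)
  qed
  then show ?thesis using W(1) d by blast
qed

text \<open>
  Otherwise \<open>\<rho>\<close> would be constant on a segment of transvections, contrary to the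
  finiteness of its kernel.
\<close>

lemma N_nonzero:
  assumes ij: "i \<noteq> j"
  shows "N i j \<noteq> 0"
proof
  assume N0: "N i j = 0"
  obtain d where d: "d > 0" "\<And>t. \<bar>t\<bar> < d \<Longrightarrow> (f i j has_vector_derivative f i j t ** N i j) (at t)"
    using f_deriv_near[OF ij] by blast
  define d' where "d' = min d e"
  have d': "d' > 0" using d e by (simp add: d'_def)
  have "(f i j has_vector_derivative 0) (at t within {- d'<..<d'})" if "t \<in> {- d'<..<d'}" for t
    using d(2)[of t] that N0 by (auto simp: d'_def intro: has_vector_derivative_at_within)
  then obtain c where "\<And>t. t \<in> {- d'<..<d'} \<Longrightarrow> f i j t = c"
    using has_vector_derivative_zero_constant[of "{- d'<..<d'}" "f i j"] by auto
  then have "f i j t = f i j 0" if "\<bar>t\<bar> < d'" for t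
    using that d' by (auto simp: abs_less_iff)
  moreover have "\<bar>t\<bar> < d' \<and> \<bar>t\<bar> < e" if "t \<in> {- d'<..<d'}" for t
    using that by (auto simp: d'_def abs_less_iff)
  ultimately have "transv i j ` {- d'<..<d'} \<subseteq> {x. det x = 1 \<and> norm (x - mat 1) < e \<and> \<rho> x = mat 1}"
    using ij f_0 by (intro image_subsetI) (auto simp: det_transv norm_transv f_def[symmetric] simp del: greaterThanLessThan_iff)
  then have "finite (transv i j ` {- d'<..<d'} :: (real^'n^'n) set)"
    using kernel finite_subset by blast
  moreover have "inj (transv i j :: real \<Rightarrow> real^'n^'n)"
  proof (rule injI)
    fix s t :: real assume "transv i j s = (transv i j t :: real^'n^'n)"
    then have "elem i j s $ i $ j = elem i j t $ i $ j" by (simp add: transv_def)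
    then show "s = t" by (simp add: elem_nth)
  qed
  ultimately have "finite {- d'<..<d'}"
    by (metis finite_imageD inj_on_subset subset_UNIV)
  then show False using d' by (simp add: infinite_Ioo)
qed

sublocale sl_rep N
proof
  show "comm (N i j) (N j k) = N i k" if "i \<noteq> j" "j \<noteq> k" "i \<noteq> k" for i j k
    using chain_relation[OF that] by (simp add: comm_def)
  show "comm (N i j) (N k l) = 0" if "i \<noteq> j" "k \<noteq> l" "j \<noteq> k" "i \<noteq> l" for i j k l
    using commute_relation[OF that] by (simp add: comm_def)
qed (use n3 weyl_relation N_nonzero in auto)

text \<open>
  The derivative of \<open>f i j t ** (mat 1 - t N)\<close> vanishes.
\<close>

lemma f_linear:
  assumes ij: "i \<noteq> j" and N2: "N i j ** N i j = 0"
  shows "\<exists>d>0. \<forall>t. \<bar>t\<bar> < d \<longrightarrow> f i j t = mat 1 + t *\<^sub>R N i j"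
proof -
  obtain d where d: "d > 0" "\<And>t. \<bar>t\<bar> < d \<Longrightarrow> (f i j has_vector_derivative f i j t ** N i j) (at t)"
    using f_deriv_near[OF ij] by blast
  define g where "g t = f i j t ** (mat 1 - t *\<^sub>R N i j)" for t
  have "(g has_vector_derivative 0) (at t)" if "\<bar>t\<bar> < d" for t
  proof -
    have "((\<lambda>t. mat 1 - t *\<^sub>R N i j) has_vector_derivative - N i j) (at t)"
      by (auto intro!: derivative_eq_intros)
    then have "(g has_vector_derivative f i j t ** (- N i j) + (f i j t ** N i j) ** (mat 1 - t *\<^sub>R N i j)) (at t)"
      unfolding g_def
      by (intro bounded_bilinear.has_vector_derivative[OF bounded_bilinear_matrix_mult] d that)
    then show ?thesis
      by (simp add: matrix_distribs matrix_scaleR_right matrix_mul_assoc[symmetric] N2)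
  qed
  then have "(g has_vector_derivative 0) (at t within {- d<..<d})" if "t \<in> {- d<..<d}" for t
    using that by (auto intro: has_vector_derivative_at_within)
  then obtain c where "\<And>t. t \<in> {- d<..<d} \<Longrightarrow> g t = c"
    using has_vector_derivative_zero_constant[of "{- d<..<d}" g] by auto
  then have "g t = g 0" if "\<bar>t\<bar> < d" for t
    using that d(1) by (auto simp: abs_less_iff)
  then have g1: "g t = mat 1" if "\<bar>t\<bar> < d" for t
    using that by (simp add: g_def f_0)
  have "f i j t = mat 1 + t *\<^sub>R N i j" if "\<bar>t\<bar> < d" for t
  proof -
    have "(mat 1 - t *\<^sub>R N i j) ** (mat 1 + t *\<^sub>R N i j) = mat 1"
      by (simp add: matrix_distribs matrix_scaleR_left matrix_scaleR_right N2)
    then have "f i j t = g t ** (mat 1 + t *\<^sub>R N i j)"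
      unfolding g_def by (metis matrix_mul_assoc matrix_mul_rid)
    then show ?thesis using g1[OF that] by simp
  qed
  then show ?thesis using d(1) by blast
qed

proposition local_form:
  "\<exists>P. det P \<noteq> 0 \<and>
    ((\<forall>i j. i \<noteq> j \<longrightarrow> (\<exists>d>0. \<forall>t. \<bar>t\<bar> < d \<longrightarrow> \<rho> (transv i j t) = conj_embed P (transv i j t))) \<or>
     (\<forall>i j. i \<noteq> j \<longrightarrow> (\<exists>d>0. \<forall>t. \<bar>t\<bar> < d \<longrightarrow> \<rho> (transv i j t) = conj_embed P (transv j i (- t)))))"
proof -
  obtain P where "det P \<noteq> 0 \<and> ((\<forall>i j. i \<noteq> j \<longrightarrow> N i j ** P = P ** elem i j 1) \<or>
     (\<forall>i j. i \<noteq> j \<longrightarrow> N i j ** P = - (P ** elem j i 1)))"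
    using standard_or_dual by (elim exE)
  then have P: "det P \<noteq> 0" and cases: "(\<forall>i j. i \<noteq> j \<longrightarrow> N i j ** P = P ** elem i j 1) \<or>
     (\<forall>i j. i \<noteq> j \<longrightarrow> N i j ** P = - (P ** elem j i 1))"
    by (elim conjunct1, elim conjunct2)
  have main: "\<exists>d>0. \<forall>t. \<bar>t\<bar> < d \<longrightarrow> \<rho> (transv i j t) = P ** (mat 1 + t *\<^sub>R Z) ** matrix_inv P"
    if ij: "i \<noteq> j" and Z: "N i j ** P = P ** Z" "Z ** Z = 0" for i j Z
  proof -
    have NZ: "N i j = P ** Z ** matrix_inv P"
      using Z(1) P by (metis inverse_matrix(1) matrix_mul_assoc matrix_mul_rid)
    have "N i j ** N i j = P ** (Z ** (matrix_inv P ** P) ** Z) ** matrix_inv P"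
      unfolding NZ by (simp only: matrix_mul_assoc)
    then have "N i j ** N i j = 0" using Z(2) P by (simp add: inverse_matrix)
    then obtain d where "d > 0" "\<And>t. \<bar>t\<bar> < d \<Longrightarrow> f i j t = mat 1 + t *\<^sub>R N i j"
      using f_linear[OF ij] by blast
    moreover have "mat 1 + t *\<^sub>R N i j = P ** (mat 1 + t *\<^sub>R Z) ** matrix_inv P" for t
      using P by (simp add: NZ matrix_distribs matrix_scaleR_left matrix_scaleR_right inverse_matrix)
    ultimately show ?thesis by (auto simp: f_def)
  qed
  have cmt: "cmat (transv i j t) = mat 1 + t *\<^sub>R elem i j 1" for i j t
    unfolding cmat_transv by (simp add: transv_def scaleR_elem of_real_def)
  from cases show ?thesis
  proof
    assume std: "\<forall>i j. i \<noteq> j \<longrightarrow> N i j ** P = P ** elem i j 1"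
    have "\<exists>d>0. \<forall>t. \<bar>t\<bar> < d \<longrightarrow> \<rho> (transv i j t) = conj_embed P (transv i j t)" if "i \<noteq> j" for i j
      using main[OF that, of "elem i j 1"] std that by (simp add: conj_embed_def cmt elem_mult_elem)
    then show ?thesis using P by blast
  next
    assume dual: "\<forall>i j. i \<noteq> j \<longrightarrow> N i j ** P = - (P ** elem j i 1)"
    have "\<exists>d>0. \<forall>t. \<bar>t\<bar> < d \<longrightarrow> \<rho> (transv i j t) = conj_embed P (transv j i (- t))" if "i \<noteq> j" for i j
      using main[OF that, of "- elem j i 1"] dual that
      by (simp add: conj_embed_def cmt elem_mult_elem matrix_minus_left matrix_minus_right)
    then show ?thesis using P by blast
  qed
qed

end

section \<open>Imaginary quadratic fields\<close>

interpretation rat_vec: vector_space "\<lambda>(q::rat) (v::'a::real_vector). of_rat q *\<^sub>R v"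
  by unfold_locales (simp_all add: scaleR_add_right of_rat_add scaleR_add_left of_rat_mult)

lemma of_rat_scaleR: "of_rat q *\<^sub>R (z :: complex) = of_rat q * z"
  by (cases q) (simp add: scaleR_conv_of_real of_rat_rat)

lemma imaginary_quadraticD:
  assumes "imaginary_quadratic F"
  shows "0 \<in> F" "1 \<in> F" "\<And>x y. x \<in> F \<Longrightarrow> y \<in> F \<Longrightarrow> x + y \<in> F" "\<And>x y. x \<in> F \<Longrightarrow> y \<in> F \<Longrightarrow> x * y \<in> F"
    "\<And>q. of_rat q \<in> F"
    "\<exists>u v. \<forall>x\<in>F. \<exists>a b. x = of_rat a * u + of_rat b * v"
proof -
  interpret R: ring "ring_of_type_algebra :: complex ring" by (rule ring_from_type_algebra)
  have sf: "subfield F ring_of_type_algebra" and dim: "R.dimension 2 \<rat> F"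
    using assms by (auto simp: imaginary_quadratic_def)
  note sr = subringE[OF subfieldE(1)[OF sf]]
  show z: "0 \<in> F" using sr(2) by (simp add: ring_of_type_algebra_def)
  show one: "1 \<in> F" using sr(3) by (simp add: ring_of_type_algebra_def)
  show add: "x + y \<in> F" if "x \<in> F" "y \<in> F" for x y
    using sr(7)[OF that] by (simp add: ring_of_type_algebra_def)
  show "x * y \<in> F" if "x \<in> F" "y \<in> F" for x y
    using sr(6)[OF that] by (simp add: ring_of_type_algebra_def)
  have "2 = Suc (Suc 0)" by simp
  with dim have dim2: "R.dimension (Suc (Suc 0)) \<rat> F" by simp
  have mem: "x \<in> R.line_extension K a E \<longleftrightarrow> (\<exists>k\<in>K. \<exists>v\<in>E. x = k * a + v)" for x K a E
    using R.line_extension_mem_iff[of x K a E] by (simp add: ring_of_type_algebra_def)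
  obtain u E where u: "F = R.line_extension \<rat> u E" "R.dimension (Suc 0) \<rat> E"
    using dim2 by (cases rule: R.dimension.cases) auto
  obtain v E' where v: "E = R.line_extension \<rat> v E'" "R.dimension 0 \<rat> E'"
    using u(2) by (cases rule: R.dimension.cases) auto
  have E': "E' = {0}"
    using v(2) by (cases rule: R.dimension.cases) (auto simp: ring_of_type_algebra_def)
  have E: "y \<in> E \<longleftrightarrow> (\<exists>b. y = of_rat b * v)" for y
    unfolding v(1) E' mem by (auto elim!: Rats_cases)
  have F: "x \<in> F \<longleftrightarrow> (\<exists>a b. x = of_rat a * u + of_rat b * v)" for x
    unfolding u(1) mem Bex_def E by (auto elim!: Rats_cases) (metis Rats_of_rat)
  then show "\<exists>u v. \<forall>x\<in>F. \<exists>a b. x = of_rat a * u + of_rat b * v" by blast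
  show "of_rat q \<in> F" for q
  proof -
    obtain a b where "1 = of_rat a * u + of_rat b * v" using one F by blast
    then have "of_rat q = of_rat q * (of_rat a * u + of_rat b * v)" by simp
    also have "\<dots> = of_rat (q * a) * u + of_rat (q * b) * v"
      by (simp add: of_rat_mult algebra_simps)
    finally show ?thesis using F by blast
  qed
qed

lemma rat_common_denominator:
  fixes c :: "'i \<Rightarrow> rat"
  assumes "finite I"
  shows "\<exists>D>0. \<forall>i\<in>I. \<exists>m. of_int D * c i = of_int (m::int)"
  using assms
proof (induction I rule: finite_induct)
  case empty
  then show ?case by (intro exI[of _ 1]) auto
next
  case (insert j I)
  then obtain D where D: "D > 0" "\<And>i. i \<in> I \<Longrightarrow> \<exists>m. of_int D * c i = of_int (m::int)" by auto
  obtain a b where ab: "c j = of_int a / of_int b" "b > 0"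
    by (metis quotient_of_div quotient_of_denom_pos surj_pair)
  have "\<exists>m. of_int (D * b) * c i = of_int (m::int)" if i: "i \<in> insert j I" for i
  proof (cases "i = j")
    case True
    have "of_int (D * b) * c j = of_int (D * a)" using ab by simp
    then show ?thesis using True by blast
  next
    case False
    then obtain m where "of_int D * c i = of_int (m::int)" using D(2) i by blast
    then have "of_int (D * b) * c i = of_int (b * m)" by (simp add: mult.assoc mult.left_commute)
    then show ?thesis by blast
  qed
  then show ?case using D(1) ab(2) by (intro exI[of _ "D * b"]) auto
qed

definition quad_int :: "complex \<Rightarrow> bool" where
  "quad_int z \<longleftrightarrow> (\<exists>a b::int. z * z = of_int a * z + of_int b)"

lemma quad_int_algebraic_int:
  assumes "quad_int z"
  shows "algebraic_int z"
proof -
  obtain a b :: int where z: "z * z = of_int a * z + of_int b" using assms by (auto simp: quad_int_def)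
  let ?p = "[:- of_int b, - of_int a, 1:] :: complex poly"
  show ?thesis
  proof (rule algebraic_int.intros[of ?p])
    show "Polynomial.lead_coeff ?p = 1" by simp
    show "\<forall>i. poly.coeff ?p i \<in> \<int>"
      by (auto simp: coeff_pCons split: nat.splits)
    show "poly ?p z = 0" using z by (simp add: algebra_simps)
  qed
qed

lemma quad_int_of_int_mult:
  assumes "quad_int z" shows "quad_int (of_int c * z)"
proof -
  obtain a b :: int where z: "z * z = of_int a * z + of_int b" using assms by (auto simp: quad_int_def)
  have "(of_int c * z) * (of_int c * z) = of_int c * of_int c * (z * z)" by simp
  also have "\<dots> = of_int (c * a) * (of_int c * z) + of_int (c * c * b)"
    unfolding z by (simp add: algebra_simps)
  finally show ?thesis unfolding quad_int_def by blast
qed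

lemma quad_int_add_1:
  assumes "quad_int z" shows "quad_int (1 + z)"
proof -
  obtain a b :: int where z: "z * z = of_int a * z + of_int b" using assms by (auto simp: quad_int_def)
  have "(1 + z) * (1 + z) = 1 + 2 * z + z * z" by (simp add: algebra_simps)
  also have "\<dots> = of_int (a + 2) * (1 + z) + of_int (b - 1 - a)"
    unfolding z by (simp add: algebra_simps)
  finally show ?thesis unfolding quad_int_def by blast
qed

text \<open>
  The elements \<open>1\<close>, \<open>z\<close> and \<open>z\<^sup>2\<close> are linearly
  dependent over the rationals. Clearing denominators and multiplying by the leading coefficient
  gives a monic equation for a multiple of \<open>z\<close>. Using only integers that satisfy a
  monic quadratic equation avoids sums of algebraic integers.
\<close>

lemma integral_multiple:
  assumes F: "imaginary_quadratic F" and z: "z \<in> F"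
  shows "\<exists>D. D \<noteq> 0 \<and> quad_int (of_int D * z)"
proof -
  obtain u v where uv: "\<And>x. x \<in> F \<Longrightarrow> \<exists>a b. x = of_rat a * u + of_rat b * v"
    using imaginary_quadraticD(6)[OF F] by blast
  have "\<exists>c. (\<exists>i\<in>{..2::nat}. c i \<noteq> 0) \<and> (\<Sum>i\<in>{..2}. of_rat (c i) *\<^sub>R z ^ i) = 0"
  proof (rule rat_vec.family_dependent[of "{u, v}"])
    have "x \<in> rat_vec.span {u, v}" if "x \<in> F" for x
    proof -
      obtain a b where "x = of_rat a * u + of_rat b * v" using uv[OF \<open>x \<in> F\<close>] by blast
      then have "x = of_rat a *\<^sub>R u + of_rat b *\<^sub>R v" by (simp add: of_rat_scaleR)
      then show ?thesis
        by (simp add: rat_vec.span_add rat_vec.span_scale rat_vec.span_base)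
    qed
    moreover have "z ^ i \<in> F" for i
      by (induction i) (auto intro: imaginary_quadraticD[OF F] z)
    ultimately show "(\<lambda>i. z ^ i) ` {..2} \<subseteq> rat_vec.span {u, v}" by blast
    show "card {u, v} < card {..2::nat}" using card_insert_le_m1[of 2 "{v}" u] by simp
  qed auto
  then obtain c where c: "\<exists>i\<in>{..2::nat}. c i \<noteq> 0" "(\<Sum>i\<le>2. of_rat (c i) *\<^sub>R z ^ i) = 0" by blast
  obtain D m where D: "D > 0" "\<And>i. i \<le> 2 \<Longrightarrow> of_int D * c i = of_int (m i :: int)"
    using rat_common_denominator[of "{..2::nat}" c] by (metis atMost_iff finite_atMost)
  have Dc: "of_int D * (of_rat (c i) :: complex) = of_int (m i)" if "i \<le> 2" for i
    using D(2)[OF that] by (metis of_rat_mult of_rat_of_int_eq)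
  have "of_int D * (\<Sum>i\<le>2. of_rat (c i) * z ^ i) = 0"
    using c(2) by (simp add: of_rat_scaleR)
  moreover have "(\<Sum>i\<le>2::nat. g i) = g 0 + g 1 + g 2" for g :: "nat \<Rightarrow> complex"
    by (simp add: numeral_2_eq_2)
  ultimately have "of_int D * of_rat (c 0) + of_int D * of_rat (c 1) * z + of_int D * of_rat (c 2) * z\<^sup>2 = 0"
    by (simp add: algebra_simps)
  then have rel: "of_int (m 0) + of_int (m 1) * z + of_int (m 2) * (z * z) = 0"
    by (simp add: Dc power2_eq_square)
  have nz: "m 0 \<noteq> 0 \<or> m 1 \<noteq> 0 \<or> m 2 \<noteq> 0"
  proof -
    obtain i where "i \<le> 2" "c i \<noteq> 0" using c(1) by auto
    then have "m i \<noteq> 0" using D(2)[of i] D(1) by auto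
    moreover have "i = 0 \<or> i = 1 \<or> i = 2" using \<open>i \<le> 2\<close> by auto
    ultimately show ?thesis by auto
  qed
  show ?thesis
  proof (cases "m 2 = 0")
    case False
    have "(of_int (m 2) * z) * (of_int (m 2) * z) = of_int (m 2) * (of_int (m 2) * (z * z))" by simp
    also have "of_int (m 2) * (z * z) = - of_int (m 0) - of_int (m 1) * z"
      using rel by (simp add: algebra_simps add_eq_0_iff)
    finally have "(of_int (m 2) * z) * (of_int (m 2) * z) =
        of_int (- m 1) * (of_int (m 2) * z) + of_int (- (m 0 * m 2))"
      by (simp add: algebra_simps)
    then show ?thesis using False unfolding quad_int_def by blast
  next
    case True
    then have r: "of_int (m 1) * z = of_int (- m 0)" using rel by (simp add: eq_neg_iff_add_eq_0 add.commute)
    then have "m 1 \<noteq> 0" using nz True by auto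
    moreover have "(of_int (m 1) * z) * (of_int (m 1) * z) = of_int (- m 0) * (of_int (m 1) * z) + of_int 0"
      using r by simp
    ultimately show ?thesis unfolding quad_int_def by blast
  qed
qed

text \<open>
  Such matrices lie in a rational vector space spanned by \<open>2 n \<bar>J\<bar>\<close> elements,
  as \<open>F\<close> is spanned by two.
\<close>

lemma rational_relation:
  fixes f :: "'i \<Rightarrow> complex^'n^'n"
  assumes F: "imaginary_quadratic F" and I: "finite I" "2 * CARD('n) * card J < card I"
    and f: "\<And>i a b. i \<in> I \<Longrightarrow> f i $ a $ b \<in> F" "\<And>i a b. i \<in> I \<Longrightarrow> b \<notin> J \<Longrightarrow> f i $ a $ b = 0"
  shows "\<exists>c. (\<exists>i\<in>I. c i \<noteq> 0) \<and> (\<Sum>i\<in>I. of_rat (c i) *\<^sub>R f i) = 0"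
proof -
  obtain u v where uv: "\<And>x. x \<in> F \<Longrightarrow> \<exists>a b. x = of_rat a * u + of_rat b * v"
    using imaginary_quadraticD(6)[OF F] by blast
  define T where "T = (\<lambda>(a, b, w). elem a b w) ` ((UNIV :: 'n set) \<times> J \<times> {u, v})"
  have finT: "finite T" by (simp add: T_def)
  have "card T \<le> card ((UNIV :: 'n set) \<times> J \<times> {u, v})" unfolding T_def by (rule card_image_le) simp
  also have "\<dots> = CARD('n) * (card J * card {u, v})" by (simp only: card_cartesian_product)
  also have "\<dots> \<le> CARD('n) * (card J * 2)"
    using card_insert_le_m1[of 2 "{v}" u] by (intro mult_left_mono) auto
  finally have cardT: "card T < card I" using I(2) by (simp add: mult_ac)
  have entry: "elem a b x \<in> rat_vec.span T" if "x \<in> F" "b \<in> J" for a b x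
  proof -
    obtain p q where "x = of_rat p * u + of_rat q * v" using uv[OF \<open>x \<in> F\<close>] by blast
    then have "elem a b x = of_rat p *\<^sub>R elem a b u + of_rat q *\<^sub>R elem a b v"
      by (simp add: scaleR_elem elem_add[symmetric] of_rat_scaleR)
    moreover have "elem a b w \<in> T" if "w \<in> {u, v}" for w
      unfolding T_def using that \<open>b \<in> J\<close> by (intro image_eqI[of _ _ "(a, b, w)"]) auto
    then have "elem a b u \<in> T" "elem a b v \<in> T" by auto
    ultimately show ?thesis
      by (simp add: rat_vec.span_add rat_vec.span_scale rat_vec.span_base)
  qed
  have "f ` I \<subseteq> rat_vec.span T"
  proof (rule image_subsetI)
    fix i assume i: "i \<in> I"
    have "elem a b (f i $ a $ b) \<in> rat_vec.span T" for a b
      using entry[of "f i $ a $ b" b a] f[OF i] rat_vec.span_zero by (cases "b \<in> J") auto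
    then show "f i \<in> rat_vec.span T"
      by (subst sum_elem[of "f i"]) (intro rat_vec.span_sum)
  qed
  then show ?thesis by (rule rat_vec.family_dependent[OF finT I(1) _ cardT])
qed


section \<open>Unipotent elements of uniform lattices\<close>

text \<open>
  Let \<open>Q\<close> be a projection onto the kernel of \<open>N\<close>, obtained from a
  generalised inverse \<open>M\<close> of \<open>N\<close>. As \<open>Q N = N\<close> and \<open>N Q
  = 0\<close>, conjugation by \<open>1 - Q + t Q\<close> multiplies \<open>N\<close> by
  \<open>t\<close>. The determinant of this matrix is positive, being the square of the one for
  \<open>sqrt t\<close>, and scaling makes it one.
\<close>

lemma contract_square_zero:
  fixes N :: "real^'n^'n"
  assumes N: "N ** N = 0" and t: "t > 0"
  shows "\<exists>g. det g = 1 \<and> g ** N ** matrix_inv g = t *\<^sub>R N"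
proof -
  obtain m where m: "linear m" "\<And>v. N *v (m (N *v v)) = N *v v"
    using linear_exists_right_inverse_on[OF matrix_vector_mul_linear[of N] subspace_UNIV] by auto
  define M where "M = matrix m"
  have "N ** M ** N = N"
    using m by (simp add: matrix_eq M_def matrix_vector_mul_assoc[symmetric] matrix_works)
  define Q where "Q = mat 1 - M ** N"
  have NQ: "N ** Q = 0" and QN: "Q ** N = N" and QQ: "Q ** Q = Q"
    using N \<open>N ** M ** N = N\<close>
    by (simp_all add: Q_def matrix_distribs matrix_mul_assoc[symmetric])
  define g where "g s = (mat 1 - Q) + s *\<^sub>R Q" for s :: real
  have gg: "g s ** g s' = g (s * s')" for s s'
    by (simp add: g_def matrix_distribs matrix_scaleR_left matrix_scaleR_right QQ)
  have "g 1 = mat 1" by (simp add: g_def)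
  then have ginv: "g t ** g (1 / t) = mat 1" using t by (simp add: gg)
  have "det (g t) = (det (g (sqrt t)))\<^sup>2"
    using t by (simp add: power2_eq_square det_mul[symmetric] gg)
  moreover have "det (g t) \<noteq> 0" using ginv by (rule det_right_inverse)
  ultimately have pos: "det (g t) > 0" by (metis zero_less_power2 power_zero_numeral)
  define c where "c = root CARD('n) (det (g t))"
  have c: "c > 0" "c ^ CARD('n) = det (g t)" using pos by (simp_all add: c_def)
  define h where "h = (1 / c) *\<^sub>R g t"
  have "det h = 1" using c pos by (simp add: h_def det_scaleR power_divide)
  moreover have "matrix_inv h = c *\<^sub>R g (1 / t)"
    using c ginv by (intro matrix_inv_unique) (simp add: h_def matrix_scaleR_left matrix_scaleR_right)
  moreover have "g t ** N = t *\<^sub>R N" by (simp add: g_def matrix_distribs matrix_scaleR_left QN)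
  moreover have "N ** g s = N" for s by (simp add: g_def matrix_distribs matrix_scaleR_right NQ)
  ultimately show ?thesis
    using c by (intro exI[of _ h]) (simp add: h_def matrix_scaleR_left matrix_scaleR_right)
qed

text \<open>
  The determinant of \<open>1 + t N\<close> is the same for all \<open>t > 0\<close> by conjugation;
  let \<open>t\<close> tend to zero.
\<close>

lemma det_square_zero:
  fixes N :: "real^'n^'n"
  assumes N: "N ** N = 0"
  shows "det (mat 1 + N) = 1"
proof -
  have "det (mat 1 + t *\<^sub>R N) = det (mat 1 + N)" if t: "t > 0" for t
  proof -
    obtain g where g: "det g = 1" "g ** N ** matrix_inv g = t *\<^sub>R N"
      using contract_square_zero[OF N t] by blast
    then have "mat 1 + t *\<^sub>R N = g ** (mat 1 + N) ** matrix_inv g"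
      by (simp add: matrix_distribs inverse_matrix)
    then show ?thesis using g(1) by (simp add: det_mul det_matrix_inv)
  qed
  then have "(\<lambda>k. det (mat 1 + (1 / real (Suc k)) *\<^sub>R N)) = (\<lambda>k. det (mat 1 + N))"
    by (intro ext) auto
  moreover have "(\<lambda>k. det (mat 1 + (1 / real (Suc k)) *\<^sub>R N)) \<longlonglongrightarrow> det (mat 1 + 0 *\<^sub>R N)"
  proof (rule continuous_on_tendsto_compose[where s = UNIV and f = det])
    have s: "(\<lambda>k. 1 / real (Suc k)) \<longlonglongrightarrow> 0" using LIMSEQ_inverse_real_of_nat by (simp add: inverse_eq_divide)
    show "(\<lambda>k. mat 1 + (1 / real (Suc k)) *\<^sub>R N) \<longlonglongrightarrow> mat 1 + 0 *\<^sub>R N"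
      by (intro tendsto_intros s)
  qed (auto intro!: continuous_intros)
  ultimately have "(\<lambda>k::nat. det (mat 1 + N)) \<longlonglongrightarrow> 1" by simp
  then show ?thesis by (simp add: LIMSEQ_const_iff)
qed

context uniform_lattice begin

text \<open>
  Choose \<open>g\<close> that contracts \<open>N\<close> strongly and \<open>x\<close> in
  \<open>L\<close> with \<open>g x\<close> in a fixed bounded set. Then \<open>x\<inverse> (1 + N)
  x\<close> lies in \<open>L\<close> and is the conjugate by the bounded element \<open>g x\<close>
  of a matrix close to one.
\<close>

proposition no_unipotent:
  assumes N: "N ** N = 0" and L: "mat 1 + N \<in> L"
  shows "N = 0"
proof -
  obtain K where K: "K > 0" "\<And>(A :: real^'n^'n) B :: real^'n^'n. norm (A ** B) \<le> norm A * norm B * K"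
    by (rule exE[OF matrix_mult_bound[where 'n = 'n]]) blast
  obtain B where B: "B > 0" "\<And>A::real^'n^'n. det A = 1 \<Longrightarrow> norm A \<le> R \<Longrightarrow> norm (matrix_inv A) \<le> B"
    using bounded_inverse_SL by metis
  define C where "C = B * norm N * K * R * K + 1"
  have C: "C > 0" using B K R_nonneg by (simp add: C_def add_nonneg_pos)
  define t where "t = e / C"
  have t: "t > 0" using C discrete(1) by (simp add: t_def)
  obtain g where g: "det g = 1" "g ** N ** matrix_inv g = t *\<^sub>R N"
    using contract_square_zero[OF N t] by blast
  obtain x where x: "x \<in> L" "norm (g ** x) \<le> R" using cocompact[OF g(1)] by blast
  define c where "c = g ** x"
  have dx: "det x = 1" using det x(1) by blast
  have dc: "det c = 1" using g dx by (simp add: c_def det_mul)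
  have cinv: "matrix_inv c = matrix_inv x ** matrix_inv g"
    unfolding c_def using g dx by (intro matrix_inv_mult) auto
  have conj: "matrix_inv x ** (mat 1 + N) ** x = mat 1 + t *\<^sub>R (matrix_inv c ** N ** c)"
  proof -
    have "g ** N = t *\<^sub>R (N ** g)"
    proof -
      have "g ** N ** (matrix_inv g ** g) = (t *\<^sub>R N) ** g"
        using g(2) by (metis matrix_mul_assoc)
      then show ?thesis using g(1) by (simp add: inverse_matrix matrix_scaleR_left)
    qed
    then have "t *\<^sub>R (matrix_inv c ** N ** c) = matrix_inv x ** (matrix_inv g ** (g ** N)) ** x"
      unfolding cinv by (simp add: c_def matrix_mul_assoc matrix_scaleR_left matrix_scaleR_right)
    also have "matrix_inv g ** (g ** N) = N"
      using g(1) by (intro matrix_left_cancel(2)) (simp add: inverse_matrix)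
    finally show ?thesis
      using dx by (simp add: matrix_distribs inverse_matrix)
  qed
  have "norm (matrix_inv c ** N ** c) \<le> norm (matrix_inv c ** N) * norm c * K" by (rule K)
  also have "\<dots> \<le> (norm (matrix_inv c) * norm N * K) * norm c * K"
    using K by (intro mult_right_mono K(2)) auto
  also have "\<dots> \<le> (B * norm N * K) * R * K"
    using K x(2) B(2)[OF dc] B(1) by (intro mult_right_mono mult_mono) (auto simp: c_def)
  also have "\<dots> < C" by (simp add: C_def)
  finally have "norm (matrix_inv x ** (mat 1 + N) ** x - mat 1) < t * C"
    unfolding conj using t by simp
  also have "t * C = e" using C by (simp add: t_def)
  finally have small: "norm (matrix_inv x ** (mat 1 + N) ** x - mat 1) < e" .
  have "matrix_inv x ** (mat 1 + N) ** x \<in> L" by (intro mult inv x(1) L)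
  then have "matrix_inv x ** (mat 1 + N) ** x = mat 1" using small by (rule discrete(2))
  then have "x ** (matrix_inv x ** ((mat 1 + N) ** x)) ** matrix_inv x = x ** mat 1 ** matrix_inv x"
    by (simp add: matrix_mul_assoc)
  moreover have "x ** (matrix_inv x ** ((mat 1 + N) ** x)) = (mat 1 + N) ** x"
    using dx by (intro matrix_left_cancel(1)) (simp add: inverse_matrix)
  ultimately have "(mat 1 + N) ** (x ** matrix_inv x) = x ** matrix_inv x"
    by (simp add: matrix_mul_assoc)
  then show ?thesis using dx by (simp add: inverse_matrix)
qed

end

section \<open>Square-zero elements of integral lattices\<close>

definition eval_rat_poly :: "real^'n^'n \<Rightarrow> rat poly \<Rightarrow> real^'n^'n" where
  "eval_rat_poly A p = fold_coeffs (\<lambda>c u. of_rat c *\<^sub>R mat 1 + A ** u) p 0"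

lemma eval_rat_poly_0 [simp]: "eval_rat_poly A 0 = 0" by (simp add: eval_rat_poly_def)

lemma eval_rat_poly_pCons [simp]: "eval_rat_poly A (pCons c p) = of_rat c *\<^sub>R mat 1 + A ** eval_rat_poly A p"
  by (cases "c = 0 \<and> p = 0") (auto simp: eval_rat_poly_def fold_coeffs_pCons_not_0_0_eq fold_coeffs_pCons_coeff_not_0_eq)

lemma eval_rat_poly_add: "eval_rat_poly A (p + q) = eval_rat_poly A p + eval_rat_poly A q"
proof (induction p arbitrary: q)
  case (pCons a p)
  then show ?case
    by (cases q) (simp add: matrix_add_ldistrib of_rat_add scaleR_add_left)
qed simp

lemma eval_rat_poly_monom: "eval_rat_poly A (Polynomial.monom c k) = of_rat c *\<^sub>R mpow A k"
  by (induction k) (auto simp: monom_0 monom_Suc matrix_scaleR_right)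

lemma eval_rat_poly_sum_monom: "eval_rat_poly A (\<Sum>k\<in>I. Polynomial.monom (c k) k) = (\<Sum>k\<in>I. of_rat (c k) *\<^sub>R mpow A k)"
  by (induction I rule: infinite_finite_induct) (auto simp: eval_rat_poly_add eval_rat_poly_monom)

text \<open>
  Since \<open>A\<close> is not invertible, the constant term of its minimal polynomial vanishes;
  the quotient of this polynomial by \<open>X\<close> does not annihilate \<open>A\<close>.
\<close>

lemma annihilator:
  fixes A :: "real^'n^'n"
  assumes "det A = 0" "p \<noteq> 0" "eval_rat_poly A p = 0"
  shows "\<exists>q. eval_rat_poly A q \<noteq> 0 \<and> A ** eval_rat_poly A q = 0"
proof -
  have "\<exists>p. p \<noteq> 0 \<and> eval_rat_poly A p = 0" using assms(2,3) by blast
  then obtain p where p: "p \<noteq> 0" "eval_rat_poly A p = 0"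
    and min: "\<And>q. q \<noteq> 0 \<Longrightarrow> eval_rat_poly A q = 0 \<Longrightarrow> Polynomial.degree p \<le> Polynomial.degree q"
    using ex_has_least_nat[of "\<lambda>p. p \<noteq> 0 \<and> eval_rat_poly A p = 0" _ Polynomial.degree] by metis
  obtain c q where q: "p = pCons c q" by (cases p)
  have rel: "of_rat c *\<^sub>R mat 1 + A ** eval_rat_poly A q = 0" using p(2) q by simp
  have "c = 0"
  proof (rule ccontr)
    assume "c \<noteq> 0"
    have "A ** eval_rat_poly A q = - (of_rat c *\<^sub>R mat 1)" using rel by (simp add: add_eq_0_iff)
    then have "A ** ((- 1 / of_rat c) *\<^sub>R eval_rat_poly A q) = mat 1"
      using \<open>c \<noteq> 0\<close> by (simp add: matrix_scaleR_right matrix_minus_right)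
    then have "det A \<noteq> 0" by (rule det_right_inverse)
    then show False using assms(1) by simp
  qed
  then have "q \<noteq> 0" using p(1) q by auto
  then have "Polynomial.degree q < Polynomial.degree p" using q by simp
  then have "eval_rat_poly A q \<noteq> 0" using min[of q] \<open>q \<noteq> 0\<close> by auto
  then show ?thesis using rel \<open>c = 0\<close> by auto
qed

proposition no_integral_lattice:
  fixes P :: "complex^'n^'n" and L :: "(real^'n^'n) set"
  assumes L: "uniform_lattice L e R" and n3: "CARD('n) \<ge> 3" and F: "imaginary_quadratic F"
    and P: "det P \<noteq> 0"
    and mem: "\<And>s. s \<in> L \<longleftrightarrow> det s = 1 \<and> (\<forall>i j. (conj_embed P s) $ i $ j \<in> ring_of_integers F)"
  shows False
proof -
  interpret uniform_lattice L e R by (rule L)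
  let ?c = "conj_embed P"
  have c_0: "?c 0 = 0" using conj_embed_scaleR[of P 0 0] by simp
  have c_sum: "?c (\<Sum>i\<in>I. Z i) = (\<Sum>i\<in>I. ?c (Z i))" for I :: "'k set" and Z
    by (induction I rule: infinite_finite_induct) (auto simp: c_0 conj_embed_add)
  have c_inj: "Z = 0" if "?c Z = 0" for Z
    using conj_embed_back[OF P, of Z] that linear_0[OF linear_cmat] by (intro cmat_inj) simp
  note Fs = imaginary_quadraticD[OF F]
  have F_sum: "(\<Sum>i\<in>I. h i) \<in> F" if "\<And>i. i \<in> I \<Longrightarrow> h i \<in> F" for I :: "'n set" and h
    using that by (induction I rule: infinite_finite_induct) (auto intro: Fs)
  define AF where "AF = {Z. \<forall>i j. ?c Z $ i $ j \<in> F}"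
  have AF_add: "W + Z \<in> AF" if "W \<in> AF" "Z \<in> AF" for W Z
    using that by (auto simp: AF_def conj_embed_add intro: Fs)
  have AF_mult: "W ** Z \<in> AF" if "W \<in> AF" "Z \<in> AF" for W Z
    using that unfolding AF_def mem_Collect_eq conj_embed_mult[OF P]
    by (auto simp: matrix_matrix_mult_def intro!: F_sum Fs(4))
  have AF_scale: "of_rat q *\<^sub>R Z \<in> AF" if "Z \<in> AF" for q Z
    using that by (auto simp: AF_def conj_embed_scaleR of_rat_scaleR intro: Fs)
  have AF_one: "mat 1 \<in> AF"
    unfolding AF_def mem_Collect_eq conj_embed_one[OF P] by (auto simp: mat_def intro: Fs)
  have AF_0: "0 \<in> AF" by (auto simp: AF_def c_0 intro: Fs)
  have AF_sum: "(\<Sum>i\<in>I. Z i) \<in> AF" if "\<And>i. i \<in> I \<Longrightarrow> Z i \<in> AF" for I :: "(real^'n^'n) set" and Z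
    using that by (induction I rule: infinite_finite_induct) (auto intro: AF_0 AF_add)
  have AF_pow: "mpow Z k \<in> AF" if "Z \<in> AF" for Z k
    by (induction k) (auto intro: AF_one AF_mult that)
  have AF_mp: "eval_rat_poly Z p \<in> AF" if "Z \<in> AF" for Z p
    by (induction p) (auto intro!: AF_0 AF_add AF_mult AF_scale AF_one that)
  have L_AF: "x \<in> AF" if "x \<in> L" for x
    using that mem[of x] by (auto simp: AF_def ring_of_integers_def)
  have span: "span L = UNIV" using n3 by (intro span_lattice) simp
  \<comment> \<open>multiplying by \<open>elem j0 j0 1\<close> keeps one column, so the relation lives in \<open>F\<^sup>n\<close>\<close>
  obtain B where B: "B \<subseteq> L" "independent B" "L \<subseteq> span B" "card B = dim L"
    using basis_exists by blast
  have finB: "finite B" using B(2) by (rule independent_imp_finite)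
  have "dim L = dim (span L)" by simp
  then have cardB: "card B = CARD('n) * CARD('n)" using B(4) span by simp
  fix j0 :: 'n
  have "\<exists>k. (\<exists>x\<in>B. k x \<noteq> 0) \<and> (\<Sum>x\<in>B. of_rat (k x) *\<^sub>R (?c x ** elem j0 j0 1)) = 0"
  proof (rule rational_relation[OF F finB, of "{j0}"])
    show "2 * CARD('n) * card {j0} < card B" using n3 by (simp add: cardB)
    have col: "(?c x ** elem j0 j0 1) $ a $ b = (if b = j0 then ?c x $ a $ j0 else 0)" for x a b
      by (simp add: matrix_matrix_mult_def elem_nth if_distrib[of "\<lambda>x. _ * x"] cong: if_cong)
    show "(?c x ** elem j0 j0 1) $ a $ b \<in> F" if "x \<in> B" for x a b
      using L_AF[of x] B(1) that unfolding col by (auto simp: AF_def intro: Fs)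
    show "(?c x ** elem j0 j0 1) $ a $ b = 0" if "b \<notin> {j0}" for x a b
      using that by (simp add: col)
  qed
  then obtain k where k: "\<exists>x\<in>B. k x \<noteq> 0" "(\<Sum>x\<in>B. of_rat (k x) *\<^sub>R (?c x ** elem j0 j0 1)) = 0" by blast
  define a where "a = (\<Sum>x\<in>B. of_rat (k x) *\<^sub>R x)"
  have aAF: "a \<in> AF" unfolding a_def using B(1) L_AF by (intro AF_sum AF_scale) auto
  have a0: "a \<noteq> 0"
  proof
    assume "a = 0"
    then have "(\<Sum>x\<in>B. of_rat (k x) *\<^sub>R x) = 0" by (simp add: a_def)
    moreover have "\<exists>x\<in>B. (of_rat (k x) :: real) \<noteq> 0" using k(1) by simp
    ultimately have "dependent B" unfolding dependent_finite[OF finB]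
      by (intro exI[of _ "\<lambda>x. of_rat (k x)"] conjI)
    then show False using B(2) by simp
  qed
  have ca: "?c a ** elem j0 j0 1 = 0"
    using k(2) by (simp add: a_def c_sum conj_embed_scaleR matrix_sum_left matrix_scaleR_left)
  have deta: "det a = 0"
  proof (rule ccontr)
    assume "det a \<noteq> 0"
    then have "?c (matrix_inv a) ** (?c a ** elem j0 j0 1) = elem j0 j0 1"
      by (simp add: matrix_mul_assoc conj_embed_mult[OF P, symmetric] inverse_matrix conj_embed_one[OF P])
    then have "elem j0 j0 (1::complex) $ j0 $ j0 = 0" using ca by simp
    then show False by (simp add: elem_nth)
  qed
  \<comment> \<open>the powers of \<open>a\<close> lie in a space of rational dimension at most \<open>M\<close>\<close>
  define M where "M = 2 * CARD('n) * CARD('n)"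
  have "\<exists>q. (\<exists>i\<in>{..M}. q i \<noteq> 0) \<and> (\<Sum>i\<in>{..M}. of_rat (q i) *\<^sub>R ?c (mpow a i)) = 0"
    by (rule rational_relation[OF F, of _ UNIV]) (use AF_pow[OF aAF] in \<open>auto simp: M_def AF_def\<close>)
  then obtain q i where q: "i \<le> M" "q i \<noteq> 0" "(\<Sum>i\<le>M. of_rat (q i) *\<^sub>R ?c (mpow a i)) = 0" by auto
  define p where "p = (\<Sum>i\<le>M. Polynomial.monom (q i) i)"
  have "poly.coeff p i = q i" using q(1) by (simp add: p_def coeff_sum)
  then have "p \<noteq> 0" using q(2) by auto
  moreover have "eval_rat_poly a p = 0"
    by (rule c_inj) (use q(3) in \<open>simp add: p_def eval_rat_poly_sum_monom c_sum conj_embed_scaleR\<close>)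
  ultimately obtain b' where b': "eval_rat_poly a b' \<noteq> 0" "a ** eval_rat_poly a b' = 0"
    using annihilator[OF deta] by blast
  define b where "b = eval_rat_poly a b'"
  have bAF: "b \<in> AF" unfolding b_def by (rule AF_mp[OF aAF])
  have ab: "a ** b = 0" "b \<noteq> 0" using b' by (simp_all add: b_def)
  \<comment> \<open>as \<open>L\<close> spans all matrices, \<open>b x a\<close> cannot vanish for all \<open>x\<close>; its square contains \<open>a b = 0\<close>\<close>
  have "\<exists>x\<in>L. b ** x ** a \<noteq> 0"
  proof (rule ccontr)
    assume neg: "\<not> ?thesis"
    have zero: "b ** x ** a = 0" if "x \<in> span L" for x
      using that
    proof (induction rule: span_induct_alt)
      case (step r y z)
      then show ?case using neg
        by (simp add: matrix_add_ldistrib matrix_add_rdistrib matrix_scaleR_left matrix_scaleR_right)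
    qed simp
    obtain i j where bij: "b $ i $ j \<noteq> 0" using ab(2) by (auto simp: vec_eq_iff)
    obtain k l where akl: "a $ k $ l \<noteq> 0" using a0 by (auto simp: vec_eq_iff)
    have 1: "(b ** elem j k 1) $ i $ m = (if m = k then b $ i $ j else 0)" for m
      by (simp add: matrix_matrix_mult_def elem_nth if_distrib[of "\<lambda>x. _ * x"] cong: if_cong)
    have "(b ** elem j k 1 ** a) $ i $ l = (\<Sum>m\<in>UNIV. (b ** elem j k 1) $ i $ m * a $ m $ l)"
      by (simp add: matrix_matrix_mult_def)
    also have "\<dots> = b $ i $ j * a $ k $ l"
      by (simp add: 1 if_distrib[of "\<lambda>x. x * _"] cong: if_cong)
    finally show False using zero[of "elem j k 1"] span bij akl by simp
  qed
  then obtain x where x: "x \<in> L" "b ** x ** a \<noteq> 0" by blast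
  define N where "N = b ** x ** a"
  have NAF: "N \<in> AF" unfolding N_def using bAF aAF L_AF[OF x(1)] by (intro AF_mult)
  have "N ** N = b ** x ** (a ** b) ** x ** a" unfolding N_def by (simp only: matrix_mul_assoc)
  then have N2: "N ** N = 0" using ab by simp
  \<comment> \<open>multipliers for the entries combine to one for the matrix\<close>
  have "\<exists>D. D \<noteq> 0 \<and> quad_int (of_int D * ?c N $ i $ j)" for i j
    using integral_multiple[OF F, of "?c N $ i $ j"] NAF by (auto simp: AF_def)
  then obtain D where D: "\<And>i j. D i j \<noteq> 0" "\<And>i j. quad_int (of_int (D i j) * ?c N $ i $ j)" by metis
  define E :: int where "E = (\<Prod>(i, j)\<in>UNIV. D i j)"
  have E0: "E \<noteq> 0" using D(1) by (auto simp: E_def)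
  have ENq: "quad_int (of_int E * ?c N $ i $ j)" for i j
  proof -
    have "E = D i j * (\<Prod>(i, j)\<in>UNIV - {(i, j)}. D i j)"
      unfolding E_def by (subst prod.remove[of UNIV "(i, j)"]) auto
    then have "of_int E * ?c N $ i $ j =
        of_int (\<Prod>(i, j)\<in>UNIV - {(i, j)}. D i j) * (of_int (D i j) * ?c N $ i $ j)" by simp
    then show ?thesis using quad_int_of_int_mult[OF D(2)] by metis
  qed
  define N' where "N' = real_of_int E *\<^sub>R N"
  have N'2: "N' ** N' = 0" by (simp add: N'_def matrix_scaleR_left matrix_scaleR_right N2)
  have cN': "?c N' $ i $ j = of_int E * ?c N $ i $ j" for i j
    by (simp add: N'_def conj_embed_scaleR) (simp add: scaleR_conv_of_real)
  have "N' = of_rat (of_int E) *\<^sub>R N" by (simp add: N'_def)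
  then have N'AF: "N' \<in> AF" using AF_scale[OF NAF] by metis
  have "mat 1 + N' \<in> L"
    unfolding mem
  proof (intro conjI allI)
    show "det (mat 1 + N') = 1" using N'2 by (rule det_square_zero)
    fix i j
    have "?c (mat 1 + N') $ i $ j \<in> F"
      using AF_add[OF AF_one N'AF] by (simp add: AF_def)
    moreover have "?c (mat 1 + N') $ i $ j = (if i = j then 1 else 0) + of_int E * ?c N $ i $ j"
      unfolding conj_embed_add conj_embed_one[OF P] by (simp add: cN' mat_def)
    then have "quad_int (?c (mat 1 + N') $ i $ j)"
      using ENq[of i j] quad_int_add_1[OF ENq[of i j]] by (cases "i = j") simp_all
    ultimately show "(conj_embed P (mat 1 + N')) $ i $ j \<in> ring_of_integers F"
      unfolding ring_of_integers_def using quad_int_algebraic_int by blast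
  qed
  then have "N' = 0" using no_unipotent[OF N'2] by blast
  then show False using E0 x(2) by (simp add: N'_def N_def)
qed

section \<open>Covers of the special linear group\<close>

lemma SL_simps [simp]:
  "carrier (SL UNIV) = {A. det A = 1}" "mult (SL R) = (**)" "one (SL R) = mat 1"
  by (auto simp: SL_def)

lemma group_SL: "group (SL UNIV :: ('a::field^'n^'n) monoid)"
proof (rule groupI)
  show "\<exists>y\<in>carrier (SL UNIV). y \<otimes>\<^bsub>SL UNIV\<^esub> x = \<one>\<^bsub>SL UNIV\<^esub>"
    if "x \<in> carrier (SL UNIV)" for x :: "'a^'n^'n"
    using that by (intro bexI[of _ "matrix_inv x"]) (auto simp: inverse_matrix det_matrix_inv)
qed (auto simp: det_mul matrix_mul_assoc)

lemma m_inv_SL: "det A = 1 \<Longrightarrow> m_inv (SL UNIV) A = matrix_inv (A :: 'a::field^'n^'n)"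
  by (rule group.inv_equality[OF group_SL]) (auto simp: inverse_matrix det_matrix_inv)

text \<open>
  A transvection is a power of small transvections.
\<close>

lemma SL_generated_by_small_transvections:
  fixes g :: "real^'n^'n"
  assumes g: "det g = 1" and one: "Q (mat 1)" and mult: "\<And>x y. Q x \<Longrightarrow> Q y \<Longrightarrow> Q (x ** y)"
    and small: "\<And>i j. i \<noteq> j \<Longrightarrow> \<exists>d>0. \<forall>t. \<bar>t\<bar> < d \<longrightarrow> Q (transv i j t)"
  shows "Q g"
  using g one
proof (rule SL_generated_by_transvections)
  fix i j :: 'n and t :: real assume ij: "i \<noteq> j"
  obtain d where d: "d > 0" "\<And>t. \<bar>t\<bar> < d \<Longrightarrow> Q (transv i j t)" using small[OF ij] by blast
  obtain m :: nat where m: "\<bar>t\<bar> < real m * d" using reals_Archimedean3[OF d(1)] by blast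
  then have m0: "m > 0" by (cases m) auto
  have "\<bar>t / real m\<bar> < d" using m m0 by (simp add: abs_divide pos_divide_less_eq mult.commute)
  then have q: "Q (transv i j (t / real m))" by (rule d(2))
  have "Q (mpow (transv i j (t / real m)) k)" for k
    by (induction k) (auto intro: one mult q)
  from this[of m] show "Q (transv i j t)" using m0 by (simp add: mpow_transv[OF ij])
qed (rule mult)

text \<open>Transvections are divisible, so \<open>SL\<close> has no proper subgroup of finite index.\<close>

lemma finite_index_subgroup_SL:
  fixes H :: "(real^'n^'n) set"
  assumes H: "subgroup H (SL UNIV)" and fin: "finite (lcosets\<^bsub>SL UNIV\<^esub> H)"
  shows "H = {A. det A = 1}"
proof -
  interpret subgroup H "SL UNIV" by (rule H)
  have sub: "H \<subseteq> {A. det A = 1}" using subset by simp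
  have one: "mat 1 \<in> H" using one_closed by simp
  have mult: "x ** y \<in> H" if "x \<in> H" "y \<in> H" for x y using m_closed[OF that] by simp
  have tr: "transv i j t \<in> H" if ij: "i \<noteq> j" for i j t
  proof -
    define N where "N = card (lcosets\<^bsub>SL UNIV\<^esub> H)"
    define \<tau> where "\<tau> = t / fact N"
    define h where "h m = transv i j (real m * \<tau>) <#\<^bsub>SL UNIV\<^esub> H" for m :: nat
    have "h ` {0..N} \<subseteq> lcosets\<^bsub>SL UNIV\<^esub> H"
    proof (rule image_subsetI)
      fix m
      show "h m \<in> lcosets\<^bsub>SL UNIV\<^esub> H"
        unfolding LCOSETS_def h_def
        by (rule UN_I[of "transv i j (real m * \<tau>)"]) (simp_all add: det_transv[OF ij])
    qed
    then have "card (h ` {0..N}) \<le> N" unfolding N_def by (rule card_mono[OF fin])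
    then have "\<not> inj_on h {0..N}" using card_image[of h "{0..N}"] by auto
    then obtain m m' where mm: "m \<le> N" "m' \<le> N" "m < m'" "h m = h m'"
      by (auto simp: inj_on_def) (metis linorder_neqE_nat)
    have "transv i j (real m' * \<tau>) \<in> h m'"
      unfolding h_def l_coset_def using one by force
    then obtain x where x: "x \<in> H" "transv i j (real m' * \<tau>) = transv i j (real m * \<tau>) ** x"
      using mm(4) unfolding h_def l_coset_def by auto
    define d where "d = m' - m"
    have d: "1 \<le> d" "d \<le> N" "real d = real m' - real m" using mm by (auto simp: d_def)
    have "transv i j (- real m * \<tau>) ** transv i j (real m' * \<tau>) =
        (transv i j (- real m * \<tau>) ** transv i j (real m * \<tau>)) ** x"
      unfolding x(2) by (simp add: matrix_mul_assoc)
    then have "transv i j (real d * \<tau>) = x"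
      using ij d by (simp add: transv_add left_diff_distrib)
    then have dH: "transv i j (real d * \<tau>) \<in> H" using x(1) by simp
    have "d dvd fact N" using d by (intro dvd_fact) auto
    then obtain l where l: "fact N = d * l" by auto
    have "mpow (transv i j (real d * \<tau>)) k \<in> H" for k
      by (induction k) (auto intro: one mult dH)
    from this[of l] have "transv i j (real l * (real d * \<tau>)) \<in> H" by (simp add: mpow_transv[OF ij])
    moreover have "real l * (real d * \<tau>) = t"
    proof -
      have "real l * real d = fact N" using l by (metis mult.commute of_nat_fact of_nat_mult)
      then show ?thesis by (simp add: \<tau>_def mult.assoc[symmetric])
    qed
    ultimately show ?thesis by simp
  qed
  have "g \<in> H" if "det g = 1" for g
    using that one by (rule SL_generated_by_transvections) (auto intro: tr mult)
  then show ?thesis using sub by blast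
qed

text \<open>
  A sheet of \<open>q\<close> through the unit gives a continuous section \<open>s\<close> of
  \<open>q\<close> near one, and \<open>\<rho> = p \<circ> s\<close>. Since \<open>s\<close> is
  inverse to \<open>q\<close> on the sheet, identities between elements of the sheet can be checked
  after applying \<open>q\<close>; this makes \<open>s\<close> multiplicative near one and
  compatible with conjugation by elements of \<open>K\<close>.
\<close>

lemma finite_cover_local_rep:
  fixes K :: "'k monoid" and G' :: "(complex^'n^'n) set" and q :: "'k \<Rightarrow> real^'n^'n"
  assumes n3: "CARD('n) \<ge> 3" and G': "G' \<subseteq> {A. det A = 1}"
    and p: "finite_cover K S ((SL UNIV)\<lparr>carrier := G'\<rparr>) (top_of_set G') p"
    and q: "finite_cover K S (SL UNIV) (top_of_set (carrier (SL UNIV))) q"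
  shows "\<exists>\<rho> e. local_rep \<rho> e \<and>
    (\<forall>x. det x = 1 \<longrightarrow> norm (x - mat 1) < e \<longrightarrow> (\<exists>k\<in>carrier K. q k = x \<and> p k = \<rho> x))"
proof -
  define M where "M = {x :: real^'n^'n. det x = 1}"
  have tK: "topological_group K S" and tG: "topological_group ((SL UNIV)\<lparr>carrier := G'\<rparr>) (top_of_set G')"
    and ph: "p \<in> hom K ((SL UNIV)\<lparr>carrier := G'\<rparr>)" and pc: "covering_map S (top_of_set G') p"
    and pk: "finite (kernel K ((SL UNIV)\<lparr>carrier := G'\<rparr>) p)"
    using p by (auto simp: finite_cover_def)
  have qh: "q \<in> hom K (SL UNIV)" and qc: "covering_map S (top_of_set M) q"
    using q by (auto simp: finite_cover_def M_def)
  interpret K: group K using tK by (simp add: topological_group_def)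
  have topS: "topspace S = carrier K" and
    multS: "continuous_map (prod_topology S S) S (\<lambda>(x, y). x \<otimes>\<^bsub>K\<^esub> y)"
    using tK by (simp_all add: topological_group_def)
  interpret q: group_hom K "SL UNIV" q
    using qh group_SL by (simp add: group_hom_def group_hom_axioms_def K.group_axioms)
  have gG: "group ((SL UNIV)\<lparr>carrier := G'\<rparr>)" using tG by (simp add: topological_group_def)
  interpret p: group_hom K "(SL UNIV)\<lparr>carrier := G'\<rparr>" p
    using ph gG by (simp add: group_hom_def group_hom_axioms_def K.group_axioms)
  have q1: "q \<one>\<^bsub>K\<^esub> = mat 1" and p1: "p \<one>\<^bsub>K\<^esub> = mat 1"
    using q.hom_one p.hom_one by simp_all
  have qm: "q (a \<otimes>\<^bsub>K\<^esub> b) = q a ** q b" and pm: "p (a \<otimes>\<^bsub>K\<^esub> b) = p a ** p b"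
    if "a \<in> carrier K" "b \<in> carrier K" for a b
    using q.hom_mult[OF that] p.hom_mult[OF that] by simp_all
  have qM: "det (q a) = 1" and pG: "p a \<in> G'" if "a \<in> carrier K" for a
    using q.hom_closed[OF that] p.hom_closed[OF that] by simp_all
  \<comment> \<open>\<open>V\<close> is the sheet over \<open>U\<close> that contains the unit\<close>
  have "mat 1 \<in> topspace (top_of_set M)" by (simp add: M_def)
  from bspec[OF conjunct2[OF conjunct2[OF qc[unfolded covering_map_def]]] this]
  obtain U where "mat 1 \<in> U \<and> openin (top_of_set M) U \<and>
      (\<exists>\<V>. \<Union>\<V> = {x \<in> topspace S. q x \<in> U} \<and> (\<forall>V\<in>\<V>. openin S V) \<and> pairwise disjnt \<V> \<and>
        (\<forall>V\<in>\<V>. homeomorphic_map (subtopology S V) (subtopology (top_of_set M) U) q))"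
    by (elim exE)
  then obtain \<V> where U: "mat 1 \<in> U" "openin (top_of_set M) U"
    and UV: "\<Union>\<V> = {x \<in> topspace S. q x \<in> U}" "\<forall>V\<in>\<V>. openin S V"
      "\<forall>V\<in>\<V>. homeomorphic_map (subtopology S V) (subtopology (top_of_set M) U) q"
    by (elim exE conjE)
  have "\<one>\<^bsub>K\<^esub> \<in> \<Union>\<V>" using UV(1) U(1) q1 topS by simp
  then obtain V where V: "\<one>\<^bsub>K\<^esub> \<in> V" "V \<in> \<V>" by blast
  have Vo: "openin S V" and VK: "V \<subseteq> carrier K" and qV: "q ` V \<subseteq> U"
    using UV V openin_subset[of S V] topS by auto
  have UM: "U \<subseteq> M" using U(2) openin_subset by fastforce
  obtain s where s: "homeomorphic_maps (subtopology S V) (subtopology (top_of_set M) U) q s"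
    using UV(3) V(2) homeomorphic_map_maps by blast
  have tU: "subtopology (top_of_set M) U = top_of_set U"
    using UM by (simp add: subtopology_subtopology inf.absorb2)
  have tV: "topspace (subtopology S V) = V" using VK topS by auto
  have sc: "continuous_map (top_of_set U) (subtopology S V) s"
    and sq: "\<And>v. v \<in> V \<Longrightarrow> s (q v) = v" and qs: "\<And>u. u \<in> U \<Longrightarrow> q (s u) = u"
    using s tV unfolding homeomorphic_maps_def tU by auto
  have sV: "s u \<in> V" if "u \<in> U" for u
    using continuous_map_image_subset_topspace[OF sc] that tV by auto
  have s1: "s (mat 1) = \<one>\<^bsub>K\<^esub>" using sq[OF V(1)] q1 by simp
  have scS: "continuous_map (top_of_set U) S s"
    using sc by (simp add: continuous_map_in_subtopology)
  define \<rho> where "\<rho> x = p (s x)" for x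
  obtain e where e: "e > 0" "\<And>x. det x = 1 \<Longrightarrow> norm (x - mat 1) < e \<Longrightarrow> x \<in> U"
    using U unfolding openin_euclidean_subtopology_iff M_def by (auto simp: dist_norm)
  have nbhd: "\<exists>d>0. d \<le> e \<and> (\<forall>x. det x = 1 \<longrightarrow> norm (x - mat 1) < d \<longrightarrow> s x \<in> W)"
    if W: "openin S W" "\<one>\<^bsub>K\<^esub> \<in> W" for W
  proof -
    have "openin (top_of_set U) {x \<in> U. s x \<in> W}"
      using openin_continuous_map_preimage[OF scS W(1)] by simp
    moreover have "mat 1 \<in> {x \<in> U. s x \<in> W}" using U s1 W by simp
    ultimately obtain d where "d > 0" "\<And>x. x \<in> U \<Longrightarrow> norm (x - mat 1) < d \<Longrightarrow> s x \<in> W"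
      unfolding openin_euclidean_subtopology_iff by (auto simp: dist_norm)
    then show ?thesis using e by (intro exI[of _ "min d e"]) auto
  qed
  have "local_rep \<rho> e"
  proof
    show "\<rho> (mat 1) = mat 1" by (simp add: \<rho>_def s1 p1)
    have "continuous_map (top_of_set U) (top_of_set G') (p \<circ> s)"
      using scS pc by (intro continuous_map_compose) (auto simp: covering_map_def)
    then have "continuous_on U (p \<circ> s)"
      by (simp add: continuous_map_in_subtopology)
    then have "continuous_on U \<rho>" by (simp add: \<rho>_def[abs_def] o_def)
    then show "continuous_on {x. det x = 1 \<and> norm (x - mat 1) < e} \<rho>"
      by (rule continuous_on_subset) (use e in auto)
    show "finite {x. det x = 1 \<and> norm (x - mat 1) < e \<and> \<rho> x = mat 1}" (is "finite ?Z")
    proof (rule finite_imageD)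
      have "s ` ?Z \<subseteq> kernel K ((SL UNIV)\<lparr>carrier := G'\<rparr>) p"
        using e(2) sV VK by (auto simp: kernel_def \<rho>_def)
      then show "finite (s ` ?Z)" using pk finite_subset by blast
      show "inj_on s ?Z" using e(2) qs by (intro inj_on_inverseI[of _ q]) auto
    qed
    show "\<exists>d>0. \<forall>x y. det x = 1 \<longrightarrow> det y = 1 \<longrightarrow> norm (x - mat 1) < d \<longrightarrow> norm (y - mat 1) < d \<longrightarrow>
        \<rho> (x ** y) = \<rho> x ** \<rho> y"
    proof -
      have o1: "openin (prod_topology S S) {z \<in> topspace (prod_topology S S). (case z of (x, y) \<Rightarrow> x \<otimes>\<^bsub>K\<^esub> y) \<in> V}"
        by (rule openin_continuous_map_preimage[OF multS Vo])
      have o2: "(\<one>\<^bsub>K\<^esub>, \<one>\<^bsub>K\<^esub>) \<in> {z \<in> topspace (prod_topology S S). (case z of (x, y) \<Rightarrow> x \<otimes>\<^bsub>K\<^esub> y) \<in> V}"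
        using V topS by simp
      obtain V1 V2 where "openin S V1 \<and> openin S V2 \<and> \<one>\<^bsub>K\<^esub> \<in> V1 \<and> \<one>\<^bsub>K\<^esub> \<in> V2 \<and>
        V1 \<times> V2 \<subseteq> {z \<in> topspace (prod_topology S S). (case z of (x, y) \<Rightarrow> x \<otimes>\<^bsub>K\<^esub> y) \<in> V}"
        using iffD1[OF openin_prod_topology_alt o1, rule_format, OF o2] by (elim exE)
      then have V12: "openin S V1" "openin S V2" "\<one>\<^bsub>K\<^esub> \<in> V1" "\<one>\<^bsub>K\<^esub> \<in> V2"
        "V1 \<times> V2 \<subseteq> {z \<in> topspace (prod_topology S S). (case z of (x, y) \<Rightarrow> x \<otimes>\<^bsub>K\<^esub> y) \<in> V}"
        by (simp_all only:)
      obtain d1 where d1: "d1 > 0" "d1 \<le> e" "\<And>x. det x = 1 \<Longrightarrow> norm (x - mat 1) < d1 \<Longrightarrow> s x \<in> V1"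
        using nbhd[OF V12(1,3)] by blast
      obtain d2 where d2: "d2 > 0" "d2 \<le> e" "\<And>x. det x = 1 \<Longrightarrow> norm (x - mat 1) < d2 \<Longrightarrow> s x \<in> V2"
        using nbhd[OF V12(2,4)] by blast
      have "\<rho> (x ** y) = \<rho> x ** \<rho> y"
        if "det x = 1" "det y = 1" "norm (x - mat 1) < min d1 d2" "norm (y - mat 1) < min d1 d2" for x y
      proof -
        have sxy: "(s x, s y) \<in> V1 \<times> V2" using that d1(3) d2(3) by auto
        have v: "s x \<otimes>\<^bsub>K\<^esub> s y \<in> V" using subsetD[OF V12(5) sxy] by simp
        have xy: "x \<in> U" "y \<in> U" using that d1(2) d2(2) e(2) by auto
        have k: "s x \<in> carrier K" "s y \<in> carrier K" using sV VK xy by auto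
        have "q (s x \<otimes>\<^bsub>K\<^esub> s y) = x ** y" using qm[OF k] qs xy by simp
        then have "s (x ** y) = s x \<otimes>\<^bsub>K\<^esub> s y" using sq[OF v] by simp
        then show ?thesis using pm[OF k] by (simp add: \<rho>_def)
      qed
      then show ?thesis using d1(1) d2(1) by (intro exI[of _ "min d1 d2"]) auto
    qed
    show "\<exists>W. det W \<noteq> 0 \<and> (\<exists>d>0. \<forall>x. det x = 1 \<longrightarrow> norm (x - mat 1) < d \<longrightarrow>
        \<rho> (w ** x ** matrix_inv w) ** W = W ** \<rho> x)" if w: "det w = 1" for w
    proof -
      have "w \<in> q ` topspace S" using qc w by (simp add: covering_map_def M_def)
      then obtain k where k: "k \<in> carrier K" "q k = w" using topS by auto
      have ik: "inv\<^bsub>K\<^esub> k \<in> carrier K" using k by simp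
      have qi: "q (inv\<^bsub>K\<^esub> k) = matrix_inv w"
        using qm[OF k(1) ik] q1 k by (intro matrix_inv_unique[symmetric]) simp
      have pi: "p (inv\<^bsub>K\<^esub> k) ** p k = mat 1"
        using pm[OF ik k(1)] p1 k by simp
      have "continuous_map S S (\<lambda>v. k \<otimes>\<^bsub>K\<^esub> v \<otimes>\<^bsub>K\<^esub> inv\<^bsub>K\<^esub> k)"
      proof -
        have "continuous_map S (prod_topology S S) (\<lambda>v. (k, v))"
          using k topS by (intro continuous_map_pairedI) auto
        from continuous_map_compose[OF this multS] have c1: "continuous_map S S (\<lambda>v. k \<otimes>\<^bsub>K\<^esub> v)"
          by (simp add: o_def)
        have "continuous_map S (prod_topology S S) (\<lambda>v. (k \<otimes>\<^bsub>K\<^esub> v, inv\<^bsub>K\<^esub> k))"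
          using ik topS by (intro continuous_map_pairedI c1) auto
        from continuous_map_compose[OF this multS] show ?thesis
          by (simp add: o_def)
      qed
      from openin_continuous_map_preimage[OF this Vo]
      have "openin S {v \<in> topspace S. k \<otimes>\<^bsub>K\<^esub> v \<otimes>\<^bsub>K\<^esub> inv\<^bsub>K\<^esub> k \<in> V}" .
      moreover have "\<one>\<^bsub>K\<^esub> \<in> {v \<in> topspace S. k \<otimes>\<^bsub>K\<^esub> v \<otimes>\<^bsub>K\<^esub> inv\<^bsub>K\<^esub> k \<in> V}"
        using k V topS by simp
      ultimately obtain d where d: "d > 0" "d \<le> e" "\<And>x. det x = 1 \<Longrightarrow> norm (x - mat 1) < d \<Longrightarrow>
          s x \<in> {v \<in> topspace S. k \<otimes>\<^bsub>K\<^esub> v \<otimes>\<^bsub>K\<^esub> inv\<^bsub>K\<^esub> k \<in> V}"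
        using nbhd by blast
      have "\<rho> (w ** x ** matrix_inv w) ** p k = p k ** \<rho> x"
        if x: "det x = 1" "norm (x - mat 1) < d" for x
      proof -
        have xU: "x \<in> U" using e(2) x d(2) by auto
        have sx: "s x \<in> carrier K" and v: "k \<otimes>\<^bsub>K\<^esub> s x \<otimes>\<^bsub>K\<^esub> inv\<^bsub>K\<^esub> k \<in> V"
          using d(3)[OF x] topS by auto
        have "q (k \<otimes>\<^bsub>K\<^esub> s x \<otimes>\<^bsub>K\<^esub> inv\<^bsub>K\<^esub> k) = w ** x ** matrix_inv w"
          using qm[of "k \<otimes>\<^bsub>K\<^esub> s x" "inv\<^bsub>K\<^esub> k"] qm[of k "s x"] qi qs[OF xU] k ik sx by simp
        then have "s (w ** x ** matrix_inv w) = k \<otimes>\<^bsub>K\<^esub> s x \<otimes>\<^bsub>K\<^esub> inv\<^bsub>K\<^esub> k"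
          using sq[OF v] by simp
        then have "\<rho> (w ** x ** matrix_inv w) = p k ** \<rho> x ** p (inv\<^bsub>K\<^esub> k)"
          using pm[of "k \<otimes>\<^bsub>K\<^esub> s x" "inv\<^bsub>K\<^esub> k"] pm[of k "s x"] k ik sx by (simp add: \<rho>_def)
        then show ?thesis using pi by (simp add: matrix_mul_assoc[symmetric])
      qed
      moreover have "det (p k) \<noteq> 0" using pG[OF k(1)] G' by auto
      ultimately show ?thesis using d(1) by blast
    qed
  qed (use n3 e in auto)
  moreover have "\<exists>k\<in>carrier K. q k = x \<and> p k = \<rho> x" if "det x = 1" "norm (x - mat 1) < e" for x
    using e(2)[OF that] sV VK qs by (intro bexI[of _ "s x"]) (auto simp: \<rho>_def)
  ultimately show ?thesis by blast
qed

section \<open>Groups isogenous to the special linear group\<close>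

text \<open>
  The subgroup of finite index in \<open>SL\<close> is all of it. Since \<open>p\<close> agrees with
  \<open>\<rho>\<close> on lifts of small elements, it maps lifts of small transvections into the
  conjugate of \<open>SL\<close>, so the preimage under \<open>p\<close> of this conjugate meets
  every coset of the finite kernel of \<open>q\<close>.
\<close>

lemma isogenous_contains_conjugate:
  fixes G :: "(complex^'n^'n) set"
  assumes n3: "CARD('n) \<ge> 3" and G: "subgroup G (SL UNIV)"
    and iso: "isogenous ((SL UNIV)\<lparr>carrier := G\<rparr>) (top_of_set G)
              (SL UNIV :: (real ^ 'n ^ 'n) monoid) (top_of_set (carrier (SL UNIV)))"
  shows "\<exists>P Y. det P \<noteq> 0 \<and> finite Y \<and> (\<forall>g. det g = 1 \<longrightarrow> conj_embed P g \<in> G) \<and>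
    (\<forall>x\<in>G. \<exists>y\<in>Y. \<exists>g. det g = 1 \<and> x = y ** (conj_embed P g))"
proof -
  obtain G' H' and K :: "((complex^'n^'n) \<times> (real^'n^'n)) monoid" and S p q where
    G'0: "closed_finite_index_subgroup G' ((SL UNIV)\<lparr>carrier := G\<rparr>) (top_of_set G)" and
    H'0: "closed_finite_index_subgroup H' (SL UNIV) (top_of_set (carrier (SL UNIV :: (real ^ 'n ^ 'n) monoid)))" and
    p0: "finite_cover K S ((SL UNIV)\<lparr>carrier := G, carrier := G'\<rparr>) (subtopology (top_of_set G) G') p" and
    q0: "finite_cover K S ((SL UNIV)\<lparr>carrier := H'\<rparr>)
      (subtopology (top_of_set (carrier (SL UNIV :: (real ^ 'n ^ 'n) monoid))) H') q"
    using iso unfolding isogenous_def by (elim exE conjE)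
  have H': "H' = {A. det A = 1}"
    using H'0 finite_index_subgroup_SL by (auto simp: closed_finite_index_subgroup_def)
  have G'sub: "subgroup G' ((SL UNIV)\<lparr>carrier := G\<rparr>)" and fin: "finite (lcosets\<^bsub>(SL UNIV)\<lparr>carrier := G\<rparr>\<^esub> G')"
    using G'0 by (auto simp: closed_finite_index_subgroup_def)
  have GSL: "G \<subseteq> {A. det A = 1}" using subgroup.subset[OF G] by simp
  have G'G: "G' \<subseteq> G" using subgroup.subset[OF G'sub] by simp
  have G'1: "mat 1 \<in> G'" using subgroup.one_closed[OF G'sub] by simp
  have G'm: "x ** y \<in> G'" if "x \<in> G'" "y \<in> G'" for x y
    using subgroup.m_closed[OF G'sub that] by simp
  have "subtopology (top_of_set G) G' = top_of_set G'"
    using G'G by (simp add: subtopology_subtopology inf.absorb2)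
  then have p: "finite_cover K S ((SL UNIV)\<lparr>carrier := G'\<rparr>) (top_of_set G') p" using p0 by simp
  have "(SL UNIV)\<lparr>carrier := H'\<rparr> = (SL UNIV :: (real^'n^'n) monoid)" by (simp add: H' SL_def)
  moreover have "subtopology (top_of_set (carrier (SL UNIV))) H' = top_of_set (carrier (SL UNIV :: (real^'n^'n) monoid))"
    by (simp add: H' subtopology_subtopology)
  ultimately have q: "finite_cover K S (SL UNIV) (top_of_set (carrier (SL UNIV))) q" using q0 by simp
  obtain \<rho> e where lr: "local_rep \<rho> e" and
    sec: "\<And>x. det x = 1 \<Longrightarrow> norm (x - mat 1) < e \<Longrightarrow> \<exists>k\<in>carrier K. q k = x \<and> p k = \<rho> x"
    using finite_cover_local_rep[OF n3 _ p q] G'G GSL by blast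
  have e: "e > 0" using lr by (simp add: local_rep_def)
  obtain P where forms0: "det P \<noteq> 0 \<and>
    ((\<forall>i j. i \<noteq> j \<longrightarrow> (\<exists>d>0. \<forall>t. \<bar>t\<bar> < d \<longrightarrow> \<rho> (transv i j t) = conj_embed P (transv i j t))) \<or>
     (\<forall>i j. i \<noteq> j \<longrightarrow> (\<exists>d>0. \<forall>t. \<bar>t\<bar> < d \<longrightarrow> \<rho> (transv i j t) = conj_embed P (transv j i (- t)))))"
    using local_rep.local_form[OF lr] by (elim exE)
  note P = conjunct1[OF forms0] and forms = conjunct2[OF forms0]
  define \<Phi> where "\<Phi> = conj_embed P"
  have \<Phi>_mult: "\<Phi> (g ** h) = \<Phi> g ** \<Phi> h" for g h unfolding \<Phi>_def by (rule conj_embed_mult[OF P])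
  have \<Phi>_one: "\<Phi> (mat 1) = mat 1" unfolding \<Phi>_def by (rule conj_embed_one[OF P])
  have image: "\<exists>d>0. \<forall>t. \<bar>t\<bar> < d \<longrightarrow> (\<exists>h. det h = 1 \<and> \<rho> (transv i j t) = \<Phi> h)" if ij: "i \<noteq> j" for i j
    using forms
  proof
    assume "\<forall>i j. i \<noteq> j \<longrightarrow> (\<exists>d>0. \<forall>t. \<bar>t\<bar> < d \<longrightarrow> \<rho> (transv i j t) = conj_embed P (transv i j t))"
    then obtain d where "d > 0" "\<And>t. \<bar>t\<bar> < d \<Longrightarrow> \<rho> (transv i j t) = \<Phi> (transv i j t)"
      using ij unfolding \<Phi>_def by blast
    then show ?thesis using det_transv[OF ij] by blast
  next
    assume "\<forall>i j. i \<noteq> j \<longrightarrow> (\<exists>d>0. \<forall>t. \<bar>t\<bar> < d \<longrightarrow> \<rho> (transv i j t) = conj_embed P (transv j i (- t)))"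
    then obtain d where "d > 0" "\<And>t. \<bar>t\<bar> < d \<Longrightarrow> \<rho> (transv i j t) = \<Phi> (transv j i (- t))"
      using ij unfolding \<Phi>_def by blast
    then show ?thesis using det_transv[of j i] ij by blast
  qed
  have preimage: "\<exists>d>0. \<forall>t. \<bar>t\<bar> < d \<longrightarrow> (\<exists>k l s. k \<noteq> l \<and> \<bar>s\<bar> = \<bar>t\<bar> \<and> \<rho> (transv k l s) = \<Phi> (transv i j t))"
    if ij: "i \<noteq> j" for i j
    using forms
  proof
    assume "\<forall>i j. i \<noteq> j \<longrightarrow> (\<exists>d>0. \<forall>t. \<bar>t\<bar> < d \<longrightarrow> \<rho> (transv i j t) = conj_embed P (transv i j t))"
    then obtain d where "d > 0" "\<And>t. \<bar>t\<bar> < d \<Longrightarrow> \<rho> (transv i j t) = \<Phi> (transv i j t)"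
      using ij unfolding \<Phi>_def by blast
    then show ?thesis using ij by blast
  next
    assume "\<forall>i j. i \<noteq> j \<longrightarrow> (\<exists>d>0. \<forall>t. \<bar>t\<bar> < d \<longrightarrow> \<rho> (transv i j t) = conj_embed P (transv j i (- t)))"
    then obtain d where d: "d > 0" "\<And>t. \<bar>t\<bar> < d \<Longrightarrow> \<rho> (transv j i t) = \<Phi> (transv i j (- t))"
      using ij unfolding \<Phi>_def by metis
    have "j \<noteq> i \<and> \<bar>- t\<bar> = \<bar>t\<bar> \<and> \<rho> (transv j i (- t)) = \<Phi> (transv i j t)" if "\<bar>t\<bar> < d" for t
      using d(2)[of "- t"] ij that by simp
    then show ?thesis using d(1) by blast
  qed
  have K: "group K" using p by (simp add: finite_cover_def topological_group_def)
  interpret K: group K by (rule K)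
  have ph: "p \<in> hom K ((SL UNIV)\<lparr>carrier := G'\<rparr>)" and qh: "q \<in> hom K (SL UNIV)"
    using p q by (auto simp: finite_cover_def)
  have pm: "p (a \<otimes>\<^bsub>K\<^esub> b) = p a ** p b" if "a \<in> carrier K" "b \<in> carrier K" for a b
    using hom_mult[OF ph that] by simp
  have qm: "q (a \<otimes>\<^bsub>K\<^esub> b) = q a ** q b" if "a \<in> carrier K" "b \<in> carrier K" for a b
    using hom_mult[OF qh that] by simp
  have pc: "p a \<in> G'" if "a \<in> carrier K" for a using hom_in_carrier[OF ph that] by simp
  have qc: "det (q a) = 1" if "a \<in> carrier K" for a using hom_in_carrier[OF qh that] by simp
  have "group ((SL UNIV)\<lparr>carrier := G'\<rparr>)" using p by (simp add: finite_cover_def topological_group_def)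
  then have p1: "p \<one>\<^bsub>K\<^esub> = mat 1" using hom_one[OF ph K] by simp
  have q1: "q \<one>\<^bsub>K\<^esub> = mat 1" using hom_one[OF qh K group_SL] by simp
  \<comment> \<open>a small conjugated transvection is a value of \<open>\<rho>\<close>, hence of \<open>p\<close>\<close>
  have \<Phi>G': "\<Phi> g \<in> G'" if "det g = 1" for g
    using that
  proof (rule SL_generated_by_small_transvections)
    show "\<Phi> (mat 1) \<in> G'" using G'1 by (simp add: \<Phi>_one)
    show "\<Phi> (x ** y) \<in> G'" if "\<Phi> x \<in> G'" "\<Phi> y \<in> G'" for x y
      using G'm[OF that] by (simp add: \<Phi>_mult)
    fix i j :: 'n assume ij: "i \<noteq> j"
    obtain d where d: "d > 0" "\<And>t. \<bar>t\<bar> < d \<Longrightarrow> \<exists>k l s. k \<noteq> l \<and> \<bar>s\<bar> = \<bar>t\<bar> \<and> \<rho> (transv k l s) = \<Phi> (transv i j t)"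
      using preimage[OF ij] by blast
    have "\<Phi> (transv i j t) \<in> G'" if t: "\<bar>t\<bar> < min d e" for t
    proof -
      obtain k l s where kl: "k \<noteq> l" "\<bar>s\<bar> = \<bar>t\<bar>" "\<rho> (transv k l s) = \<Phi> (transv i j t)"
        using d(2)[of t] t by auto
      then obtain a where "a \<in> carrier K" "p a = \<rho> (transv k l s)"
        using sec[of "transv k l s"] t by (auto simp: det_transv norm_transv)
      then show ?thesis using pc kl(3) by metis
    qed
    then show "\<exists>d>0. \<forall>t. \<bar>t\<bar> < d \<longrightarrow> \<Phi> (transv i j t) \<in> G'"
      using d(1) e by (intro exI[of _ "min d e"]) auto
  qed
  \<comment> \<open>conversely, \<open>p\<close> maps lifts of small transvections into the conjugate\<close>
  have lift: "\<exists>k\<in>carrier K. q k = g \<and> (\<exists>h. det h = 1 \<and> p k = \<Phi> h)" if "det g = 1" for g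
    using that
  proof (rule SL_generated_by_small_transvections)
    show "\<exists>k\<in>carrier K. q k = mat 1 \<and> (\<exists>h. det h = 1 \<and> p k = \<Phi> h)"
      using p1 q1 \<Phi>_one by (intro bexI[of _ "\<one>\<^bsub>K\<^esub>"] conjI exI[of _ "mat 1"]) auto
    show "\<exists>k\<in>carrier K. q k = x ** y \<and> (\<exists>h. det h = 1 \<and> p k = \<Phi> h)"
      if x: "\<exists>k\<in>carrier K. q k = x \<and> (\<exists>h. det h = 1 \<and> p k = \<Phi> h)"
        and y: "\<exists>k\<in>carrier K. q k = y \<and> (\<exists>h. det h = 1 \<and> p k = \<Phi> h)" for x y
    proof -
      obtain k h where k: "k \<in> carrier K" "q k = x" "det h = 1" "p k = \<Phi> h" using x by blast
      obtain k' h' where k': "k' \<in> carrier K" "q k' = y" "det h' = 1" "p k' = \<Phi> h'" using y by blast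
      show ?thesis
        using k k' by (intro bexI[of _ "k \<otimes>\<^bsub>K\<^esub> k'"] conjI exI[of _ "h ** h'"])
          (auto simp: qm pm \<Phi>_mult det_mul)
    qed
    fix i j :: 'n assume ij: "i \<noteq> j"
    obtain d where d: "d > 0" "\<And>t. \<bar>t\<bar> < d \<Longrightarrow> \<exists>h. det h = 1 \<and> \<rho> (transv i j t) = \<Phi> h"
      using image[OF ij] by blast
    have "\<exists>k\<in>carrier K. q k = transv i j t \<and> (\<exists>h. det h = 1 \<and> p k = \<Phi> h)" if t: "\<bar>t\<bar> < min d e" for t
    proof -
      obtain a where "a \<in> carrier K" "q a = transv i j t" "p a = \<rho> (transv i j t)"
        using sec[of "transv i j t"] t ij by (auto simp: det_transv norm_transv)
      moreover obtain h where "det h = 1" "\<rho> (transv i j t) = \<Phi> h" using d(2)[of t] t by auto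
      ultimately show ?thesis by metis
    qed
    then show "\<exists>d>0. \<forall>t. \<bar>t\<bar> < d \<longrightarrow> (\<exists>k\<in>carrier K. q k = transv i j t \<and> (\<exists>h. det h = 1 \<and> p k = \<Phi> h))"
      using d(1) e by (intro exI[of _ "min d e"]) auto
  qed
  define Z where "Z = kernel K (SL UNIV) q"
  have finZ: "finite Z" using q by (simp add: finite_cover_def Z_def)
  have G'_cover: "\<exists>z\<in>Z. \<exists>h. det h = 1 \<and> x = p z ** \<Phi> h" if "x \<in> G'" for x
  proof -
    have "x \<in> p ` topspace S" using p that by (simp add: finite_cover_def covering_map_def)
    then obtain k where k: "k \<in> carrier K" "p k = x"
      using p by (auto simp: finite_cover_def topological_group_def)
    obtain k0 h where k0: "k0 \<in> carrier K" "q k0 = q k" "det h = 1" "p k0 = \<Phi> h"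
      using lift[OF qc[OF k(1)]] by blast
    define z where "z = k \<otimes>\<^bsub>K\<^esub> inv\<^bsub>K\<^esub> k0"
    have zK: "z \<in> carrier K" using k k0 by (simp add: z_def)
    have zk: "z \<otimes>\<^bsub>K\<^esub> k0 = k" using k k0 by (simp add: z_def K.m_assoc)
    have "q z ** q k0 = q k0" using qm[OF zK k0(1)] zk k0(2) by simp
    then have "q z ** (q k0 ** matrix_inv (q k0)) = q k0 ** matrix_inv (q k0)"
      by (simp add: matrix_mul_assoc)
    then have "q z = mat 1" using qc[OF k0(1)] by (simp add: inverse_matrix)
    then have "z \<in> Z" using zK by (simp add: Z_def kernel_def)
    moreover have "x = p z ** \<Phi> h" using pm[OF zK k0(1)] zk k0(4) k(2) by simp
    ultimately show ?thesis using k0(3) by blast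
  qed
  define LC where "LC = lcosets\<^bsub>(SL UNIV)\<lparr>carrier := G\<rparr>\<^esub> G'"
  have "\<exists>a. c = a <#\<^bsub>(SL UNIV)\<lparr>carrier := G\<rparr>\<^esub> G'" if "c \<in> LC" for c
    using that by (auto simp: LC_def LCOSETS_def)
  then obtain r where r: "\<And>c. c \<in> LC \<Longrightarrow> c = r c <#\<^bsub>(SL UNIV)\<lparr>carrier := G\<rparr>\<^esub> G'" by metis
  define Y where "Y = (\<lambda>(c, z). r c ** p z) ` (LC \<times> Z)"
  have "finite Y" using fin finZ by (simp add: Y_def LC_def)
  moreover have "\<exists>y\<in>Y. \<exists>g. det g = 1 \<and> x = y ** \<Phi> g" if x: "x \<in> G" for x
  proof -
    define c where "c = x <#\<^bsub>(SL UNIV)\<lparr>carrier := G\<rparr>\<^esub> G'"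
    have cLC: "c \<in> LC" using x by (auto simp: LC_def LCOSETS_def c_def)
    have "x \<in> c" unfolding c_def l_coset_def using G'1 by force
    then have "x \<in> r c <#\<^bsub>(SL UNIV)\<lparr>carrier := G\<rparr>\<^esub> G'" using r[OF cLC] by simp
    then obtain g1 where g1: "g1 \<in> G'" "x = r c ** g1" by (auto simp: l_coset_def)
    obtain z h where zh: "z \<in> Z" "det h = 1" "g1 = p z ** \<Phi> h" using G'_cover[OF g1(1)] by blast
    have "r c ** p z \<in> Y" using cLC zh(1) by (auto simp: Y_def)
    moreover have "x = (r c ** p z) ** \<Phi> h" using g1(2) zh(3) by (simp add: matrix_mul_assoc)
    ultimately show ?thesis using zh(2) by blast
  qed
  ultimately show ?thesis
    using P \<Phi>G' G'G unfolding \<Phi>_def by blast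
qed

text \<open>
  The images in the coset space of the sets of elements of norm less than \<open>n\<close> are open
  and increase to the whole space, so one of them suffices.
\<close>

lemma cocompact_lattice_bound:
  fixes G :: "(complex^'n^'n) set"
  assumes G: "subgroup G (SL UNIV)"
    and \<Gamma>: "cocompact_lattice \<Gamma> ((SL UNIV)\<lparr>carrier := G\<rparr>) (top_of_set G)"
  shows "\<exists>R. \<forall>x\<in>G. \<exists>y\<in>\<Gamma>. norm (x ** y) \<le> R"
proof -
  let ?G = "(SL UNIV)\<lparr>carrier := G\<rparr>"
  define f where "f x = x <#\<^bsub>?G\<^esub> \<Gamma>" for x
  have sub: "subgroup \<Gamma> ?G" and comp: "compact_space (quotient_topology (top_of_set G) f)"
    using \<Gamma> by (auto simp: cocompact_lattice_def coset_space_def f_def[abs_def])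
  have gG: "group ?G" by (rule group.subgroup_imp_group[OF group_SL G])
  interpret \<Gamma>: subgroup \<Gamma> ?G by (rule sub)
  have f_mem: "z \<in> f x \<longleftrightarrow> (\<exists>y\<in>\<Gamma>. z = x ** y)" for x z by (auto simp: f_def l_coset_def)
  have \<Gamma>1: "mat 1 \<in> \<Gamma>" using \<Gamma>.one_closed by simp
  have \<Gamma>m: "x ** y \<in> \<Gamma>" if "x \<in> \<Gamma>" "y \<in> \<Gamma>" for x y using \<Gamma>.m_closed[OF that] by simp
  have \<Gamma>G: "\<Gamma> \<subseteq> G" using \<Gamma>.subset by simp
  have Gm: "x ** y \<in> G" if "x \<in> G" "y \<in> G" for x y using subgroup.m_closed[OF G that] by simp
  have \<Gamma>inv: "\<exists>y'\<in>\<Gamma>. y ** y' = mat 1" if "y \<in> \<Gamma>" for y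
    using \<Gamma>.m_inv_closed[OF that] group.r_inv[OF gG, of y] that \<Gamma>G
    by (intro bexI[of _ "inv\<^bsub>?G\<^esub> y"]) auto
  have f_shift: "f (x ** y) = f x" if y: "y \<in> \<Gamma>" for x y
  proof (rule Set.set_eqI)
    fix z :: "complex^'n^'n"
    obtain y' where y': "y' \<in> \<Gamma>" "y ** y' = mat 1" using \<Gamma>inv[OF y] by blast
    have "z = x ** y ** (y' ** w)" if "z = x ** w" for w :: "complex^'n^'n"
      using that y'(2) by (metis matrix_mul_assoc matrix_mul_rid)
    then show "z \<in> f (x ** y) \<longleftrightarrow> z \<in> f x"
      unfolding f_mem using \<Gamma>m y y'(1) by (metis matrix_mul_assoc)
  qed
  define U where "U n = f ` {x \<in> G. norm x < real n}" for n
  have openU: "openin (quotient_topology (top_of_set G) f) (U n)" for n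
    unfolding openin_quotient_topology
  proof
    show "U n \<subseteq> f ` topspace (top_of_set G)" by (auto simp: U_def)
    have "f x \<in> U n \<longleftrightarrow> (\<exists>y\<in>\<Gamma>. norm (x ** y) < real n)" if x: "x \<in> G" for x
    proof
      assume "f x \<in> U n"
      then obtain x' where x': "x' \<in> G" "norm x' < real n" "f x = f x'" by (auto simp: U_def)
      have "x' \<in> f x'" unfolding f_mem using \<Gamma>1 by (metis matrix_mul_rid)
      then show "\<exists>y\<in>\<Gamma>. norm (x ** y) < real n" using x'(2,3) f_mem by metis
    next
      assume "\<exists>y\<in>\<Gamma>. norm (x ** y) < real n"
      then obtain y where y: "y \<in> \<Gamma>" "norm (x ** y) < real n" by blast
      then have "f (x ** y) \<in> U n" using Gm[OF x] \<Gamma>G by (auto simp: U_def)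
      then show "f x \<in> U n" using f_shift[OF y(1)] by simp
    qed
    then have eq: "{x \<in> topspace (top_of_set G). f x \<in> U n} = (\<Union>y\<in>\<Gamma>. G \<inter> {x. norm (x ** y) < real n})"
      by auto
    have op: "openin (top_of_set G) (G \<inter> {x. norm (x ** y) < real n})" for y
      by (intro openin_open_Int open_Collect_less continuous_intros)
    show "openin (top_of_set G) {x \<in> topspace (top_of_set G). f x \<in> U n}"
      unfolding eq by (rule openin_Union) (use op in blast)
  qed
  have top: "topspace (quotient_topology (top_of_set G) f) = f ` G"
    by (simp add: topspace_quotient_topology)
  have cover: "f ` G \<subseteq> \<Union>(range U)"
  proof
    fix c assume "c \<in> f ` G"
    then obtain x where x: "x \<in> G" "c = f x" by blast
    obtain n :: nat where "norm x < real n" using reals_Archimedean2 by blast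
    then show "c \<in> \<Union>(range U)" using x by (auto simp: U_def)
  qed
  obtain \<F> where \<F>: "finite \<F>" "\<F> \<subseteq> range U" "f ` G \<subseteq> \<Union>\<F>"
  proof -
    have "\<exists>\<F>. finite \<F> \<and> \<F> \<subseteq> range U \<and> f ` G \<subseteq> \<Union>\<F>"
      using comp openU cover unfolding compact_space_def compactin_def top by auto
    then show ?thesis using that by blast
  qed
  obtain I where I: "finite I" "\<F> = U ` I" using finite_subset_image[OF \<F>(1,2)] by blast
  define R where "R = real (Max (insert 0 I))"
  have "\<exists>y\<in>\<Gamma>. norm (x ** y) \<le> R" if x: "x \<in> G" for x
  proof -
    obtain n where n: "n \<in> I" "f x \<in> U n" using \<F>(3) x I(2) by blast
    then obtain x' where x': "norm x' < real n" "f x = f x'" by (auto simp: U_def)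
    have "x' \<in> f x'" unfolding f_mem using \<Gamma>1 by (metis matrix_mul_rid)
    then obtain y where y: "y \<in> \<Gamma>" "x' = x ** y" using x'(2) f_mem by metis
    have "n \<le> Max (insert 0 I)" using n(1) I(1) by (intro Max_ge) auto
    then have "norm (x ** y) \<le> R" using x'(1) y(2) unfolding R_def by simp
    then show ?thesis using y(1) by blast
  qed
  then show ?thesis by blast
qed

lemma norm_cmat: "norm (cmat A) = norm A"
  by (simp add: norm_vec_def cmat_nth)

theorem propositionA3:
  fixes F :: "complex set"
  assumes "CARD('n::finite) \<ge> 3"
    and "imaginary_quadratic F"
  shows "\<not> (\<exists>G :: (complex ^ 'n ^ 'n) set.
            subgroup G (SL UNIV) \<and>
            closedin (top_of_set (carrier (SL UNIV))) G \<and>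
            isogenous ((SL UNIV)\<lparr>carrier := G\<rparr>) (top_of_set G)
              (SL UNIV :: (real ^ 'n ^ 'n) monoid) (top_of_set (carrier (SL UNIV))) \<and>
            cocompact_lattice (G \<inter> carrier (SL (ring_of_integers F)))
              ((SL UNIV)\<lparr>carrier := G\<rparr>) (top_of_set G))"
proof
  assume "\<exists>G :: (complex ^ 'n ^ 'n) set.
            subgroup G (SL UNIV) \<and>
            closedin (top_of_set (carrier (SL UNIV))) G \<and>
            isogenous ((SL UNIV)\<lparr>carrier := G\<rparr>) (top_of_set G)
              (SL UNIV :: (real ^ 'n ^ 'n) monoid) (top_of_set (carrier (SL UNIV))) \<and>
            cocompact_lattice (G \<inter> carrier (SL (ring_of_integers F)))
              ((SL UNIV)\<lparr>carrier := G\<rparr>) (top_of_set G)"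
  then obtain G :: "(complex ^ 'n ^ 'n) set" where G: "subgroup G (SL UNIV)" and
    iso: "isogenous ((SL UNIV)\<lparr>carrier := G\<rparr>) (top_of_set G)
              (SL UNIV :: (real ^ 'n ^ 'n) monoid) (top_of_set (carrier (SL UNIV)))" and
    lat: "cocompact_lattice (G \<inter> carrier (SL (ring_of_integers F)))
              ((SL UNIV)\<lparr>carrier := G\<rparr>) (top_of_set G)"
    by (elim exE conjE)
  define \<Gamma> where "\<Gamma> = G \<inter> carrier (SL (ring_of_integers F))"
  have \<Gamma>_mem: "x \<in> \<Gamma> \<longleftrightarrow> x \<in> G \<and> det x = 1 \<and> (\<forall>i j. x $ i $ j \<in> ring_of_integers F)" for x
    by (auto simp: \<Gamma>_def SL_def)
  note lat = lat[folded \<Gamma>_def]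
  let ?G = "(SL UNIV)\<lparr>carrier := G\<rparr>"
  have sub: "subgroup \<Gamma> ?G" and disc: "subtopology (top_of_set G) \<Gamma> = discrete_topology \<Gamma>"
    using lat by (auto simp: cocompact_lattice_def)
  have gG: "group ?G" by (rule group.subgroup_imp_group[OF group_SL G])
  interpret \<Gamma>: subgroup \<Gamma> ?G by (rule sub)
  have \<Gamma>1: "mat 1 \<in> \<Gamma>" using \<Gamma>.one_closed by simp
  have \<Gamma>m: "x ** y \<in> \<Gamma>" if "x \<in> \<Gamma>" "y \<in> \<Gamma>" for x y using \<Gamma>.m_closed[OF that] by simp
  have \<Gamma>G: "\<Gamma> \<subseteq> G" using \<Gamma>.subset by simp
  have \<Gamma>inv: "matrix_inv x \<in> \<Gamma>" if "x \<in> \<Gamma>" for x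
  proof -
    have "inv\<^bsub>?G\<^esub> x = matrix_inv x"
      using group.m_inv_consistent[OF group_SL G, of x] that \<Gamma>G \<Gamma>_mem[of x] m_inv_SL[of x] by auto
    then show ?thesis using \<Gamma>.m_inv_closed[OF that] by simp
  qed
  obtain R where R: "\<And>x. x \<in> G \<Longrightarrow> \<exists>y\<in>\<Gamma>. norm (x ** y) \<le> R"
    using cocompact_lattice_bound[OF G lat] by blast
  have teq: "subtopology (top_of_set G) \<Gamma> = top_of_set \<Gamma>"
    using \<Gamma>G by (simp add: subtopology_subtopology inf.absorb2)
  have "openin (subtopology (top_of_set G) \<Gamma>) {mat 1}" unfolding disc using \<Gamma>1 by simp
  then have "\<exists>e>0. \<forall>x\<in>\<Gamma>. dist x (mat 1) < e \<longrightarrow> x \<in> {mat 1}"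
    unfolding teq openin_euclidean_subtopology_iff by blast
  then obtain e where e: "e > 0" "\<And>x. x \<in> \<Gamma> \<Longrightarrow> norm (x - mat 1) < e \<Longrightarrow> x = mat 1"
    by (auto simp: dist_norm)
  obtain P and Y :: "(complex^'n^'n) set" where PY: "det P \<noteq> 0" "finite Y"
    "\<And>g. det g = 1 \<Longrightarrow> conj_embed P g \<in> G"
    "\<And>x. x \<in> G \<Longrightarrow> \<exists>y\<in>Y. \<exists>g. det g = 1 \<and> x = y ** conj_embed P g"
    using isogenous_contains_conjugate[OF assms(1) G iso] by metis
  note P = inverse_matrix[OF PY(1)]
  define \<Phi> where "\<Phi> = conj_embed P"
  have \<Phi>_mult: "\<Phi> (g ** h) = \<Phi> g ** \<Phi> h" for g h unfolding \<Phi>_def by (rule conj_embed_mult[OF PY(1)])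
  have \<Phi>_one: "\<Phi> (mat 1) = mat 1" unfolding \<Phi>_def by (rule conj_embed_one[OF PY(1)])
  have \<Phi>_inv: "\<Phi> (matrix_inv g) = matrix_inv (\<Phi> g)" if "det g = 1" for g
    unfolding \<Phi>_def using that by (intro conj_embed_inv[OF PY(1)]) simp
  have \<Phi>_det: "det (\<Phi> g) = of_real (det g)" for g unfolding \<Phi>_def by (rule det_embed[OF PY(1)])
  have \<Phi>_back: "cmat g = matrix_inv P ** \<Phi> g ** P" for g unfolding \<Phi>_def by (rule conj_embed_back[OF PY(1), symmetric])
  obtain K where K: "K > 0" "\<And>(A :: complex^'n^'n) B :: complex^'n^'n. norm (A ** B) \<le> norm A * norm B * K"
    using bounded_bilinear.pos_bounded[OF bounded_bilinear_matrix_mult[where 'a = complex and 'k = 'n and 'n = 'n and 'm = 'n]]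
    by (elim exE conjE) blast
  define C where "C = norm P * norm (matrix_inv P) * K * K + 1"
  have C: "C > 0" using K by (simp add: C_def add_nonneg_pos)
  have sandwich: "norm (A ** Z ** B) \<le> C * norm Z"
    if "norm A * norm B = norm P * norm (matrix_inv P)" for A Z B :: "complex^'n^'n"
  proof -
    have "norm (A ** Z ** B) \<le> norm (A ** Z) * norm B * K" by (rule K)
    also have "\<dots> \<le> (norm A * norm Z * K) * norm B * K"
      using K by (intro mult_right_mono K(2)) auto
    also have "\<dots> = (norm P * norm (matrix_inv P) * K * K) * norm Z"
      unfolding that[symmetric] by (simp add: mult_ac)
    also have "\<dots> \<le> C * norm Z" unfolding C_def by (intro mult_right_mono) auto
    finally show ?thesis .
  qed
  have \<Phi>_bound: "norm (\<Phi> g - mat 1) \<le> C * norm (g - mat 1)" for g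
  proof -
    have "\<Phi> g - mat 1 = P ** cmat (g - mat 1) ** matrix_inv P"
      using linear_diff[OF linear_cmat, of g "mat 1"] by (simp add: \<Phi>_def conj_embed_def matrix_distribs P)
    then show ?thesis using sandwich[of P "matrix_inv P" "cmat (g - mat 1)"] by (simp add: norm_cmat)
  qed
  have \<Phi>_bound': "norm g \<le> C * norm (\<Phi> g)" for g
    using sandwich[of "matrix_inv P" P "\<Phi> g"] \<Phi>_back[of g] norm_cmat[of g] by (simp add: mult.commute)
  \<comment> \<open>the traces of \<open>\<Gamma>\<close> on finitely many cosets \<open>y P SL\<^sub>n(\<real>) P\<inverse>\<close> differ from \<open>L\<close> by the factors \<open>\<delta> y\<close>\<close>
  define L where "L = {s. det s = 1 \<and> \<Phi> s \<in> \<Gamma>}"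
  have L_mem: "s \<in> L \<longleftrightarrow> det s = 1 \<and> (\<forall>i j. conj_embed P s $ i $ j \<in> ring_of_integers F)" for s
    using PY(3)[of s] \<Phi>_det[of s] by (auto simp: L_def \<Gamma>_mem \<Phi>_def)
  have "\<exists>\<delta>\<in>\<Gamma>. \<forall>x\<in>\<Gamma>. (\<exists>g. det g = 1 \<and> x = y ** \<Phi> g) \<longrightarrow> (\<exists>h. det h = 1 \<and> \<delta> = y ** \<Phi> h)" for y
    using \<Gamma>1 by blast
  then obtain \<delta> where \<delta>: "\<And>y. \<delta> y \<in> \<Gamma>"
    "\<And>x y g. x \<in> \<Gamma> \<Longrightarrow> det g = 1 \<Longrightarrow> x = y ** \<Phi> g \<Longrightarrow> \<exists>h. det h = 1 \<and> \<delta> y = y ** \<Phi> h"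
    by metis
  define B where "B = (\<Sum>y\<in>Y. norm (\<delta> y))"
  have "uniform_lattice L (e / C) (C * (\<bar>R\<bar> * B * K))"
  proof
    show "mat 1 \<in> L" using \<Gamma>1 by (simp add: L_def \<Phi>_one)
    show "x ** y \<in> L" if "x \<in> L" "y \<in> L" for x y
      using that \<Gamma>m by (simp add: L_def det_mul \<Phi>_mult)
    show "matrix_inv x \<in> L" if "x \<in> L" for x
      using that \<Gamma>inv by (simp add: L_def det_matrix_inv \<Phi>_inv)
    show "det x = 1" if "x \<in> L" for x using that by (simp add: L_def)
    show "e / C > 0" using e C by simp
    show "x = mat 1" if x: "x \<in> L" "norm (x - mat 1) < e / C" for x
    proof -
      have "C * norm (x - mat 1) < e" using x(2) C by (simp add: pos_less_divide_eq mult.commute)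
      then have "\<Phi> x = mat 1" using \<Phi>_bound[of x] x(1) by (intro e(2)) (auto simp: L_def)
      then have "cmat x = cmat (mat 1)" using \<Phi>_back[of x] by (simp add: P)
      then show ?thesis by (rule cmat_inj)
    qed
    show "\<exists>x\<in>L. norm (g ** x) \<le> C * (\<bar>R\<bar> * B * K)" if g: "det g = 1" for g
    proof -
      have "\<Phi> g \<in> G" using PY(3)[OF g] by (simp add: \<Phi>_def)
      then obtain \<gamma> where \<gamma>: "\<gamma> \<in> \<Gamma>" "norm (\<Phi> g ** \<gamma>) \<le> R" using R by blast
      have d\<gamma>: "det \<gamma> \<noteq> 0" using \<gamma>(1) \<Gamma>_mem by simp
      obtain y h where y: "y \<in> Y" "det h = 1" "matrix_inv \<gamma> = y ** \<Phi> h"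
        using PY(4)[of "matrix_inv \<gamma>"] \<Gamma>inv[OF \<gamma>(1)] \<Gamma>G unfolding \<Phi>_def by blast
      obtain h' where h': "det h' = 1" "\<delta> y = y ** \<Phi> h'"
        using \<delta>(2)[OF \<Gamma>inv[OF \<gamma>(1)] y(2,3)] by blast
      define s where "s = matrix_inv h ** h'"
      have ds: "det s = 1" using y(2) h'(1) by (simp add: s_def det_mul det_matrix_inv)
      have "y = matrix_inv \<gamma> ** \<Phi> (matrix_inv h)"
      proof -
        have "matrix_inv \<gamma> ** \<Phi> (matrix_inv h) = y ** \<Phi> (h ** matrix_inv h)"
          unfolding y(3) by (simp add: \<Phi>_mult matrix_mul_assoc)
        then show ?thesis using y(2) by (simp add: inverse_matrix \<Phi>_one)
      qed
      then have "\<delta> y = matrix_inv \<gamma> ** \<Phi> s"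
        using h'(2) by (simp add: s_def \<Phi>_mult matrix_mul_assoc)
      then have \<Phi>s: "\<Phi> s = \<gamma> ** \<delta> y"
        using d\<gamma> by (simp add: matrix_mul_assoc inverse_matrix)
      then have "s \<in> L" using ds \<Gamma>m[OF \<gamma>(1) \<delta>(1)] by (simp add: L_def)
      moreover have "norm (g ** s) \<le> C * (\<bar>R\<bar> * B * K)"
      proof -
        have "norm (\<Phi> (g ** s)) = norm ((\<Phi> g ** \<gamma>) ** \<delta> y)"
          by (simp add: \<Phi>_mult \<Phi>s matrix_mul_assoc)
        also have "\<dots> \<le> norm (\<Phi> g ** \<gamma>) * norm (\<delta> y) * K" by (rule K)
        also have "\<dots> \<le> \<bar>R\<bar> * B * K"
        proof (intro mult_right_mono mult_mono)
          show "norm (\<delta> y) \<le> B"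
            unfolding B_def using y(1) PY(2) by (intro member_le_sum) auto
        qed (use \<gamma>(2) K in auto)
        finally have "C * norm (\<Phi> (g ** s)) \<le> C * (\<bar>R\<bar> * B * K)" using C by simp
        then show ?thesis using \<Phi>_bound'[of "g ** s"] by linarith
      qed
      ultimately show ?thesis by blast
    qed
  qed
  then show False
    using no_integral_lattice[OF _ assms(1,2) PY(1) L_mem] by blast
qed

end
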